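(* There is a universal constant $C>0$ such that for every weighted finite graph $G$ with $N$ vertices and all $1\leq k\leq l\leq N$, \[ 1-\overline{h}(k)\leq Clk^6\,\frac{2-\lambda_{N-k+1}}{\sqrt{2-\lambda_{N-l+1}}}. \]
   Context: $G=(V,E,w)$ is a finite undirected graph without self-loops, $N=|V|$, positive symmetric edge weights $w_{uv}$ ($w_{uv}=0$ for non-edges), degrees $d_u=\sum_vw_{uv}$ (implicitly positive). $|E(A,B)|:=\sum_{u\in A,v\in B}w_{uv}$, $\mathrm{vol}(A)=\sum_{u\in A}d_u$. The normalized Laplacian $\Delta f(u)=\frac{1}{d_u}\sum_vw_{uv}(f(u)-f(v))$ has eigenvalues (with multiplicity) $0=\lambda_1\leq\cdots\leq\lambda_N\leq2$. For disjoint $V_1,V_2$ with $V_1\cup V_2\neq\emptyset$, $\overline{\phi}(V_1,V_2)=2|E(V_1,V_2)|/\mathrm{vol}(V_1\cup V_2)$; $\overline{h}(k):=\max\min_{1\leq i\leq k}\overline{\phi}(V_{2i-1},V_{2i})$ over all collections of $k$ pairs $(V_1,V_2),\ldots,(V_{2k-1},V_{2k})$ of pairwise disjoint subsets of $V$ with $V_{2i-1}\cup V_{2i}\neq\emptyset$ for each $i$. *)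

theory Defs
  imports Complex_Main "Jordan_Normal_Form.Char_Poly"
begin

definition wgraph :: "nat \<Rightarrow> (nat \<Rightarrow> nat \<Rightarrow> real) \<Rightarrow> bool" where
  "wgraph N w \<longleftrightarrow>
     (\<forall>u<N. \<forall>v<N. w u v \<ge> 0 \<and> w u v = w v u) \<and>
     (\<forall>u<N. w u u = 0) \<and>
     (\<forall>u<N. (\<Sum>v<N. w u v) > 0)"

definition deg :: "nat \<Rightarrow> (nat \<Rightarrow> nat \<Rightarrow> real) \<Rightarrow> nat \<Rightarrow> real" where
  "deg N w u = (\<Sum>v<N. w u v)"

definition vol :: "nat \<Rightarrow> (nat \<Rightarrow> nat \<Rightarrow> real) \<Rightarrow> nat set \<Rightarrow> real" where
  "vol N w A = (\<Sum>u\<in>A. deg N w u)"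

definition edges_between :: "(nat \<Rightarrow> nat \<Rightarrow> real) \<Rightarrow> nat set \<Rightarrow> nat set \<Rightarrow> real" where
  "edges_between w A B = (\<Sum>u\<in>A. \<Sum>v\<in>B. w u v)"

definition phibar :: "nat \<Rightarrow> (nat \<Rightarrow> nat \<Rightarrow> real) \<Rightarrow> nat set \<Rightarrow> nat set \<Rightarrow> real" where
  "phibar N w A B = 2 * edges_between w A B / vol N w (A \<union> B)"

definition admissible_pairs :: "nat \<Rightarrow> nat \<Rightarrow> (nat \<Rightarrow> nat set) \<Rightarrow> (nat \<Rightarrow> nat set) \<Rightarrow> bool" where
  "admissible_pairs N k A B \<longleftrightarrow>
     (\<forall>i<k. A i \<subseteq> {..<N} \<and> B i \<subseteq> {..<N} \<and> A i \<union> B i \<noteq> {}) \<and>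
     (\<forall>i<k. \<forall>j<k. A i \<inter> B j = {}) \<and>
     (\<forall>i<k. \<forall>j<k. i \<noteq> j \<longrightarrow> A i \<inter> A j = {} \<and> B i \<inter> B j = {})"

definition hbar :: "nat \<Rightarrow> (nat \<Rightarrow> nat \<Rightarrow> real) \<Rightarrow> nat \<Rightarrow> real" where
  "hbar N w k = Max {Min {phibar N w (A i) (B i) | i. i < k} | A B. admissible_pairs N k A B}"

definition norm_laplacian :: "nat \<Rightarrow> (nat \<Rightarrow> nat \<Rightarrow> real) \<Rightarrow> real mat" where
  "norm_laplacian N w = mat N N (\<lambda>(u,v). (if u = v then 1 else 0) - w u v / deg N w u)"

text \<open>Eigenvalues with multiplicity in nondecreasing order: the sorted list of roots of the
  characteristic polynomial (which splits over the reals, L being similar to a symmetric matrix).\<close>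
definition laplacian_eigenvalues :: "nat \<Rightarrow> (nat \<Rightarrow> nat \<Rightarrow> real) \<Rightarrow> real list" where
  "laplacian_eigenvalues N w = (THE xs. sorted xs \<and> length xs = N \<and>
       char_poly (norm_laplacian N w) = (\<Prod>x\<leftarrow>xs. [:- x, 1:]))"

text \<open>lambda_i for 1 \<le> i \<le> N (1-based indexing as in the paper).\<close>
definition lambda :: "nat \<Rightarrow> (nat \<Rightarrow> nat \<Rightarrow> real) \<Rightarrow> nat \<Rightarrow> real" where
  "lambda N w i = laplacian_eigenvalues N w ! (i - 1)"

end

theory Submission
  imports Defs "HOL-Analysis.L2_Norm" "HOL-Library.FuncSet"
begin

text \<open>
  Write \<open>\<mu> k = 2 - \<lambda> (N - k + 1)\<close>; it is the \<open>k\<close>-th smallest eigenvalue of the quadratic form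
  \<open>\<Sum> w u v * (f u + f v)\<^sup>2\<close>.

  The top \<open>k\<close> eigenfunctions embed the vertices into \<open>\<real>\<^sup>k\<close>. Orthonormality forbids more than about
  unit mass near any single line through the origin, so region growing in the projective distance
  produces \<open>k\<close> well separated sets of vertices of mass at least \<open>1/2\<close>. Cutting the embedding off
  around these sets and keeping the best coordinate gives \<open>k\<close> disjointly supported functions
  whose Rayleigh quotient is \<open>O(k\<^sup>6) * \<mu> k\<close>.

  Each such function \<open>f\<close> is swept after composition with the odd primitive of the distance to a
  set of \<open>2 * l\<close> thresholds. The thresholds are chosen so that every interval between them captures
  the same amount of the norm of \<open>f\<close>; if they did not exhaust the range of \<open>f\<close>, the truncations
  of \<open>f\<close> to these intervals would be too many disjointly supported functions of small energy,
  contradicting the min-max principle for \<open>\<mu> l\<close>. The sweep therefore loses only a factor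
  \<open>O(l / sqrt (\<mu> l))\<close>.
\<close>

section \<open>Spectral theorem for real symmetric matrices\<close>

text \<open>Lines replace points because \<open>dual_energy\<close> is small when adjacent vertices
  carry nearly opposite vectors, so a distance adapted to it must identify \<open>x\<close> with
  \<open>- x\<close>. The power \<open>k ^ 6\<close> arises as follows. To extract \<open>k\<close>
  groups of mass \<open>1 / 2\<close> from total mass \<open>k\<close>, the loss in region growing
  and the excess of a cluster mass over \<open>1\<close> must both be a fraction of order
  \<open>1 / k\<close>. Hence a growth rate and a squared radius of order \<open>1 / k\<close>.
  Against the doubling constant \<open>32 ^ k\<close> this takes order \<open>k ^ 2\<close> layers,
  so the clusters are separated by order \<open>1 / (k ^ 2 * sqrt k)\<close>. The squared slope of
  the cutoffs costs \<open>k ^ 5\<close>, and adding the energies of \<open>k\<close> coordinates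
  costs one more \<open>k\<close>. Sweeping \<open>f * \<bar>f\<bar>\<close> would bound the loss
  only by the square root of the Rayleigh quotient. The primitive replaces the factor
  \<open>\<bar>f\<bar>\<close> by the distance to the thresholds, whose squared norm is itself of
  the order of the energy divided by the gap, and so the bound becomes linear in the energy. If
  \<open>dual_gap N w l = 0\<close>, division by zero makes the right-hand side \<open>0\<close>;
  the claim is then \<open>hbar N w k \<ge> 1\<close> and needs its own argument.\<close>

lemma real_symmetric_eigenvalue_real:
  fixes A :: "real mat"
  assumes A: "A \<in> carrier_mat n n" and sym: "A\<^sup>T = A"
    and ev: "eigenvalue (map_mat complex_of_real A) a"
  shows "a \<in> \<real>"
proof -
  let ?B = "map_mat complex_of_real A"
  have B: "?B \<in> carrier_mat n n" using A by auto
  from ev obtain v where v: "v \<in> carrier_vec n" "v \<noteq> 0\<^sub>v n" and eq: "?B *\<^sub>v v = a \<cdot>\<^sub>v v"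
    using A unfolding eigenvalue_def eigenvector_def by auto
  have symij: "A $$ (i,j) = A $$ (j,i)" if "i < n" "j < n" for i j
    using that A sym by (metis carrier_matD index_transpose_mat(1))
  have row: "(\<Sum>j<n. complex_of_real (A $$ (i,j)) * v $ j) = a * v $ i" if "i < n" for i
  proof -
    have "(?B *\<^sub>v v) $ i = (\<Sum>j<n. complex_of_real (A $$ (i,j)) * v $ j)"
      using A v that by (auto simp: scalar_prod_def row_def intro!: sum.cong)
    then show ?thesis using eq v that by auto
  qed
  \<comment> \<open>The Hermitian form of \<open>A\<close> at \<open>v\<close>: symmetry makes it
    self-conjugate, the eigenvalue equation makes it \<open>a\<close> times the positive number
    \<open>m\<close>.\<close>
  define s where "s = (\<Sum>i<n. \<Sum>j<n. cnj (v $ i) * complex_of_real (A $$ (i,j)) * v $ j)"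
  define m where "m = (\<Sum>i<n. (cmod (v $ i))\<^sup>2)"
  have s: "s = a * complex_of_real m"
  proof -
    have "s = (\<Sum>i<n. cnj (v $ i) * (\<Sum>j<n. complex_of_real (A $$ (i,j)) * v $ j))"
      unfolding s_def by (simp add: sum_distrib_left mult.assoc)
    also have "\<dots> = (\<Sum>i<n. a * complex_of_real ((cmod (v $ i))\<^sup>2))"
    proof (rule sum.cong[OF refl])
      fix i assume "i \<in> {..<n}"
      then show "cnj (v $ i) * (\<Sum>j<n. complex_of_real (A $$ (i,j)) * v $ j)
        = a * complex_of_real ((cmod (v $ i))\<^sup>2)"
        using row[of i] complex_norm_square[of "v $ i"] by (simp del: of_real_power)
    qed
    finally show ?thesis unfolding m_def by (simp add: sum_distrib_left)
  qed
  have "cnj s = (\<Sum>i<n. \<Sum>j<n. v $ i * complex_of_real (A $$ (i,j)) * cnj (v $ j))"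
    unfolding s_def by simp
  also have "\<dots> = (\<Sum>j<n. \<Sum>i<n. v $ i * complex_of_real (A $$ (i,j)) * cnj (v $ j))"
    by (rule sum.swap)
  also have "\<dots> = s" unfolding s_def
    by (intro sum.cong refl) (use symij in \<open>simp add: mult_ac\<close>)
  finally have "s \<in> \<real>" using Reals_cnj_iff by blast
  moreover have "m \<noteq> 0"
  proof
    assume "m = 0"
    then have "\<forall>i<n. v $ i = 0" unfolding m_def
      by (subst (asm) sum_nonneg_eq_0_iff) auto
    then have "v = 0\<^sub>v n" using v by (intro eq_vecI) auto
    then show False using v by simp
  qed
  ultimately show ?thesis using s
    by (metis Reals_divide Reals_of_real nonzero_eq_divide_eq of_real_eq_0_iff)
qed

text \<open>The factorization exists over the complex numbers; its roots are eigenvalues, hence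
  real, and injectivity of the coefficient embedding carries it back to real polynomials.\<close>

lemma real_symmetric_char_poly_splits:
  fixes A :: "real mat"
  assumes A: "A \<in> carrier_mat n n" and sym: "A\<^sup>T = A"
  shows "\<exists>es. length es = n \<and> char_poly A = (\<Prod>e\<leftarrow>es. [:- e, 1:])"
proof -
  let ?B = "map_mat complex_of_real A"
  have B: "?B \<in> carrier_mat n n" using A by auto
  obtain as where as: "char_poly ?B = (\<Prod>a\<leftarrow>as. [:- a, 1:])" "length as = n"
    using char_poly_factorized[OF B] by blast
  have real: "a \<in> \<real>" if "a \<in> set as" for a
  proof (rule real_symmetric_eigenvalue_real[OF A sym])
    have "poly (char_poly ?B) a = 0" unfolding as poly_prod_list
      by (rule prod_list_zero_iff[THEN iffD2]) (use that in auto)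
    then show "eigenvalue ?B a" using eigenvalue_root_char_poly[OF B] by simp
  qed
  define es where "es = map Re as"
  have as_es: "as = map complex_of_real es" unfolding es_def
    using real by (induction as) auto
  have lin: "map_poly complex_of_real [:- e, 1:] = [:- complex_of_real e, 1:]" for e
    by (rule poly_eqI) (auto simp: coeff_map_poly coeff_pCons split: nat.splits)
  interpret map_poly_inj_comm_ring_hom complex_of_real ..
  have "map_poly complex_of_real (\<Prod>e\<leftarrow>es. [:- e, 1:]) = (\<Prod>e\<leftarrow>es. [:- complex_of_real e, 1:])"
    by (induction es) (simp_all add: hom_mult lin del: mult_pCons_left)
  then have "map_poly complex_of_real (char_poly A) = map_poly complex_of_real (\<Prod>e\<leftarrow>es. [:- e, 1:])"
    using as(1) of_real_hom.char_poly_hom[OF A, where ?'a = complex] by (simp add: as_es o_def)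
  then have "char_poly A = (\<Prod>e\<leftarrow>es. [:- e, 1:])" by (rule injectivity)
  then show ?thesis using as(2) as_es by auto
qed

text \<open>Householder reflection: with \<open>z\<close> the difference of \<open>v\<close> and the
  first unit vector, reflecting along \<open>z\<close> exchanges the two. If they coincide,
  \<open>z\<close> vanishes and the identity serves instead.\<close>

lemma unit_vector_reflection:
  assumes v: "(v :: real vec) \<in> carrier_vec n" and vv: "v \<bullet> v = 1" and n: "0 < n"
  shows "\<exists>W \<in> carrier_mat n n. W\<^sup>T = W \<and> W * W = 1\<^sub>m n \<and> col W 0 = v"
proof (cases "v = unit_vec n 0")
  case True
  then show ?thesis using n by (intro bexI[of _ "1\<^sub>m n"]) auto
next
  case False
  define z where "z i = v $ i - (if i = 0 then 1 else 0)" for i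
  define q where "q = (\<Sum>i<n. (z i)\<^sup>2)"
  define W where "W = mat n n (\<lambda>(i,j). (if i = j then 1 else 0) - 2 * z i * z j / q)"
  have W: "W \<in> carrier_mat n n" unfolding W_def by simp
  have vv': "(\<Sum>i<n. (v $ i)\<^sup>2) = 1" using vv v
    by (auto simp: scalar_prod_def power2_eq_square atLeast0LessThan)
  have "q \<noteq> 0"
  proof
    assume "q = 0"
    then have "\<forall>i<n. z i = 0" unfolding q_def by (subst (asm) sum_nonneg_eq_0_iff) auto
    then have "v = unit_vec n 0" using v unfolding z_def by (intro eq_vecI) (auto split: if_splits)
    then show False using False by simp
  qed
  \<comment> \<open>Since \<open>v\<close> has norm 1, the squared length of \<open>z\<close> is
    \<open>2 - 2 * v $ 0\<close>. This is what turns column 0 of \<open>W\<close> into the first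
    unit vector plus \<open>z\<close>, that is, into \<open>v\<close>.\<close>
  have q: "q = - 2 * z 0"
  proof -
    have "q = (\<Sum>i<n. (v $ i)\<^sup>2 + (if i = 0 then 1 - 2 * v $ 0 else 0))"
      unfolding q_def z_def by (intro sum.cong) (auto simp: power2_eq_square algebra_simps)
    also have "\<dots> = 1 + (1 - 2 * v $ 0)"
      unfolding sum.distrib vv' using n by (simp add: sum.delta')
    finally show ?thesis by (simp add: z_def)
  qed
  have "W\<^sup>T = W" unfolding W_def by (intro eq_matI) auto
  moreover have "col W 0 = v"
    using \<open>q \<noteq> 0\<close> n v by (intro eq_vecI) (auto simp: W_def q z_def field_simps)
  moreover have "W * W = 1\<^sub>m n"
  proof (rule eq_matI)
    fix i j assume ij: "i < dim_row (1\<^sub>m n :: real mat)" "j < dim_col (1\<^sub>m n :: real mat)"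
    then have "(W * W) $$ (i,j) = (\<Sum>r<n. ((if i = r then 1 else 0) - 2 * z i * z r / q) * 
       ((if r = j then 1 else 0) - 2 * z r * z j / q))"
      unfolding W_def by (auto simp: scalar_prod_def atLeast0LessThan)
    also have "\<dots> = (\<Sum>r<n. (if r = i then (if i = j then 1 else 0) - 2 * z i * z j / q else 0)
        - (if r = j then 2 * z i * z j / q else 0) + (4 * z i * z j / q\<^sup>2) * (z r)\<^sup>2)"
      by (intro sum.cong) (auto simp: algebra_simps power2_eq_square)
    also have "\<dots> = (if i = j then 1 else 0) - 4 * z i * z j / q + 4 * z i * z j / q\<^sup>2 * q"
      unfolding sum.distrib sum_subtractf sum_distrib_left[symmetric] using ij 
      by (simp add: sum.delta q_def)
    also have "\<dots> = (1\<^sub>m n) $$ (i,j)" using ij \<open>q \<noteq> 0\<close> by (simp add: power2_eq_square)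
    finally show "(W * W) $$ (i,j) = (1\<^sub>m n) $$ (i,j)" .
  qed (auto simp: W_def)
  ultimately show ?thesis using W by blast
qed

text \<open>Deflation, by induction on the list of roots: conjugating with a reflection moves an
  eigenvector for \<open>e\<close> to the first basis vector, and symmetry then splits off a block
  of size 1. The roots are consumed in the given order, so column \<open>i\<close> of
  \<open>U\<close> belongs to \<open>es ! i\<close> and a sorted list yields a sorted
  eigenbasis.\<close>

lemma real_symmetric_diagonalizable:
  fixes A :: "real mat"
  assumes "A \<in> carrier_mat n n" "A\<^sup>T = A" "char_poly A = (\<Prod>e\<leftarrow>es. [:- e, 1:])" 
  shows "\<exists>U \<in> carrier_mat n n. U\<^sup>T * U = 1\<^sub>m n \<and> A * U = U * mat n n (\<lambda>(i,j). if i = j then es ! i else 0)"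
  using assms
proof (induction es arbitrary: n A)
  case Nil
  then have "n = 0" using degree_monic_char_poly[of A n] by auto
  then show ?case using Nil by (intro bexI[of _ "1\<^sub>m 0"]) auto
next
  case (Cons e es)
  note A = Cons.prems(1)
  have deg: "degree (\<Prod>e\<leftarrow>x # xs. [:- e, 1:]) = Suc (length xs)" for x :: real and xs 
    using degree_linear_factors[of uminus "x#xs"] by simp
  obtain m where n: "n = Suc m"
    using degree_monic_char_poly[OF A] Cons.prems(3) deg[of e es] by auto
  have "eigenvalue A e"
    unfolding eigenvalue_root_char_poly[OF A] Cons.prems(3) by simp
  then obtain v0 where v0: "v0 \<in> carrier_vec n" "v0 \<noteq> 0\<^sub>v n" "A *\<^sub>v v0 = e \<cdot>\<^sub>v v0"
    using A unfolding eigenvalue_def eigenvector_def by auto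
  have pos: "v0 \<bullet> v0 > 0"
    using v0(1,2) conjugate_square_greater_0_vec[of v0 n] by simp
  define v where "v = (1 / sqrt (v0 \<bullet> v0)) \<cdot>\<^sub>v v0"
  have v: "v \<in> carrier_vec n" "v \<bullet> v = 1" "A *\<^sub>v v = e \<cdot>\<^sub>v v"
    using v0 pos A unfolding v_def
    by (auto simp: mult_mat_vec[OF A v0(1)] smult_smult_assoc mult_ac)
  obtain W where W: "W \<in> carrier_mat n n" "W\<^sup>T = W" "W * W = 1\<^sub>m n" "col W 0 = v"
    using unit_vector_reflection[OF v(1,2)] n by auto
  define A' where "A' = W * A * W"
  have A': "A' \<in> carrier_mat n n" using A W unfolding A'_def by auto
  have symA': "A'\<^sup>T = A'" unfolding A'_def using A W Cons.prems(2)
    by (simp add: transpose_mult[of _ n n _ n] assoc_mult_mat[of _ n n _ n _ n])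
  have "W * A' = (W * W) * (A * W)" unfolding A'_def using A W(1)
    by (simp add: assoc_mult_mat[of _ n n _ n _ n])
  then have WA': "W * A' = A * W" using A W(1,3) by simp
  have "similar_mat_wit A' A W W" unfolding similar_mat_wit_def Let_def A'_def using A W by auto
  then have cp: "char_poly A' = char_poly A" 
    using char_poly_similar unfolding similar_mat_def by blast
  have col0: "col A' 0 = e \<cdot>\<^sub>v unit_vec n 0"
  proof -
    have AW: "A * W \<in> carrier_mat n n" and "A' = W * (A * W)"
      unfolding A'_def using A W(1) by auto
    then have "col A' 0 = W *\<^sub>v (A *\<^sub>v col W 0)"
      using col_mult2[OF W(1) AW, of 0] col_mult2[OF A W(1), of 0] n by simp
    also have "\<dots> = e \<cdot>\<^sub>v (W *\<^sub>v col W 0)" using v W by (simp add: mult_mat_vec)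
    also have "W *\<^sub>v col W 0 = col (W * W) 0"
      using n by (subst col_mult2[OF W(1) W(1)]) auto
    also have "\<dots> = unit_vec n 0" using W n by simp
    finally show ?thesis .
  qed
  define A3 where "A3 = mat m m (\<lambda>(i,j). A' $$ (Suc i, Suc j))"
  have A3: "A3 \<in> carrier_mat m m" unfolding A3_def by auto
  have sA': "A' $$ (i,j) = A' $$ (j,i)" if "i < n" "j < n" for i j
    using that A' symA' by (metis carrier_matD index_transpose_mat(1))
  have c0: "A' $$ (i,0) = (if i = 0 then e else 0)" if "i < n" for i
  proof -
    have "A' $$ (i,0) = col A' 0 $ i" using that A' n by auto
    then show ?thesis unfolding col0 using that n by auto
  qed
  have blk: "A' = four_block_mat (mat 1 1 (\<lambda>_. e)) (0\<^sub>m 1 m) (0\<^sub>m m 1) A3"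
    using A' n c0 sA'[of 0] by (intro eq_matI) (auto simp: A3_def)
  have "char_poly A' = [:- e, 1:] * char_poly A3"
    unfolding blk by (subst char_poly_four_block_zeros_col) (auto simp: A3 char_poly_defs det_single)
  then have cp3: "char_poly A3 = (\<Prod>e\<leftarrow>es. [:- e, 1:])"
    using cp Cons.prems(3) by (auto simp del: mult_pCons_left)
  have sym3: "A3\<^sup>T = A3" unfolding A3_def using sA' n by (intro eq_matI) auto
  obtain U3 where U3: "U3 \<in> carrier_mat m m" "U3\<^sup>T * U3 = 1\<^sub>m m"
    "A3 * U3 = U3 * mat m m (\<lambda>(i,j). if i = j then es ! i else 0)"
    using Cons.IH[OF A3 sym3 cp3] by blast
  define U' where "U' = four_block_mat (1\<^sub>m 1) (0\<^sub>m 1 m) (0\<^sub>m m 1) U3"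
  have U': "U' \<in> carrier_mat n n" unfolding U'_def n using U3 by auto
  have U'U': "U'\<^sup>T * U' = 1\<^sub>m n"
  proof -
    have "U'\<^sup>T = four_block_mat (1\<^sub>m 1) (0\<^sub>m 1 m) (0\<^sub>m m 1) (U3\<^sup>T)" unfolding U'_def
      using U3 by (subst transpose_four_block_mat) auto
    then show ?thesis unfolding U'_def n using U3
      by (simp add: mult_four_block_mat[of _ 1 1 _ m _ m _ _ 1 _ m])
  qed
  define D where "D = mat n n (\<lambda>(i,j). if i = j then (e # es) ! i else 0)"
  have D: "D \<in> carrier_mat n n" unfolding D_def by auto
  have Dblk: "D = four_block_mat (mat 1 1 (\<lambda>_. e)) (0\<^sub>m 1 m) (0\<^sub>m m 1) (mat m m (\<lambda>(i,j). if i = j then es ! i else 0))"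
    unfolding D_def n by (intro eq_matI) (auto simp: nth_Cons')
  have A'U': "A' * U' = U' * D" unfolding U'_def Dblk blk using U3 A3
      by (simp add: mult_four_block_mat[of _ 1 1 _ m _ m _ _ 1 _ m])
  have "(W * U')\<^sup>T * (W * U') = 1\<^sub>m n"
  proof -
    have "(W * U')\<^sup>T * (W * U') = U'\<^sup>T * (W * W) * U'" using W(1,2) U'
      by (simp add: transpose_mult[of _ n n _ n] assoc_mult_mat[of _ n n _ n _ n])
    then show ?thesis using W U' U'U' by simp
  qed
  moreover have "A * (W * U') = W * U' * D"
  proof -
    have "A * (W * U') = (A * W) * U'" using A W(1) U'
      by (simp add: assoc_mult_mat[of _ n n _ n _ n])
    also have "\<dots> = W * (A' * U')" unfolding WA'[symmetric] using A' W(1) U'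
      by (simp add: assoc_mult_mat[of _ n n _ n _ n])
    finally show ?thesis unfolding A'U' using W U' D
      by (simp add: assoc_mult_mat[of _ n n _ n _ n])
  qed
  ultimately show ?case unfolding D_def using W U' by (intro bexI[of _ "W * U'"]) auto
qed

text \<open>Unique factorization, by cancelling one root at a time; it provides the uniqueness
  behind the definite description in \<open>laplacian_eigenvalues\<close>.\<close>

lemma prod_linear_factors_mset:
  "(\<Prod>x\<leftarrow>xs. [:- x, 1::real:]) = (\<Prod>x\<leftarrow>ys. [:- x, 1:]) \<Longrightarrow> mset xs = mset ys"
proof (induction xs arbitrary: ys)
  case Nil
  then have "length ys = 0" using degree_linear_factors[of uminus ys] by simp
  then show ?case by simp
next
  case (Cons x xs)
  have "poly (\<Prod>x\<leftarrow>ys. [:- x, 1:]) x = 0" using Cons.prems[symmetric] by simp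
  then have "x \<in> set ys" by (auto simp: poly_prod_list prod_list_zero_iff)
  then have ys: "mset ys = mset (x # remove1 x ys)" by simp
  then have "(\<Prod>x\<leftarrow>ys. [:- x, 1:]) = (\<Prod>x\<leftarrow>x # remove1 x ys. [:- x, 1:])"
    by (simp only: prod_mset_prod_list[symmetric] mset_map ys)
  then have "[:- x, 1:] * (\<Prod>x\<leftarrow>xs. [:- x, 1:]) = [:- x, 1:] * (\<Prod>x\<leftarrow>remove1 x ys. [:- x, 1:])"
    using Cons.prems by (simp del: mult_pCons_left)
  then have "(\<Prod>x\<leftarrow>xs. [:- x, 1:]) = (\<Prod>x\<leftarrow>remove1 x ys. [:- x, 1:])"
    by (auto simp del: mult_pCons_left)
  then show ?case using Cons.IH ys by simp
qed

section \<open>Eigenvalues of the normalized Laplacian\<close>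

lemma deg_pos: "wgraph N w \<Longrightarrow> u < N \<Longrightarrow> deg N w u > 0"
  unfolding wgraph_def deg_def by blast

text \<open>The conjugate of \<open>norm_laplacian\<close> by the square roots of the degrees: same
  characteristic polynomial, but symmetric, so that the spectral theorem applies.\<close>

definition sym_laplacian :: "nat \<Rightarrow> (nat \<Rightarrow> nat \<Rightarrow> real) \<Rightarrow> real mat" where
  "sym_laplacian N w = mat N N (\<lambda>(u,v). (if u = v then 1 else 0) - w u v / (sqrt (deg N w u) * sqrt (deg N w v)))"

lemma char_poly_norm_laplacian:
  assumes "wgraph N w"
  shows "char_poly (norm_laplacian N w) = char_poly (sym_laplacian N w)"
proof -
  define P where "P = mat_diag N (\<lambda>u. 1 / sqrt (deg N w u))"
  define Q where "Q = mat_diag N (\<lambda>u. sqrt (deg N w u))"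
  have s: "sqrt (deg N w u) * sqrt (deg N w u) = deg N w u" "sqrt (deg N w u) \<noteq> 0" if "u < N" for u
    using deg_pos[OF assms that] by auto
  have carrier: "P \<in> carrier_mat N N" "Q \<in> carrier_mat N N" "sym_laplacian N w \<in> carrier_mat N N"
    "norm_laplacian N w \<in> carrier_mat N N"
    by (auto simp: P_def Q_def sym_laplacian_def norm_laplacian_def)
  have "P * Q = 1\<^sub>m N" "Q * P = 1\<^sub>m N"
    unfolding P_def Q_def mat_diag_diag using s(2) by (auto simp: mat_diag_def intro!: eq_matI)
  moreover have "norm_laplacian N w = P * sym_laplacian N w * Q"
  proof (rule eq_matI)
    fix u v assume "u < dim_row (P * sym_laplacian N w * Q)" "v < dim_col (P * sym_laplacian N w * Q)"
    then have uv: "u < N" "v < N" using carrier by auto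
    have "(P * sym_laplacian N w * Q) $$ (u,v)
      = 1 / sqrt (deg N w u) * sym_laplacian N w $$ (u,v) * sqrt (deg N w v)"
      unfolding P_def Q_def mat_diag_mult_left[OF carrier(3)]
      by (subst mat_diag_mult_right[of _ N]) (use uv in auto)
    also have "\<dots> = (if u = v then 1 else 0) - w u v / (sqrt (deg N w u) * sqrt (deg N w u))"
      using uv s(2)[OF uv(1)] s(2)[OF uv(2)] by (simp add: sym_laplacian_def field_simps)
    finally show "norm_laplacian N w $$ (u,v) = (P * sym_laplacian N w * Q) $$ (u,v)"
      unfolding s(1)[OF uv(1)] using uv by (simp add: norm_laplacian_def)
  qed (use carrier in auto)
  ultimately have "similar_mat_wit (norm_laplacian N w) (sym_laplacian N w) P Q"
    unfolding similar_mat_wit_def Let_def using carrier by auto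
  then show ?thesis using char_poly_similar unfolding similar_mat_def by blast
qed

text \<open>Existence comes from the splitting over the reals followed by sorting; uniqueness holds
  because a sorted list is determined by its multiset of roots.\<close>

lemma laplacian_eigenvalues_spec:
  assumes "wgraph N w"
  defines "ev \<equiv> laplacian_eigenvalues N w"
  shows "sorted ev" "length ev = N"
    "char_poly (sym_laplacian N w) = (\<Prod>x\<leftarrow>ev. [:- x, 1:])"
    "(sym_laplacian N w)\<^sup>T = sym_laplacian N w"
proof -
  show sym: "(sym_laplacian N w)\<^sup>T = sym_laplacian N w"
    using assms unfolding sym_laplacian_def wgraph_def by (intro eq_matI) (auto simp: mult.commute)
  have S: "sym_laplacian N w \<in> carrier_mat N N" by (simp add: sym_laplacian_def)
  obtain es where es: "length es = N" "char_poly (sym_laplacian N w) = (\<Prod>x\<leftarrow>es. [:- x, 1:])"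
    using real_symmetric_char_poly_splits[OF S sym] by blast
  let ?P = "\<lambda>xs. sorted xs \<and> length xs = N \<and> char_poly (norm_laplacian N w) = (\<Prod>x\<leftarrow>xs. [:- x, 1:])"
  have "(\<Prod>x\<leftarrow>sort es. [:- x, 1:]) = (\<Prod>x\<leftarrow>es. [:- x, 1:])"
    by (simp flip: prod_mset_prod_list)
  then have "?P (sort es)" using es char_poly_norm_laplacian[OF assms(1)] by simp
  moreover have "xs = sort es" if "?P xs" for xs
  proof -
    have "mset xs = mset es"
      using that \<open>?P (sort es)\<close> prod_linear_factors_mset[of xs "sort es"] by simp
    then show ?thesis using that properties_for_sort[of xs es] by simp
  qed
  ultimately have "?P ev" unfolding ev_def laplacian_eigenvalues_def by (rule theI)
  then show "sorted ev" "length ev = N" "char_poly (sym_laplacian N w) = (\<Prod>x\<leftarrow>ev. [:- x, 1:])"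
    using char_poly_norm_laplacian[OF assms(1)] by auto
qed

text \<open>\<open>\<phi> i\<close> is column \<open>i\<close> of an orthogonal diagonalizing matrix
  \<open>U\<close>, divided by the square roots of the degrees. The first two clauses are the two
  products of \<open>U\<close> with its transpose: orthonormality and completeness for the degree
  weight.\<close>

lemma laplacian_eigenbasis:
  assumes G: "wgraph N w"
  shows "\<exists>\<phi>. (\<forall>i<N. \<forall>j<N. (\<Sum>u<N. deg N w u * \<phi> i u * \<phi> j u) = (if i = j then 1 else 0)) \<and>
    (\<forall>u<N. \<forall>v<N. (\<Sum>i<N. \<phi> i u * \<phi> i v) * deg N w v = (if u = v then 1 else 0)) \<and>
    (\<forall>i<N. \<forall>u<N. (\<Sum>v<N. w u v * \<phi> i v) = (1 - laplacian_eigenvalues N w ! i) * deg N w u * \<phi> i u)"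
proof -
  let ?S = "sym_laplacian N w" and ?ev = "laplacian_eigenvalues N w"
  let ?D = "mat N N (\<lambda>(i,j). if i = j then ?ev ! i else 0)"
  have S: "?S \<in> carrier_mat N N" by (simp add: sym_laplacian_def)
  obtain U where U: "U \<in> carrier_mat N N" "U\<^sup>T * U = 1\<^sub>m N" "?S * U = U * ?D"
    using real_symmetric_diagonalizable[OF S laplacian_eigenvalues_spec(4,3)[OF G]] by blast
  have UU: "U * U\<^sup>T = 1\<^sub>m N" using mat_mult_left_right_inverse[of "U\<^sup>T" N U] U by auto
  define d where "d u = sqrt (deg N w u)" for u
  have d: "d u > 0" "d u * d u = deg N w u" if "u < N" for u
    using deg_pos[OF G that] unfolding d_def by auto
  define \<phi> where "\<phi> i u = U $$ (u,i) / d u" for i u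
  have "(\<Sum>u<N. deg N w u * \<phi> i u * \<phi> j u) = (if i = j then 1 else 0)" if ij: "i < N" "j < N" for i j
  proof -
    have "(\<Sum>u<N. deg N w u * \<phi> i u * \<phi> j u) = (\<Sum>u<N. U $$ (u,i) * U $$ (u,j))"
    proof (rule sum.cong[OF refl])
      fix u assume "u \<in> {..<N}"
      then have "d u \<noteq> 0" "deg N w u = d u * d u" using d[of u] by auto
      then show "deg N w u * \<phi> i u * \<phi> j u = U $$ (u,i) * U $$ (u,j)" by (simp add: \<phi>_def)
    qed
    also have "\<dots> = (U\<^sup>T * U) $$ (i,j)" using U(1) ij by (auto simp: scalar_prod_def atLeast0LessThan)
    finally show ?thesis using U(2) ij by simp
  qed
  moreover have "(\<Sum>i<N. \<phi> i u * \<phi> i v) * deg N w v = (if u = v then 1 else 0)" if uv: "u < N" "v < N" for u v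
  proof -
    have "(\<Sum>i<N. \<phi> i u * \<phi> i v) * deg N w v = (\<Sum>i<N. U $$ (u,i) * U $$ (v,i)) * d v / d u"
    proof -
      have "d u \<noteq> 0" "d v \<noteq> 0" "deg N w v = d v * d v" using d[OF uv(1)] d[OF uv(2)] by auto
      then show ?thesis by (simp add: \<phi>_def sum_distrib_right sum_divide_distrib mult.assoc)
    qed
    also have "(\<Sum>i<N. U $$ (u,i) * U $$ (v,i)) = (U * U\<^sup>T) $$ (u,v)"
      using U(1) uv by (auto simp: scalar_prod_def atLeast0LessThan)
    finally show ?thesis using UU uv d(1)[OF uv(1)] by (cases "u = v") auto
  qed
  moreover have "(\<Sum>v<N. w u v * \<phi> i v) = (1 - ?ev ! i) * deg N w u * \<phi> i u" if iu: "i < N" "u < N" for i u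
  proof -
    have "(?S * U) $$ (u,i) = (\<Sum>v<N. ?S $$ (u,v) * U $$ (v,i))"
      using U(1) iu S by (auto simp: scalar_prod_def atLeast0LessThan)
    also have "\<dots> = (\<Sum>v<N. (if v = u then U $$ (u,i) else 0) - w u v * \<phi> i v / d u)"
    proof (rule sum.cong[OF refl])
      fix v assume "v \<in> {..<N}"
      then have S_uv: "?S $$ (u,v) = (if u = v then 1 else 0) - w u v / (d u * d v)"
        using iu by (simp add: sym_laplacian_def d_def)
      show "?S $$ (u,v) * U $$ (v,i) = (if v = u then U $$ (u,i) else 0) - w u v * \<phi> i v / d u"
        unfolding S_uv \<phi>_def left_diff_distrib by (auto simp: mult.commute)
    qed
    also have "\<dots> = U $$ (u,i) - (\<Sum>v<N. w u v * \<phi> i v) / d u"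
      using iu by (simp add: sum_subtractf sum_divide_distrib)
    finally have 1: "(?S * U) $$ (u,i) = U $$ (u,i) - (\<Sum>v<N. w u v * \<phi> i v) / d u" .
    have "(U * ?D) $$ (u,i) = (\<Sum>v<N. if v = i then U $$ (u,i) * ?ev ! i else 0)"
      using U(1) iu
      by (auto simp: scalar_prod_def atLeast0LessThan if_distrib[where f = "(*) _"] cong: if_cong)
    then have "U $$ (u,i) - (\<Sum>v<N. w u v * \<phi> i v) / d u = U $$ (u,i) * ?ev ! i"
      using 1 U(3) iu by simp
    moreover have du: "d u \<noteq> 0" "deg N w u = d u * d u" using d[OF iu(2)] by auto
    ultimately have "(\<Sum>v<N. w u v * \<phi> i v) = (U $$ (u,i) - U $$ (u,i) * ?ev ! i) * d u"
      by (subst nonzero_divide_eq_eq[symmetric]) auto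
    moreover have "(1 - ?ev ! i) * deg N w u * \<phi> i u = (U $$ (u,i) - U $$ (u,i) * ?ev ! i) * d u"
      unfolding \<phi>_def[of i u] du(2) using du(1) by (simp add: field_simps)
    ultimately show ?thesis by simp
  qed
  ultimately show ?thesis by blast
qed


section \<open>Dual energy and the min-max principle\<close>

definition sqnorm :: "nat \<Rightarrow> (nat \<Rightarrow> nat \<Rightarrow> real) \<Rightarrow> (nat \<Rightarrow> real) \<Rightarrow> real" where
  "sqnorm N w f = (\<Sum>u<N. deg N w u * (f u)\<^sup>2)"

text \<open>Ordered pairs are summed, so every edge counts twice and a normalized eigenfunction for
  the eigenvalue \<open>x\<close> has energy \<open>2 * (2 - x)\<close>. This is the source of the
  factor 2 between energies and \<open>dual_gap\<close>.\<close>

definition dual_energy :: "nat \<Rightarrow> (nat \<Rightarrow> nat \<Rightarrow> real) \<Rightarrow> (nat \<Rightarrow> real) \<Rightarrow> real" where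
  "dual_energy N w f = (\<Sum>u<N. \<Sum>v<N. w u v * (f u + f v)\<^sup>2)"

definition dual_gap :: "nat \<Rightarrow> (nat \<Rightarrow> nat \<Rightarrow> real) \<Rightarrow> nat \<Rightarrow> real" where
  "dual_gap N w k = 2 - lambda N w (N - k + 1)"

lemma sum_weights_fst: "(\<Sum>u<N. \<Sum>v<N. w u v * h u) = (\<Sum>u<N. deg N w u * h u)"
  by (simp add: deg_def sum_distrib_right)

lemma sum_weights_snd:
  assumes "wgraph N w"
  shows "(\<Sum>u<N. \<Sum>v<N. w u v * h v) = (\<Sum>u<N. deg N w u * h u)"
proof -
  have "(\<Sum>u<N. \<Sum>v<N. w u v * h v) = (\<Sum>v<N. \<Sum>u<N. w u v * h v)"
    by (rule sum.swap)
  also have "\<dots> = (\<Sum>v<N. \<Sum>u<N. w v u * h v)"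
    using assms by (intro sum.cong refl) (auto simp: wgraph_def)
  finally show ?thesis by (simp add: sum_weights_fst)
qed

lemma dual_energy_expand:
  assumes "wgraph N w"
  shows "dual_energy N w f = 2 * sqnorm N w f + 2 * (\<Sum>u<N. f u * (\<Sum>v<N. w u v * f v))"
proof -
  have "dual_energy N w f = (\<Sum>u<N. \<Sum>v<N. w u v * (f u)\<^sup>2) + (\<Sum>u<N. \<Sum>v<N. w u v * (f v)\<^sup>2)
      + 2 * (\<Sum>u<N. \<Sum>v<N. f u * (w u v * f v))"
    unfolding dual_energy_def sum_distrib_left sum.distrib[symmetric]
    by (intro sum.cong refl) (simp add: power2_eq_square algebra_simps)
  then show ?thesis
    unfolding sum_weights_fst sum_weights_snd[OF assms] sqnorm_def by (simp add: sum_distrib_left)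
qed

lemma dual_energy_nonneg: "wgraph N w \<Longrightarrow> dual_energy N w f \<ge> 0"
  unfolding dual_energy_def by (intro sum_nonneg) (auto simp: wgraph_def)

lemma sqnorm_nonneg: "wgraph N w \<Longrightarrow> sqnorm N w f \<ge> 0"
  unfolding sqnorm_def by (intro sum_nonneg mult_nonneg_nonneg less_imp_le[OF deg_pos]) auto

lemma dual_energy_le:
  assumes "wgraph N w"
  shows "dual_energy N w f \<le> 4 * sqnorm N w f"
proof -
  have "dual_energy N w f \<le> (\<Sum>u<N. \<Sum>v<N. w u v * (2 * (f u)\<^sup>2) + w u v * (2 * (f v)\<^sup>2))"
    unfolding dual_energy_def
  proof (intro sum_mono)
    fix u v assume "u \<in> {..<N}" "v \<in> {..<N}"
    then have "w u v \<ge> 0" using assms by (auto simp: wgraph_def)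
    moreover have "(f u + f v)\<^sup>2 \<le> 2 * (f u)\<^sup>2 + 2 * (f v)\<^sup>2"
      using zero_le_power2[of "f u - f v"] by (simp add: power2_eq_square algebra_simps)
    ultimately show "w u v * (f u + f v)\<^sup>2 \<le> w u v * (2 * (f u)\<^sup>2) + w u v * (2 * (f v)\<^sup>2)"
      by (metis distrib_left mult_left_mono)
  qed
  also have "\<dots> = (\<Sum>u<N. deg N w u * (2 * (f u)\<^sup>2)) + (\<Sum>u<N. deg N w u * (2 * (f u)\<^sup>2))"
    unfolding sum.distrib
    using sum_weights_fst[of w "\<lambda>u. 2 * (f u)\<^sup>2" N] sum_weights_snd[OF assms, of "\<lambda>u. 2 * (f u)\<^sup>2"] by simp
  also have "\<dots> = 4 * sqnorm N w f"
    unfolding sqnorm_def sum_distrib_left sum.distrib[symmetric] by (intro sum.cong) auto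
  finally show ?thesis .
qed

text \<open>The \<open>l - 1\<close> equations are padded with a zero row; the resulting square
  matrix is singular because its transpose kills the last unit vector.\<close>

lemma underdetermined_system_solution:
  fixes a :: "nat \<Rightarrow> nat \<Rightarrow> real"
  assumes "1 \<le> l"
  shows "\<exists>x. (\<exists>j<l. x j \<noteq> 0) \<and> (\<forall>i<l - 1. (\<Sum>j<l. a i j * x j) = 0)"
proof -
  define M where "M = mat l l (\<lambda>(i,j). if i < l - 1 then a i j else 0)"
  have M: "M \<in> carrier_mat l l" "M\<^sup>T \<in> carrier_mat l l" unfolding M_def by auto
  have "M\<^sup>T *\<^sub>v unit_vec l (l - 1) = 0\<^sub>v l"
    using assms by (intro eq_vecI) (auto simp: M_def scalar_prod_def intro!: sum.neutral)
  moreover have "unit_vec l (l - 1) \<noteq> (0\<^sub>v l :: real vec)" using assms by simp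
  ultimately have "det (M\<^sup>T) = 0" using det_0_iff_vec_prod_zero[OF M(2)] by (metis unit_vec_carrier)
  then have "det M = 0" using det_transpose[OF M(1)] by simp
  then obtain x where x: "x \<in> carrier_vec l" "x \<noteq> 0\<^sub>v l" "M *\<^sub>v x = 0\<^sub>v l"
    using det_0_iff_vec_prod_zero[OF M(1)] by blast
  have "\<exists>j<l. x $ j \<noteq> 0"
  proof (rule ccontr)
    assume "\<not> ?thesis"
    then have "x = 0\<^sub>v l" using x(1) by (intro eq_vecI) auto
    then show False using x(2) by simp
  qed
  moreover have "(\<Sum>j<l. a i j * x $ j) = 0" if "i < l - 1" for i
  proof -
    have "(M *\<^sub>v x) $ i = (\<Sum>j<l. a i j * x $ j)"
      using that x(1) by (auto simp: M_def scalar_prod_def atLeast0LessThan)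
    then show ?thesis using x(3) that by simp
  qed
  ultimately show ?thesis by blast
qed

text \<open>Parseval for the degree weight: completeness expands \<open>g\<close> in the
  eigenfunctions, and both quadratic forms are diagonal in this basis.\<close>

lemma eigenbasis_expansion:
  assumes G: "wgraph N w"
    and orth: "\<forall>u<N. \<forall>v<N. (\<Sum>i<N. \<phi> i u * \<phi> i v) * deg N w v = (if u = v then 1 else 0)"
    and eig: "\<forall>i<N. \<forall>u<N. (\<Sum>v<N. w u v * \<phi> i v) = (1 - e i) * deg N w u * \<phi> i u"
  defines "c \<equiv> \<lambda>g i. \<Sum>u<N. deg N w u * g u * \<phi> i u"
  shows "sqnorm N w g = (\<Sum>i<N. (c g i)\<^sup>2)" (is ?norm)
    and "dual_energy N w g = 2 * (\<Sum>i<N. (2 - e i) * (c g i)\<^sup>2)" (is ?energy)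
proof -
  have exp: "g v = (\<Sum>i<N. c g i * \<phi> i v)" if "v < N" for v
  proof -
    have "(\<Sum>i<N. c g i * \<phi> i v) = (\<Sum>i<N. \<Sum>u<N. g u * (\<phi> i v * \<phi> i u * deg N w u))"
      unfolding c_def sum_distrib_right by (intro sum.cong refl) (simp add: mult_ac)
    also have "\<dots> = (\<Sum>u<N. \<Sum>i<N. g u * (\<phi> i v * \<phi> i u * deg N w u))"
      by (rule sum.swap)
    also have "\<dots> = (\<Sum>u<N. g u * ((\<Sum>i<N. \<phi> i v * \<phi> i u) * deg N w u))"
      by (simp add: sum_distrib_left sum_distrib_right)
    also have "\<dots> = (\<Sum>u<N. if u = v then g v else 0)"
      using orth that by (intro sum.cong refl) auto
    finally show ?thesis using that by simp
  qed
  have "sqnorm N w g = (\<Sum>u<N. deg N w u * g u * (\<Sum>i<N. c g i * \<phi> i u))"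
    unfolding sqnorm_def by (intro sum.cong refl) (simp add: exp[symmetric] power2_eq_square)
  also have "\<dots> = (\<Sum>u<N. \<Sum>i<N. c g i * (deg N w u * g u * \<phi> i u))"
    unfolding sum_distrib_left by (intro sum.cong refl) (simp add: mult_ac)
  also have "\<dots> = (\<Sum>i<N. \<Sum>u<N. c g i * (deg N w u * g u * \<phi> i u))" by (rule sum.swap)
  also have "\<dots> = (\<Sum>i<N. (c g i)\<^sup>2)"
    by (simp add: c_def sum_distrib_left power2_eq_square)
  finally show n: ?norm .
  have "(\<Sum>v<N. w u v * g v) = (\<Sum>i<N. c g i * (1 - e i) * (deg N w u * \<phi> i u))" if "u < N" for u
  proof -
    have "(\<Sum>v<N. w u v * g v) = (\<Sum>v<N. \<Sum>i<N. c g i * (w u v * \<phi> i v))"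
      by (intro sum.cong refl) (simp add: exp sum_distrib_left mult_ac)
    also have "\<dots> = (\<Sum>i<N. \<Sum>v<N. c g i * (w u v * \<phi> i v))" by (rule sum.swap)
    also have "\<dots> = (\<Sum>i<N. c g i * (1 - e i) * (deg N w u * \<phi> i u))"
      using eig that by (intro sum.cong refl) (simp add: sum_distrib_left[symmetric] mult.assoc)
    finally show ?thesis .
  qed
  then have "(\<Sum>u<N. g u * (\<Sum>v<N. w u v * g v))
      = (\<Sum>u<N. \<Sum>i<N. c g i * (1 - e i) * (deg N w u * g u * \<phi> i u))"
    by (intro sum.cong refl) (simp add: sum_distrib_left mult_ac)
  also have "\<dots> = (\<Sum>i<N. \<Sum>u<N. c g i * (1 - e i) * (deg N w u * g u * \<phi> i u))"
    by (rule sum.swap)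
  also have "\<dots> = (\<Sum>i<N. (1 - e i) * (c g i)\<^sup>2)"
  proof (intro sum.cong refl)
    fix i
    have "(\<Sum>u<N. deg N w u * g u * \<phi> i u) = c g i" by (simp add: c_def)
    then show "(\<Sum>u<N. c g i * (1 - e i) * (deg N w u * g u * \<phi> i u)) = (1 - e i) * (c g i)\<^sup>2"
      unfolding sum_distrib_left[symmetric] by (simp add: power2_eq_square)
  qed
  finally have cross: "(\<Sum>u<N. g u * (\<Sum>v<N. w u v * g v)) = (\<Sum>i<N. (1 - e i) * (c g i)\<^sup>2)" .
  have "(\<Sum>i<N. (2 - e i) * (c g i)\<^sup>2) = (\<Sum>i<N. (c g i)\<^sup>2) + (\<Sum>i<N. (1 - e i) * (c g i)\<^sup>2)"
    unfolding sum.distrib[symmetric] by (intro sum.cong refl) (simp add: algebra_simps)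
  then show ?energy unfolding dual_energy_expand[OF G] n cross by simp
qed

lemma dual_gap_eigenvalue:
  assumes "1 \<le> k" "k \<le> N"
  shows "dual_gap N w k = 2 - laplacian_eigenvalues N w ! (N - k)"
  using assms by (simp add: dual_gap_def lambda_def)

lemma dual_gap_mono:
  assumes G: "wgraph N w" and "1 \<le> k" "k \<le> l" "l \<le> N"
  shows "dual_gap N w k \<le> dual_gap N w l"
  using assms laplacian_eigenvalues_spec(1,2)[OF G] by (simp add: dual_gap_eigenvalue sorted_nth_mono)

lemma dual_gap_eigenfunctions:
  assumes G: "wgraph N w" and k: "1 \<le> k" "k \<le> N"
  shows "\<exists>f. (\<forall>i<k. \<forall>j<k. (\<Sum>u<N. deg N w u * f i u * f j u) = (if i = j then 1 else 0)) \<and>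
    (\<forall>i<k. dual_energy N w (f i) = 2 * dual_gap N w (k - i))"
proof -
  let ?ev = "laplacian_eigenvalues N w"
  obtain \<phi> where \<phi>:
    "\<forall>i<N. \<forall>j<N. (\<Sum>u<N. deg N w u * \<phi> i u * \<phi> j u) = (if i = j then 1 else 0)"
    "\<forall>u<N. \<forall>v<N. (\<Sum>i<N. \<phi> i u * \<phi> i v) * deg N w v = (if u = v then 1 else 0)"
    "\<forall>i<N. \<forall>u<N. (\<Sum>v<N. w u v * \<phi> i v) = (1 - ?ev ! i) * deg N w u * \<phi> i u"
    using laplacian_eigenbasis[OF G] by blast
  have energy: "dual_energy N w (\<phi> j) = 2 * (2 - ?ev ! j)" if "j < N" for j
  proof -
    have "dual_energy N w (\<phi> j) = 2 * (\<Sum>i<N. (2 - ?ev ! i) * (\<Sum>u<N. deg N w u * \<phi> j u * \<phi> i u)\<^sup>2)"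
      by (rule eigenbasis_expansion(2)[OF G \<phi>(2,3)])
    also have "(\<Sum>i<N. (2 - ?ev ! i) * (\<Sum>u<N. deg N w u * \<phi> j u * \<phi> i u)\<^sup>2)
        = (\<Sum>i<N. if i = j then 2 - ?ev ! j else 0)"
      using \<phi>(1) that by (intro sum.cong refl) auto
    finally show ?thesis using that by simp
  qed
  \<comment> \<open>Eigenvalues ascend, so these are the last \<open>k\<close> eigenfunctions.
    Position \<open>N - k + i\<close> is that of gap number \<open>k - i\<close>, and the largest of
    these gaps, number \<open>k\<close>, sits at \<open>i = 0\<close>.\<close>
  define f where "f i = \<phi> (N - k + i)" for i
  have "\<forall>i<k. \<forall>j<k. (\<Sum>u<N. deg N w u * f i u * f j u) = (if i = j then 1 else 0)"
    unfolding f_def using \<phi>(1) k by auto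
  moreover have "dual_energy N w (f i) = 2 * dual_gap N w (k - i)" if "i < k" for i
    using energy[of "N - k + i"] that k by (simp add: f_def dual_gap_eigenvalue)
  ultimately show ?thesis by blast
qed

lemma dual_gap_bounds:
  assumes G: "wgraph N w" and k: "1 \<le> k" "k \<le> N"
  shows "0 \<le> dual_gap N w k" "dual_gap N w k \<le> 2"
proof -
  obtain f where f: "\<forall>i<k. \<forall>j<k. (\<Sum>u<N. deg N w u * f i u * f j u) = (if i = j then 1 else 0)"
    "\<forall>i<k. dual_energy N w (f i) = 2 * dual_gap N w (k - i)"
    using dual_gap_eigenfunctions[OF assms] by blast
  have "sqnorm N w (f 0) = 1" using f(1) k by (simp add: sqnorm_def power2_eq_square mult.assoc)
  moreover have "dual_energy N w (f 0) = 2 * dual_gap N w k" using f(2) k by simp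
  ultimately show "0 \<le> dual_gap N w k" "dual_gap N w k \<le> 2"
    using dual_energy_nonneg[OF G, of "f 0"] dual_energy_le[OF G, of "f 0"] by simp_all
qed

lemma square_sum_one_active:
  fixes x :: "'i \<Rightarrow> real"
  assumes "finite J" and x: "\<And>i j. i \<in> J \<Longrightarrow> j \<in> J \<Longrightarrow> i \<noteq> j \<Longrightarrow> x i = 0 \<or> x j = 0"
  shows "(\<Sum>j\<in>J. x j)\<^sup>2 = (\<Sum>j\<in>J. (x j)\<^sup>2)"
proof -
  have "(\<Sum>j\<in>J. x j)\<^sup>2 = (\<Sum>i\<in>J. \<Sum>j\<in>J. x i * x j)" by (simp add: power2_eq_square sum_product)
  also have "\<dots> = (\<Sum>i\<in>J. \<Sum>j\<in>J. if j = i then (x i)\<^sup>2 else 0)"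
    using x by (intro sum.cong refl) (auto simp: power2_eq_square)
  finally show ?thesis using assms(1) by simp
qed

text \<open>\<open>x\<close> and \<open>y\<close> stand for the values of disjointly supported
  functions at the two ends of an edge. At most one index is active at each end; if the two indices
  differ, the square of a sum of two terms costs the factor 2.\<close>

lemma square_sum_le_two_active:
  fixes x y :: "'i \<Rightarrow> real"
  assumes J: "finite J" "J \<noteq> {}" and x: "\<And>i j. i \<in> J \<Longrightarrow> j \<in> J \<Longrightarrow> i \<noteq> j \<Longrightarrow> x i = 0 \<or> x j = 0"
    and y: "\<And>i j. i \<in> J \<Longrightarrow> j \<in> J \<Longrightarrow> i \<noteq> j \<Longrightarrow> y i = 0 \<or> y j = 0"
  shows "((\<Sum>j\<in>J. x j) + (\<Sum>j\<in>J. y j))\<^sup>2 \<le> 2 * (\<Sum>j\<in>J. (x j + y j)\<^sup>2)"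
proof -
  have ex: "\<exists>p\<in>J. \<forall>j\<in>J. j \<noteq> p \<longrightarrow> z j = 0"
    if "\<And>i j. i \<in> J \<Longrightarrow> j \<in> J \<Longrightarrow> i \<noteq> j \<Longrightarrow> z i = 0 \<or> z j = 0" for z :: "'i \<Rightarrow> real"
  proof (cases "\<exists>p\<in>J. z p \<noteq> 0")
    case True
    then show ?thesis using that by blast
  next
    case False
    then show ?thesis using J(2) by blast
  qed
  obtain p where p: "p \<in> J" "\<forall>j\<in>J. j \<noteq> p \<longrightarrow> x j = 0" using ex[of x, OF x] by auto
  obtain q where q: "q \<in> J" "\<forall>j\<in>J. j \<noteq> q \<longrightarrow> y j = 0" using ex[of y, OF y] by auto
  have sx: "(\<Sum>j\<in>J. x j) = x p" using sum.remove[OF J(1) p(1), of x] p(2) by (simp add: sum.neutral)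
  have sy: "(\<Sum>j\<in>J. y j) = y q" using sum.remove[OF J(1) q(1), of y] q(2) by (simp add: sum.neutral)
  show ?thesis
  proof (cases "p = q")
    case True
    have "(x p + y p)\<^sup>2 \<le> (\<Sum>j\<in>J. (x j + y j)\<^sup>2)" using J(1) p(1) by (intro member_le_sum) auto
    moreover have "0 \<le> (\<Sum>j\<in>J. (x j + y j)\<^sup>2)" by (simp add: sum_nonneg)
    ultimately show ?thesis unfolding sx sy using True by simp
  next
    case False
    have "(x p)\<^sup>2 + (y q)\<^sup>2 = (\<Sum>j\<in>{p,q}. (x j + y j)\<^sup>2)" using False p q by simp
    also have "\<dots> \<le> (\<Sum>j\<in>J. (x j + y j)\<^sup>2)" using J(1) p(1) q(1) by (intro sum_mono2) auto
    finally have A: "(x p)\<^sup>2 + (y q)\<^sup>2 \<le> (\<Sum>j\<in>J. (x j + y j)\<^sup>2)" .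
    have "(x p + y q)\<^sup>2 \<le> 2 * ((x p)\<^sup>2 + (y q)\<^sup>2)"
      using zero_le_power2[of "x p - y q"] by (simp add: power2_eq_square algebra_simps)
    also have "\<dots> \<le> 2 * (\<Sum>j\<in>J. (x j + y j)\<^sup>2)" using A by simp
    finally show ?thesis unfolding sx sy .
  qed
qed

text \<open>Courant-Fischer: some nonzero combination \<open>h\<close> of the \<open>l\<close>
  functions is orthogonal to the last \<open>l - 1\<close> eigenfunctions, so its energy is at least
  \<open>2 * dual_gap N w l\<close> times its norm. Norms add over disjoint supports, while energies
  add up to a factor 2 for edges joining two supports. The two factors 2 cancel, hence
  \<open>x\<close> without a constant.\<close>

lemma dual_gap_le_disjoint_supports:
  assumes G: "wgraph N w" and l: "1 \<le> l" "l \<le> N"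
    and disj: "\<And>i j u. i < l \<Longrightarrow> j < l \<Longrightarrow> i \<noteq> j \<Longrightarrow> u < N \<Longrightarrow> g i u = 0 \<or> g j u = 0"
    and nz: "\<And>i. i < l \<Longrightarrow> sqnorm N w (g i) > 0"
    and en: "\<And>i. i < l \<Longrightarrow> dual_energy N w (g i) \<le> x * sqnorm N w (g i)"
  shows "dual_gap N w l \<le> x"
proof -
  let ?ev = "laplacian_eigenvalues N w"
  obtain \<phi> where \<phi>:
    "\<forall>u<N. \<forall>v<N. (\<Sum>i<N. \<phi> i u * \<phi> i v) * deg N w v = (if u = v then 1 else 0)"
    "\<forall>i<N. \<forall>u<N. (\<Sum>v<N. w u v * \<phi> i v) = (1 - ?ev ! i) * deg N w u * \<phi> i u"
    using laplacian_eigenbasis[OF G] by blast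
  define c where "c f i = (\<Sum>u<N. deg N w u * f u * \<phi> i u)" for f i
  note expand = eigenbasis_expansion[OF G \<phi>, folded c_def]
  obtain a where a: "\<exists>j<l. a j \<noteq> 0" "\<forall>i<l - 1. (\<Sum>j<l. c (g j) (N - l + 1 + i) * a j) = 0"
    using underdetermined_system_solution[OF l(1), of "\<lambda>i j. c (g j) (N - l + 1 + i)"] by blast
  define h where "h u = (\<Sum>j<l. a j * g j u)" for u
  have ch: "c h i = 0" if "N - l < i" "i < N" for i
  proof -
    have "c h i = (\<Sum>u<N. \<Sum>j<l. deg N w u * g j u * \<phi> i u * a j)"
      unfolding c_def h_def sum_distrib_left sum_distrib_right by (intro sum.cong refl) (simp add: mult_ac)
    also have "\<dots> = (\<Sum>j<l. \<Sum>u<N. deg N w u * g j u * \<phi> i u * a j)" by (rule sum.swap)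
    also have "\<dots> = (\<Sum>j<l. c (g j) i * a j)" by (simp add: c_def sum_distrib_right)
    also have "\<dots> = 0"
    proof -
      have "i - (N - l + 1) < l - 1" "N - l + 1 + (i - (N - l + 1)) = i" using that l by linarith+
      then show ?thesis using a(2) by metis
    qed
    finally show ?thesis .
  qed
  have sq_h: "(h u)\<^sup>2 = (\<Sum>j<l. (a j)\<^sup>2 * (g j u)\<^sup>2)" if "u < N" for u
    unfolding h_def using disj that
    by (subst square_sum_one_active) (auto simp: power_mult_distrib)
  have norm_h: "sqnorm N w h = (\<Sum>j<l. (a j)\<^sup>2 * sqnorm N w (g j))"
  proof -
    have "sqnorm N w h = (\<Sum>u<N. \<Sum>j<l. (a j)\<^sup>2 * (deg N w u * (g j u)\<^sup>2))"
      unfolding sqnorm_def by (intro sum.cong refl) (simp add: sq_h sum_distrib_left mult_ac)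
    then show ?thesis by (subst (asm) sum.swap) (simp add: sqnorm_def sum_distrib_left)
  qed
  have "sqnorm N w h > 0"
  proof -
    obtain j where j: "j < l" "a j \<noteq> 0" using a(1) by blast
    have "0 < (a j)\<^sup>2 * sqnorm N w (g j)" using j nz by simp
    also have "\<dots> \<le> sqnorm N w h" unfolding norm_h
      using j sqnorm_nonneg[OF G] by (intro member_le_sum) auto
    finally show ?thesis .
  qed
  have "2 * dual_gap N w l * sqnorm N w h \<le> dual_energy N w h"
  proof -
    have "(2 - ?ev ! (N - l)) * (c h i)\<^sup>2 \<le> (2 - ?ev ! i) * (c h i)\<^sup>2" if "i < N" for i
    proof (cases "i \<le> N - l")
      case True
      then have "?ev ! i \<le> ?ev ! (N - l)" using laplacian_eigenvalues_spec(1,2)[OF G] l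
        by (intro sorted_nth_mono) auto
      then show ?thesis by (intro mult_right_mono) auto
    next
      case False
      then show ?thesis using ch[of i] that by simp
    qed
    then have "(\<Sum>i<N. (2 - ?ev ! (N - l)) * (c h i)\<^sup>2) \<le> (\<Sum>i<N. (2 - ?ev ! i) * (c h i)\<^sup>2)"
      by (intro sum_mono) auto
    then have "2 * ((2 - ?ev ! (N - l)) * (\<Sum>i<N. (c h i)\<^sup>2)) \<le> 2 * (\<Sum>i<N. (2 - ?ev ! i) * (c h i)\<^sup>2)"
      unfolding sum_distrib_left[symmetric] by simp
    then show ?thesis unfolding expand dual_gap_eigenvalue[OF l] by (simp only: mult.assoc)
  qed
  also have "dual_energy N w h \<le> 2 * (\<Sum>j<l. (a j)\<^sup>2 * dual_energy N w (g j))"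
  proof -
    have "dual_energy N w h \<le> (\<Sum>u<N. \<Sum>v<N. w u v * (2 * (\<Sum>j<l. (a j * g j u + a j * g j v)\<^sup>2)))"
      unfolding dual_energy_def
    proof (intro sum_mono mult_left_mono)
      fix u v assume uv: "u \<in> {..<N}" "v \<in> {..<N}"
      show "0 \<le> w u v" using G uv by (auto simp: wgraph_def)
      show "(h u + h v)\<^sup>2 \<le> 2 * (\<Sum>j<l. (a j * g j u + a j * g j v)\<^sup>2)"
        unfolding h_def using l uv disj
        by (intro square_sum_le_two_active) (auto simp: lessThan_empty_iff)
    qed
    also have "\<dots> = (\<Sum>u<N. \<Sum>v<N. \<Sum>j<l. 2 * ((a j)\<^sup>2 * (w u v * (g j u + g j v)\<^sup>2)))"
    proof (intro sum.cong refl)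
      fix u v
      have "(a j * g j u + a j * g j v)\<^sup>2 = (a j)\<^sup>2 * (g j u + g j v)\<^sup>2" for j
        by (simp only: distrib_left[symmetric] power_mult_distrib)
      then show "w u v * (2 * (\<Sum>j<l. (a j * g j u + a j * g j v)\<^sup>2))
        = (\<Sum>j<l. 2 * ((a j)\<^sup>2 * (w u v * (g j u + g j v)\<^sup>2)))"
        by (simp add: sum_distrib_left mult_ac)
    qed
    also have "\<dots> = (\<Sum>u<N. \<Sum>j<l. \<Sum>v<N. 2 * ((a j)\<^sup>2 * (w u v * (g j u + g j v)\<^sup>2)))"
      by (intro sum.cong[OF refl] sum.swap)
    also have "\<dots> = (\<Sum>j<l. \<Sum>u<N. \<Sum>v<N. 2 * ((a j)\<^sup>2 * (w u v * (g j u + g j v)\<^sup>2)))"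
      by (rule sum.swap)
    finally show ?thesis by (simp add: dual_energy_def sum_distrib_left)
  qed
  also have "\<dots> \<le> 2 * (\<Sum>j<l. (a j)\<^sup>2 * (x * sqnorm N w (g j)))"
    using en by (intro mult_left_mono sum_mono) auto
  also have "\<dots> = 2 * x * sqnorm N w h" by (simp add: norm_h sum_distrib_left mult_ac)
  finally show ?thesis using \<open>sqnorm N w h > 0\<close> by simp
qed

section \<open>Improved dual Cheeger inequality for a single function\<close>

text \<open>On an edge the integrand is the sum of the two absolute values, except between
  \<open>A\<close> and \<open>B\<close>, where it drops from 2 to 0. Summation gives twice the
  volume minus four times the weight between \<open>A\<close> and \<open>B\<close>.\<close>

lemma sum_signed_indicator:
  fixes h :: "nat \<Rightarrow> real"
  assumes G: "wgraph N w"
  defines "A \<equiv> {u\<in>{..<N}. h u > 0}" and "B \<equiv> {u\<in>{..<N}. h u < 0}"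
  assumes ne: "A \<union> B \<noteq> {}"
  shows "(\<Sum>u<N. \<Sum>v<N. w u v * \<bar>sgn (h u) + sgn (h v)\<bar>)
      = 2 * (1 - phibar N w A B) * (\<Sum>u<N. deg N w u * \<bar>sgn (h u)\<bar>)"
proof -
  have sub: "A \<subseteq> {..<N}" "B \<subseteq> {..<N}" and fin: "finite A" "finite B" unfolding A_def B_def by auto
  have vol: "vol N w (A \<union> B) = (\<Sum>u<N. deg N w u * \<bar>sgn (h u)\<bar>)"
    unfolding vol_def A_def B_def
    by (rule sum.mono_neutral_cong_left) (auto simp: sgn_real_def)
  have "vol N w (A \<union> B) > 0" unfolding vol_def
    using ne fin sub deg_pos[OF G] by (intro sum_pos) auto
  have restrict: "(\<Sum>u<N. of_bool (u \<in> X) * g u) = (\<Sum>u\<in>X. g u)"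
    if "X \<subseteq> {..<N}" for X and g :: "nat \<Rightarrow> real"
    using that by (intro sum.mono_neutral_cong_right) auto
  have ind: "(\<Sum>u<N. \<Sum>v<N. w u v * (of_bool (u \<in> X) * of_bool (v \<in> Y))) = edges_between w X Y"
    if "X \<subseteq> {..<N}" "Y \<subseteq> {..<N}" for X Y
  proof -
    have "(\<Sum>u<N. \<Sum>v<N. w u v * (of_bool (u \<in> X) * of_bool (v \<in> Y)))
        = (\<Sum>u<N. of_bool (u \<in> X) * (\<Sum>v<N. of_bool (v \<in> Y) * w u v))"
      unfolding sum_distrib_left by (intro sum.cong refl) (simp only: mult_ac)
    then show ?thesis unfolding restrict[OF that(2)] restrict[OF that(1)] edges_between_def .
  qed
  have swap: "edges_between w B A = edges_between w A B"
    unfolding edges_between_def using G sub by (subst sum.swap) (intro sum.cong refl, auto simp: wgraph_def)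
  have "(\<Sum>u<N. \<Sum>v<N. w u v * \<bar>sgn (h u) + sgn (h v)\<bar>)
     = (\<Sum>u<N. \<Sum>v<N. w u v * \<bar>sgn (h u)\<bar> + w u v * \<bar>sgn (h v)\<bar>
        - 2 * (w u v * (of_bool (u \<in> A) * of_bool (v \<in> B))) - 2 * (w u v * (of_bool (u \<in> B) * of_bool (v \<in> A))))"
    by (intro sum.cong refl) (auto simp: A_def B_def sgn_real_def)
  also have "\<dots> = 2 * vol N w (A \<union> B) - 4 * edges_between w A B"
    unfolding sum_subtractf sum.distrib sum_distrib_left[symmetric] sum_weights_fst sum_weights_snd[OF G] 
      ind[OF sub] ind[OF sub(2,1)] swap vol by simp
  finally have "(\<Sum>u<N. \<Sum>v<N. w u v * \<bar>sgn (h u) + sgn (h v)\<bar>)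
      = 2 * vol N w (A \<union> B) - 4 * edges_between w A B" .
  moreover have "2 * (1 - phibar N w A B) * vol N w (A \<union> B)
      = 2 * vol N w (A \<union> B) - 4 * edges_between w A B"
    using \<open>vol N w (A \<union> B) > 0\<close> unfolding phibar_def by (simp add: field_simps)
  ultimately show ?thesis unfolding vol[symmetric] by simp
qed

text \<open>A discrete coarea formula by induction on the size of the support: subtracting the
  smallest nonzero \<open>\<bar>h u\<bar>\<close> from all nonzero absolute values peels off one
  level set. Both sums are additive under peeling, so one of the levels is at least as good as the
  average.\<close>

lemma signed_sweep:
  fixes h :: "nat \<Rightarrow> real"
  assumes G: "wgraph N w" and "\<exists>u<N. h u \<noteq> 0"
  shows "\<exists>A B. A \<subseteq> {u\<in>{..<N}. h u > 0} \<and> B \<subseteq> {u\<in>{..<N}. h u < 0} \<and> A \<union> B \<noteq> {} \<and>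
    2 * (1 - phibar N w A B) * (\<Sum>u<N. deg N w u * \<bar>h u\<bar>) \<le> (\<Sum>u<N. \<Sum>v<N. w u v * \<bar>h u + h v\<bar>)"
  using assms(2)
proof (induction "card {u\<in>{..<N}. h u \<noteq> 0}" arbitrary: h rule: less_induct)
  case less
  let ?S = "{u\<in>{..<N}. h u \<noteq> 0}"
  let ?A = "{u\<in>{..<N}. h u > 0}" and ?B = "{u\<in>{..<N}. h u < 0}"
  have ne: "?A \<union> ?B \<noteq> {}" using less.prems by force
  define m where "m = Min ((\<lambda>u. \<bar>h u\<bar>) ` ?S)"
  have "m \<in> (\<lambda>u. \<bar>h u\<bar>) ` ?S" unfolding m_def using less.prems by (intro Min_in) auto
  then obtain p where p: "p < N" "h p \<noteq> 0" "m = \<bar>h p\<bar>" by auto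
  have m: "m > 0" using p by simp
  have m_le: "m \<le> \<bar>h u\<bar>" if "u < N" "h u \<noteq> 0" for u unfolding m_def using that by (intro Min_le) auto
  define h' where "h' u = h u - m * sgn (h u)" for u
  define X where "X g = (\<Sum>u<N. deg N w u * \<bar>g u\<bar>)" for g :: "nat \<Rightarrow> real"
  define Y where "Y g = (\<Sum>u<N. \<Sum>v<N. w u v * \<bar>g u + g v\<bar>)" for g :: "nat \<Rightarrow> real"
  have Xnn: "X g \<ge> 0" for g unfolding X_def using deg_pos[OF G] by (intro sum_nonneg) (simp add: less_imp_le)
  have X: "X h = X h' + m * X (\<lambda>u. sgn (h u))"
    unfolding X_def sum_distrib_left sum.distrib[symmetric]
  proof (intro sum.cong refl)
    fix u assume "u \<in> {..<N}"
    then have "\<bar>h u\<bar> = \<bar>h' u\<bar> + m * \<bar>sgn (h u)\<bar>"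
      using m_le[of u] m unfolding h'_def by (cases "h u" "0::real" rule: linorder_cases) auto
    then show "deg N w u * \<bar>h u\<bar> = deg N w u * \<bar>h' u\<bar> + m * (deg N w u * \<bar>sgn (h u)\<bar>)"
      by (simp add: algebra_simps)
  qed
  \<comment> \<open>Additivity is exact because \<open>h' u + h' v\<close> and
    \<open>sgn (h u) + sgn (h v)\<close> never have opposite signs, by minimality of
    \<open>m\<close>.\<close>
  have Y: "Y h = Y h' + m * Y (\<lambda>u. sgn (h u))"
    unfolding Y_def sum_distrib_left sum.distrib[symmetric]
  proof (intro sum.cong refl)
    fix u v assume "u \<in> {..<N}" "v \<in> {..<N}"
    then have "\<bar>h u + h v\<bar> = \<bar>h' u + h' v\<bar> + m * \<bar>sgn (h u) + sgn (h v)\<bar>"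
      using m_le[of u] m_le[of v] m unfolding h'_def
      by (cases "h u" "0::real" rule: linorder_cases; cases "h v" "0::real" rule: linorder_cases) auto
    then show "w u v * \<bar>h u + h v\<bar> = w u v * \<bar>h' u + h' v\<bar> + m * (w u v * \<bar>sgn (h u) + sgn (h v)\<bar>)"
      by (simp add: algebra_simps)
  qed
  have level: "Y (\<lambda>u. sgn (h u)) = 2 * (1 - phibar N w ?A ?B) * X (\<lambda>u. sgn (h u))"
    unfolding X_def Y_def by (rule sum_signed_indicator[OF G ne])
  have pos': "h' u > 0 \<Longrightarrow> h u > 0" and neg': "h' u < 0 \<Longrightarrow> h u < 0" if "u < N" for u
    using m_le[OF that] m unfolding h'_def by (cases "h u" "0::real" rule: linorder_cases; auto)+
  show ?case unfolding X_def[symmetric] Y_def[symmetric]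
  proof (cases "\<exists>u<N. h' u \<noteq> 0")
    case False
    then have "X h' = 0" "Y h' = 0" unfolding X_def Y_def by (auto intro!: sum.neutral)
    then have "2 * (1 - phibar N w ?A ?B) * X h \<le> Y h" unfolding X Y level by simp
    then show "\<exists>A B. A \<subseteq> ?A \<and> B \<subseteq> ?B \<and> A \<union> B \<noteq> {} \<and> 2 * (1 - phibar N w A B) * X h \<le> Y h"
      using ne by blast
  next
    case True
    have "{u\<in>{..<N}. h' u \<noteq> 0} \<subset> ?S"
    proof
      show "{u\<in>{..<N}. h' u \<noteq> 0} \<subseteq> ?S" unfolding h'_def by auto
      have "p \<notin> {u\<in>{..<N}. h' u \<noteq> 0}" using p unfolding h'_def by (auto simp: abs_mult_sgn)
      then show "{u\<in>{..<N}. h' u \<noteq> 0} \<noteq> ?S" using p by auto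
    qed
    then have "card {u\<in>{..<N}. h' u \<noteq> 0} < card ?S" by (intro psubset_card_mono) auto
    from less.hyps[OF this True] obtain A' B' where AB:
      "A' \<subseteq> {u\<in>{..<N}. h' u > 0}" "B' \<subseteq> {u\<in>{..<N}. h' u < 0}" "A' \<union> B' \<noteq> {}"
      "2 * (1 - phibar N w A' B') * X h' \<le> Y h'" unfolding X_def Y_def by blast
    have sub: "A' \<subseteq> ?A" "B' \<subseteq> ?B" using AB pos' neg' by blast+
    show "\<exists>A B. A \<subseteq> ?A \<and> B \<subseteq> ?B \<and> A \<union> B \<noteq> {} \<and> 2 * (1 - phibar N w A B) * X h \<le> Y h"
    \<comment> \<open>The pair with the larger \<open>phibar\<close> satisfies the inequality for
      the peeled level as well as for the remainder, and these add up.\<close>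
    proof (cases "phibar N w A' B' \<ge> phibar N w ?A ?B")
      case True
      have "2 * (1 - phibar N w A' B') * (m * X (\<lambda>u. sgn (h u)))
          \<le> 2 * (1 - phibar N w ?A ?B) * (m * X (\<lambda>u. sgn (h u)))"
        using True m Xnn by (intro mult_right_mono) auto
      also have "\<dots> = m * Y (\<lambda>u. sgn (h u))" unfolding level by simp
      finally have "2 * (1 - phibar N w A' B') * X h \<le> Y h" using AB(4) unfolding X Y distrib_left by linarith
      then show ?thesis using sub AB(3) by blast
    next
      case False
      have "2 * (1 - phibar N w ?A ?B) * X h' \<le> 2 * (1 - phibar N w A' B') * X h'"
        using False Xnn by (intro mult_right_mono) auto
      moreover have "2 * (1 - phibar N w ?A ?B) * (m * X (\<lambda>u. sgn (h u))) = m * Y (\<lambda>u. sgn (h u))"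
        unfolding level by simp
      ultimately have "2 * (1 - phibar N w ?A ?B) * X h \<le> Y h" using AB(4) unfolding X Y distrib_left by linarith
      then show ?thesis using ne by blast
    qed
  qed
qed

section \<open>Tent functions over consecutive thresholds and their primitives\<close>

definition tent :: "real \<Rightarrow> real \<Rightarrow> real \<Rightarrow> real" where
  "tent a b x = max 0 (min (x - a) (b - x))"

text \<open>For \<open>a \<le> b\<close>, the length of the part of \<open>[a, b]\<close> below
  \<open>x\<close>. It is monotone in \<open>x\<close> and telescopes over consecutive intervals,
  which \<open>tent\<close> does not; it therefore serves as a majorant of tents and of their
  increments.\<close>

definition covered :: "real \<Rightarrow> real \<Rightarrow> real \<Rightarrow> real" where
  "covered a b x = max 0 (min x b - a)"

lemma tent_nonneg: "tent a b x \<ge> 0" by (simp add: tent_def)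

lemma tent_le_covered: "a \<le> b \<Longrightarrow> tent a b x \<le> covered a b x"
  by (auto simp: tent_def covered_def)

lemma tent_diff_le_covered: "a \<le> b \<Longrightarrow> x \<le> y \<Longrightarrow> \<bar>tent a b x - tent a b y\<bar> \<le> covered a b y - covered a b x"
  by (auto simp: tent_def covered_def max_def min_def)

lemma sum_covered:
  assumes "\<And>i. t i \<le> t (Suc i)" "t 0 = 0" "0 \<le> x"
  shows "(\<Sum>i<m. covered (t i) (t (Suc i)) x) = min x (t m)"
proof (induction m)
  case 0
  then show ?case using assms by simp
next
  case (Suc m)
  then show ?case using assms(1)[of m] by (auto simp: covered_def max_def min_def)
qed

lemma sum_tent_le:
  assumes "\<And>i. t i \<le> t (Suc i)" "t 0 = 0" "0 \<le> x"
  shows "(\<Sum>i<m. tent (t i) (t (Suc i)) x) \<le> x"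
proof -
  have "(\<Sum>i<m. tent (t i) (t (Suc i)) x) \<le> (\<Sum>i<m. covered (t i) (t (Suc i)) x)"
    using assms(1) by (intro sum_mono tent_le_covered)
  then show ?thesis using sum_covered[of t x m] assms by simp
qed

lemma sum_tent_diff_le:
  assumes t: "\<And>i. t i \<le> t (Suc i)" "t 0 = 0" and "0 \<le> x" "0 \<le> y"
  shows "(\<Sum>i<m. \<bar>tent (t i) (t (Suc i)) x - tent (t i) (t (Suc i)) y\<bar>) \<le> \<bar>x - y\<bar>"
proof -
  have *: "(\<Sum>i<m. \<bar>tent (t i) (t (Suc i)) x - tent (t i) (t (Suc i)) y\<bar>) \<le> y - x"
    if "0 \<le> x" "x \<le> y" for x y
  proof -
    have "(\<Sum>i<m. \<bar>tent (t i) (t (Suc i)) x - tent (t i) (t (Suc i)) y\<bar>)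
        \<le> (\<Sum>i<m. covered (t i) (t (Suc i)) y - covered (t i) (t (Suc i)) x)"
      using t(1) that by (intro sum_mono tent_diff_le_covered)
    also have "\<dots> = min y (t m) - min x (t m)"
      unfolding sum_subtractf using t that by (simp add: sum_covered)
    finally show ?thesis using that by simp
  qed
  show ?thesis
  proof (cases "x \<le> y")
    case True
    then show ?thesis using *[of x y] assms by simp
  next
    case False
    then show ?thesis using *[of y x] assms by (simp add: abs_minus_commute)
  qed
qed

text \<open>Truncating to all intervals at once does not increase the edge terms. For equal signs
  the tents at each end sum to at most the absolute value there; for opposite signs their
  differences are controlled by the Lipschitz bound. This is what limits the total energy of the
  truncations by that of \<open>f\<close>.\<close>

lemma sum_signed_tent_diff_le:
  assumes t: "\<And>i. t i \<le> t (Suc i)" "t 0 = 0"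
  shows "(\<Sum>i<m. \<bar>sgn x * tent (t i) (t (Suc i)) \<bar>x\<bar> + sgn y * tent (t i) (t (Suc i)) \<bar>y\<bar>\<bar>) \<le> \<bar>x + y\<bar>"
proof (cases "x * y \<ge> 0")
  case True
  have "(\<Sum>i<m. \<bar>sgn x * tent (t i) (t (Suc i)) \<bar>x\<bar> + sgn y * tent (t i) (t (Suc i)) \<bar>y\<bar>\<bar>)
      \<le> (\<Sum>i<m. tent (t i) (t (Suc i)) \<bar>x\<bar> + tent (t i) (t (Suc i)) \<bar>y\<bar>)"
    by (intro sum_mono order_trans[OF abs_triangle_ineq] add_mono)
      (auto simp: abs_mult abs_sgn_eq tent_nonneg)
  also have "\<dots> \<le> \<bar>x\<bar> + \<bar>y\<bar>"
    unfolding sum.distrib using sum_tent_le[OF t, of "\<bar>x\<bar>" m] sum_tent_le[OF t, of "\<bar>y\<bar>" m] by simp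
  also have "\<dots> = \<bar>x + y\<bar>" using True by (auto simp: zero_le_mult_iff)
  finally show ?thesis .
next
  case False
  then have xy: "(x > 0 \<and> y < 0) \<or> (x < 0 \<and> y > 0)" by (auto simp: not_le mult_less_0_iff)
  then have "\<bar>sgn x * tent a b \<bar>x\<bar> + sgn y * tent a b \<bar>y\<bar>\<bar> = \<bar>tent a b \<bar>x\<bar> - tent a b \<bar>y\<bar>\<bar>" for a b by auto
  then have "(\<Sum>i<m. \<bar>sgn x * tent (t i) (t (Suc i)) \<bar>x\<bar> + sgn y * tent (t i) (t (Suc i)) \<bar>y\<bar>\<bar>) \<le> \<bar>\<bar>x\<bar> - \<bar>y\<bar>\<bar>"
    using sum_tent_diff_le[OF t, of "\<bar>x\<bar>" "\<bar>y\<bar>" m] by simp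
  also have "\<dots> = \<bar>x + y\<bar>" using xy by auto
  finally show ?thesis .
qed

lemma tent_disjoint:
  assumes t: "\<And>i. t i \<le> t (Suc i)" and "i \<noteq> j"
  shows "tent (t i) (t (Suc i)) x = 0 \<or> tent (t j) (t (Suc j)) x = 0"
proof -
  have mono: "t p \<le> t q" if "p \<le> q" for p q using lift_Suc_mono_le[of t p q] t that by blast
  have *: "tent (t i) (t (Suc i)) x = 0 \<or> tent (t j) (t (Suc j)) x = 0" if "i < j" for i j
    using mono[of "Suc i" j] that by (auto simp: tent_def max_def min_def)
  show ?thesis using *[of i j] *[of j i] assms(2) by linarith
qed

text \<open>Integrates the identity \<open>tent a b x = (x - a)\<^sub>+ - 2 (x - (a + b) / 2)\<^sub>+ + (x - b)\<^sub>+\<close>.\<close>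
definition tent_int :: "real \<Rightarrow> real \<Rightarrow> real \<Rightarrow> real" where
  "tent_int a b x = ((max 0 (x - a))\<^sup>2 - 2 * (max 0 (x - (a + b) / 2))\<^sup>2 + (max 0 (x - b))\<^sup>2) / 2"

lemma DERIV_truncated_square:
  "((\<lambda>x::real. (max 0 (x - a))\<^sup>2) has_real_derivative 2 * max 0 (x - a)) (at x)"
proof (cases x a rule: linorder_cases)
  case less
  have "((\<lambda>x. 0) has_real_derivative 0) (at x)" by simp
  then show ?thesis using less
    by (subst DERIV_cong_ev[OF refl _ refl, where g = "\<lambda>_. 0"])
      (auto simp: max_def eventually_nhds intro!: exI[of _ "{..<a}"])
next
  case greater
  have "((\<lambda>x. (x - a)\<^sup>2) has_real_derivative 2 * (x - a)) (at x)"
    by (auto intro!: derivative_eq_intros)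
  then show ?thesis using greater
    by (subst DERIV_cong_ev[OF refl _ refl, where g = "\<lambda>x. (x - a)\<^sup>2"])
      (auto simp: max_def eventually_nhds intro!: exI[of _ "{a<..}"])
next
  case equal
  have "(\<lambda>h. ((max 0 (a + h - a))\<^sup>2 - (max 0 (a - a))\<^sup>2) / h) \<midarrow>0\<rightarrow> 0"
  proof (rule tendsto_rabs_zero_cancel, rule tendsto_sandwich[of "\<lambda>_. 0" _ _ "\<lambda>h. \<bar>h\<bar>"])
    show "\<forall>\<^sub>F h in at 0. \<bar>((max 0 (a + h - a))\<^sup>2 - (max 0 (a - a))\<^sup>2) / h\<bar> \<le> \<bar>h\<bar>"
      by (intro always_eventually) (auto simp: max_def power2_eq_square)
    show "((\<lambda>h. \<bar>h\<bar>) \<longlongrightarrow> 0) (at (0::real))" by (intro tendsto_rabs_zero tendsto_ident_at)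
  qed auto
  then show ?thesis unfolding equal DERIV_def by simp
qed

lemma DERIV_tent_int:
  assumes "a \<le> b"
  shows "(tent_int a b has_real_derivative tent a b x) (at x)"
proof -
  have "(tent_int a b has_real_derivative
      (2 * max 0 (x - a) - 2 * (2 * max 0 (x - (a + b) / 2)) + 2 * max 0 (x - b)) / 2) (at x)"
    unfolding tent_int_def by (intro DERIV_cdivide DERIV_add DERIV_diff DERIV_cmult DERIV_truncated_square)
  also have "(2 * max 0 (x - a) - 2 * (2 * max 0 (x - (a + b) / 2)) + 2 * max 0 (x - b)) / 2 = tent a b x"
    using assms by (auto simp: tent_def max_def min_def field_simps)
  finally show ?thesis .
qed

text \<open>Up to the midpoint the primitive is half the square of \<open>x - a\<close>. Beyond
  \<open>b\<close> it is the full area of the triangle, \<open>(b - a)\<^sup>2 / 4\<close>, so the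
  constant is attained.\<close>

lemma tent_int_ge:
  assumes "a \<le> b"
  shows "(covered a b x)\<^sup>2 / 4 \<le> tent_int a b x"
proof -
  consider "x \<le> a" | "a < x" "x \<le> (a + b) / 2" | "(a + b) / 2 < x" "x \<le> b" | "a < x" "b < x" using assms by linarith
  then show ?thesis
  proof cases
    case 3
    then have "2 * (x - (a + b) / 2) \<le> x - a" "0 \<le> 2 * (x - (a + b) / 2)" by (simp_all add: field_simps)
    then have "(2 * (x - (a + b) / 2))\<^sup>2 \<le> (x - a)\<^sup>2" by (rule power_mono)
    then have "4 * (x - (a + b) / 2)\<^sup>2 \<le> (x - a)\<^sup>2" unfolding power_mult_distrib by simp
    moreover have "covered a b x = x - a" "max 0 (x - a) = x - a" "max 0 (x - b) = 0"
      "max 0 (x - (a + b) / 2) = x - (a + b) / 2" using 3 assms by (auto simp: covered_def)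
    ultimately show ?thesis unfolding tent_int_def by simp
  next
    case 4
    have eqs: "covered a b x = b - a" "max 0 (x - a) = x - a" "max 0 (x - b) = x - b"
      "max 0 (x - (a + b) / 2) = x - (a + b) / 2" using 4 assms by (auto simp: covered_def)
    show ?thesis unfolding tent_int_def eqs by (simp add: power2_eq_square field_simps)
  next
    case 1
    then show ?thesis using assms by (simp add: tent_int_def covered_def)
  next
    case 2
    then have "covered a b x = x - a" "max 0 (x - a) = x - a" "max 0 (x - b) = 0"
      "max 0 (x - (a + b) / 2) = 0" using assms by (auto simp: covered_def)
    then show ?thesis unfolding tent_int_def by simp
  qed
qed


lemma square_sum_le_card_sum_squares:
  fixes c :: "nat \<Rightarrow> real"
  shows "(\<Sum>i<m. c i)\<^sup>2 \<le> real m * (\<Sum>i<m. (c i)\<^sup>2)"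
proof -
  have "0 \<le> (\<Sum>i<m. \<Sum>j<m. (c i - c j)\<^sup>2)" by (intro sum_nonneg) auto
  also have "\<dots> = (\<Sum>i<m. \<Sum>j<m. (c i)\<^sup>2) + (\<Sum>i<m. \<Sum>j<m. (c j)\<^sup>2) - 2 * (\<Sum>i<m. \<Sum>j<m. c i * c j)"
    unfolding sum_distrib_left sum.distrib[symmetric] sum_subtractf[symmetric]
    by (intro sum.cong refl) (simp add: power2_eq_square algebra_simps)
  also have "\<dots> = 2 * (real m * (\<Sum>i<m. (c i)\<^sup>2)) - 2 * (\<Sum>i<m. c i)\<^sup>2"
    by (simp add: sum_distrib_left[symmetric] power2_eq_square sum_product)
  finally show ?thesis by simp
qed

text \<open>The primitive of the distance to the thresholds: its increments are controlled by that
  distance, while Cauchy-Schwarz over the intervals keeps it quadratically large.\<close>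
lemma threshold_primitive:
  fixes t :: "nat \<Rightarrow> real" and m :: nat
  assumes t: "\<And>i. t i \<le> t (Suc i)" "t 0 = 0"
  defines "\<mu> \<equiv> \<lambda>x. \<Sum>i<m. tent (t i) (t (Suc i)) x"
    and "H \<equiv> \<lambda>x. \<Sum>i<m. tent_int (t i) (t (Suc i)) x"
  shows "0 \<le> x \<Longrightarrow> x \<le> t m \<Longrightarrow> x\<^sup>2 \<le> 4 * real m * H x"
    and "\<bar>sgn x * H \<bar>x\<bar> + sgn y * H \<bar>y\<bar>\<bar> \<le> \<bar>x + y\<bar> * (\<mu> \<bar>x\<bar> + \<bar>x + y\<bar>)"
proof -
  have pos: "t i \<ge> 0" for i using lift_Suc_mono_le[of t 0 i] t by auto
  show "x\<^sup>2 \<le> 4 * real m * H x" if x: "0 \<le> x" "x \<le> t m"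
  proof -
    have "x\<^sup>2 = (\<Sum>i<m. covered (t i) (t (Suc i)) x)\<^sup>2" using sum_covered[OF t x(1), of m] x by simp
    also have "\<dots> \<le> real m * (\<Sum>i<m. (covered (t i) (t (Suc i)) x)\<^sup>2)"
      by (rule square_sum_le_card_sum_squares)
    also have "\<dots> \<le> real m * (\<Sum>i<m. 4 * tent_int (t i) (t (Suc i)) x)"
    proof (intro mult_left_mono sum_mono)
      fix i show "(covered (t i) (t (Suc i)) x)\<^sup>2 \<le> 4 * tent_int (t i) (t (Suc i)) x"
        using tent_int_ge[OF t(1), of i x] by simp
    qed simp
    finally show ?thesis by (simp add: H_def sum_distrib_left[symmetric])
  qed
  have H0: "H 0 = 0" unfolding H_def tent_int_def
    using pos by (intro sum.neutral) (auto simp: max_absorb1)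
  have deriv: "(H has_real_derivative \<mu> x) (at x)" for x
    unfolding H_def \<mu>_def using t(1) by (intro DERIV_sum DERIV_tent_int)
  \<comment> \<open>The mean value theorem evaluates \<open>\<mu>\<close> at an unknown point; the
    Lipschitz property moves the evaluation to the fixed point \<open>r\<close> at the price of the
    distance.\<close>
  have lip: "\<mu> p \<le> \<mu> r + \<bar>p - r\<bar>" if "0 \<le> p" "0 \<le> r" for p r
  proof -
    have "\<mu> p - \<mu> r \<le> (\<Sum>i<m. \<bar>tent (t i) (t (Suc i)) p - tent (t i) (t (Suc i)) r\<bar>)"
      unfolding \<mu>_def sum_subtractf[symmetric] by (intro sum_mono) simp
    then show ?thesis using sum_tent_diff_le[OF t that, of m] by simp
  qed
  have incr: "\<exists>z. p \<le> z \<and> z \<le> q \<and> H q - H p = (q - p) * \<mu> z" if pq: "p \<le> q" for p q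
  proof (cases "p = q")
    case False
    then have "p < q" using pq by simp
    from MVT2[OF this deriv] obtain z where "p < z" "z < q" "H q - H p = (q - p) * \<mu> z" by blast
    then show ?thesis by (intro exI[of _ z]) auto
  qed auto
  have \<mu>nn: "\<mu> z \<ge> 0" for z unfolding \<mu>_def by (intro sum_nonneg tent_nonneg)
  have bound: "\<bar>H q - H p\<bar> \<le> (q - p) * (\<mu> r + D)"
    if b: "0 \<le> p" "p \<le> q" "0 \<le> r" "\<And>z. p \<le> z \<Longrightarrow> z \<le> q \<Longrightarrow> \<bar>z - r\<bar> \<le> D" for p q r D
  proof -
    obtain z where z: "p \<le> z" "z \<le> q" "H q - H p = (q - p) * \<mu> z" using incr[OF b(2)] by blast
    have "\<mu> z \<le> \<mu> r + D" using lip[of z r] b z by force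
    then have "(q - p) * \<mu> z \<le> (q - p) * (\<mu> r + D)" using b by (intro mult_left_mono) auto
    then show ?thesis using z(3) \<mu>nn[of z] b by simp
  qed
  show "\<bar>sgn x * H \<bar>x\<bar> + sgn y * H \<bar>y\<bar>\<bar> \<le> \<bar>x + y\<bar> * (\<mu> \<bar>x\<bar> + \<bar>x + y\<bar>)"
  proof (cases "x * y \<ge> 0")
    case True
    \<comment> \<open>For equal signs the values of \<open>H\<close> are bounded separately, as
      increments from \<open>0\<close>: every point up to \<open>\<bar>x\<bar>\<close> or
      \<open>\<bar>y\<bar>\<close> lies within \<open>\<bar>x + y\<bar>\<close> of
      \<open>\<bar>x\<bar>\<close>.\<close>
    then have s: "\<bar>x + y\<bar> = \<bar>x\<bar> + \<bar>y\<bar>" by (auto simp: zero_le_mult_iff)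
    have "\<bar>sgn x * H \<bar>x\<bar> + sgn y * H \<bar>y\<bar>\<bar> \<le> \<bar>H \<bar>x\<bar>\<bar> + \<bar>H \<bar>y\<bar>\<bar>"
      by (intro order_trans[OF abs_triangle_ineq] add_mono) (auto simp: abs_mult abs_sgn_eq)
    moreover have "\<bar>H \<bar>x\<bar>\<bar> \<le> \<bar>x\<bar> * (\<mu> \<bar>x\<bar> + \<bar>x + y\<bar>)"
      using bound[of 0 "\<bar>x\<bar>" "\<bar>x\<bar>" "\<bar>x + y\<bar>"] H0 s by (simp add: abs_if split: if_splits)
    moreover have "\<bar>H \<bar>y\<bar>\<bar> \<le> \<bar>y\<bar> * (\<mu> \<bar>x\<bar> + \<bar>x + y\<bar>)"
      using bound[of 0 "\<bar>y\<bar>" "\<bar>x\<bar>" "\<bar>x + y\<bar>"] H0 s by (simp add: abs_if split: if_splits)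
    ultimately show ?thesis unfolding s by (simp add: distrib_right)
  next
    case False
    then have xy: "(x > 0 \<and> y < 0) \<or> (x < 0 \<and> y > 0)" by (auto simp: not_le mult_less_0_iff)
    then have "\<bar>sgn x * H \<bar>x\<bar> + sgn y * H \<bar>y\<bar>\<bar> = \<bar>H \<bar>x\<bar> - H \<bar>y\<bar>\<bar>" by auto
    moreover have s: "\<bar>x + y\<bar> = \<bar>\<bar>x\<bar> - \<bar>y\<bar>\<bar>" using xy by auto
    moreover have "\<bar>H \<bar>x\<bar> - H \<bar>y\<bar>\<bar> \<le> \<bar>\<bar>x\<bar> - \<bar>y\<bar>\<bar> * (\<mu> \<bar>x\<bar> + \<bar>\<bar>x\<bar> - \<bar>y\<bar>\<bar>)"
    proof (cases "\<bar>x\<bar> \<le> \<bar>y\<bar>")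
      case True
      then show ?thesis using bound[of "\<bar>x\<bar>" "\<bar>y\<bar>" "\<bar>x\<bar>" "\<bar>y\<bar> - \<bar>x\<bar>"] by (simp add: abs_minus_commute)
    next
      case False
      then show ?thesis using bound[of "\<bar>y\<bar>" "\<bar>x\<bar>" "\<bar>x\<bar>" "\<bar>x\<bar> - \<bar>y\<bar>"] by simp
    qed
    ultimately show ?thesis by simp
  qed
qed

text \<open>Tents, unlike sharp truncations, make the captured norm continuous in the right
  endpoint, so the intermediate value theorem places the next threshold where exactly
  \<open>C\<close> is captured. If less than that remains, the threshold is \<open>M\<close>, and
  the sequence stays there.\<close>

lemma equidistributed_thresholds:
  fixes f d :: "nat \<Rightarrow> real" and N :: nat
  assumes "0 \<le> M" "0 \<le> C"
  defines "\<Phi> \<equiv> \<lambda>a b. \<Sum>u<N. d u * (tent a b \<bar>f u\<bar>)\<^sup>2"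
  shows "\<exists>t. t 0 = 0 \<and> (\<forall>i. t i \<le> t (Suc i) \<and> t (Suc i) \<le> M \<and> \<Phi> (t i) (t (Suc i)) \<le> C \<and>
     (t (Suc i) < M \<longrightarrow> \<Phi> (t i) (t (Suc i)) = C))"
proof -
  have step: "\<exists>b. 0 \<le> b \<and> b \<le> M \<and> a \<le> b \<and> \<Phi> a b \<le> C \<and> (b < M \<longrightarrow> \<Phi> a b = C)" if a: "0 \<le> a" "a \<le> M" for a
  proof (cases "\<Phi> a M \<le> C")
    case True
    then show ?thesis using a assms(1) by (intro exI[of _ M]) auto
  next
    case False
    have "continuous_on {a..M} (\<Phi> a)" unfolding \<Phi>_def tent_def by (intro continuous_intros)
    moreover have "\<Phi> a a \<le> C" 
    proof -
      have "tent a a x = 0" for x unfolding tent_def by (auto simp: max_def min_def)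
      then show ?thesis using assms(2) unfolding \<Phi>_def by simp
    qed
    ultimately obtain b where "a \<le> b" "b \<le> M" "\<Phi> a b = C"
      using IVT'[of "\<Phi> a" a C M] False a by auto
    then show ?thesis using a by (intro exI[of _ b]) auto
  qed
  have "\<exists>t. \<forall>i. (0 \<le> t i \<and> t i \<le> M \<and> (i = 0 \<longrightarrow> t i = 0)) \<and>
     (t i \<le> t (Suc i) \<and> \<Phi> (t i) (t (Suc i)) \<le> C \<and> (t (Suc i) < M \<longrightarrow> \<Phi> (t i) (t (Suc i)) = C))"
  proof (rule dependent_nat_choice)
    show "\<exists>x. 0 \<le> x \<and> x \<le> M \<and> ((0::nat) = 0 \<longrightarrow> x = 0)" using assms by auto
  next
    fix x :: real and n :: nat assume "0 \<le> x \<and> x \<le> M \<and> (n = 0 \<longrightarrow> x = 0)"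
    then show "\<exists>y. (0 \<le> y \<and> y \<le> M \<and> (Suc n = 0 \<longrightarrow> y = 0)) \<and>
      (x \<le> y \<and> \<Phi> x y \<le> C \<and> (y < M \<longrightarrow> \<Phi> x y = C))" using step[of x] by auto
  qed
  then show ?thesis by blast
qed


lemma sum_squares_le_square_sum_abs:
  fixes x :: "nat \<Rightarrow> real"
  shows "(\<Sum>i<m. (x i)\<^sup>2) \<le> (\<Sum>i<m. \<bar>x i\<bar>)\<^sup>2"
proof (induction m)
  case (Suc m)
  have "0 \<le> (\<Sum>i<m. \<bar>x i\<bar>) * \<bar>x m\<bar>" by (intro mult_nonneg_nonneg sum_nonneg) auto
  then have "0 \<le> 2 * (\<Sum>i<m. \<bar>x i\<bar>) * \<bar>x m\<bar>" by simp
  then show ?case using Suc.IH unfolding sum.lessThan_Suc power2_sum power2_abs by linarith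
qed simp

text \<open>Markov's inequality: more than \<open>l\<close> summands above \<open>E / l\<close>
  would exceed the total, so at least half of the \<open>2 * l\<close> are small.\<close>

lemma many_small_summands:
  fixes e :: "nat \<Rightarrow> real"
  assumes "0 < l" "0 < E" and e: "\<And>i. e i \<ge> 0" "(\<Sum>i<2 * l. e i) \<le> E"
  shows "\<exists>\<sigma>. inj_on \<sigma> {..<l} \<and> (\<forall>i<l. \<sigma> i < 2 * l \<and> e (\<sigma> i) \<le> E / real l)"
proof -
  define J where "J = {i\<in>{..<2 * l}. e i \<le> E / real l}"
  define K where "K = {i\<in>{..<2 * l}. e i > E / real l}"
  have "card J + card K = card (J \<union> K)" unfolding J_def K_def by (intro card_Un_disjoint[symmetric]) auto
  moreover have "J \<union> K = {..<2 * l}" unfolding J_def K_def by auto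
  ultimately have JK: "card J + card K = 2 * l" by simp
  have "card K \<le> l"
  proof (rule ccontr)
    assume "\<not> card K \<le> l"
    then have "E < real (card K) * (E / real l)" using assms(1,2) by (simp add: field_simps)
    also have "\<dots> \<le> (\<Sum>i\<in>K. e i)" unfolding K_def
      by (intro sum_bounded_below) (auto simp: K_def)
    also have "\<dots> \<le> (\<Sum>i<2 * l. e i)" unfolding K_def using e by (intro sum_mono2) auto
    finally show False using e by simp
  qed
  then obtain J' where J': "J' \<subseteq> J" "card J' = l" "finite J'"
    using JK obtain_subset_with_card_n[of l J] by auto
  obtain \<sigma> where \<sigma>: "bij_betw \<sigma> {..<l} J'" using ex_bij_betw_nat_finite[OF J'(3)] J'(2) by (auto simp: atLeast0LessThan)
  then have "\<sigma> i \<in> J" if "i < l" for i using that J'(1) by (auto simp: bij_betw_def)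
  then show ?thesis using \<sigma> unfolding bij_betw_def J_def by blast
qed

text \<open>\<open>p\<close> is a value of \<open>phibar\<close>, and \<open>1 - p\<close> is not
  known to be nonnegative. Only in the second case can the lower bound on \<open>X\<close> be
  multiplied by it.\<close>

lemma phibar_le_of_sweep:
  fixes p :: real
  assumes "2 * (1 - p) * X \<le> Y" "n \<le> c * X" "0 < n" "0 < c" "0 \<le> Y"
  shows "1 - p \<le> c * Y / (2 * n)"
proof (cases "1 - p \<le> 0")
  case True
  have "0 \<le> c * Y / (2 * n)" using assms by simp
  then show ?thesis using True by linarith
next
  case False
  have "2 * (1 - p) * n \<le> 2 * (1 - p) * (c * X)" using False assms by (intro mult_left_mono) auto
  also have "\<dots> = c * (2 * (1 - p) * X)" by simp
  also have "\<dots> \<le> c * Y" using assms by (intro mult_left_mono) auto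
  finally show ?thesis using assms by (simp add: field_simps)
qed

lemma sqnorm_pos_imp_nonzero: "0 < sqnorm N w f \<Longrightarrow> \<exists>u<N. f u \<noteq> 0"
proof (rule ccontr)
  assume "0 < sqnorm N w f" "\<not> (\<exists>u<N. f u \<noteq> 0)"
  moreover from this have "sqnorm N w f = 0" unfolding sqnorm_def by (intro sum.neutral) auto
  ultimately show False by simp
qed

text \<open>Zero energy forces \<open>f u = - f v\<close> along every edge of positive weight, so
  the right-hand side of the sweep vanishes. This covers the degenerate cases, in which the
  thresholds would capture no norm or the gap is zero.\<close>

lemma zero_dual_energy_pair:
  assumes G: "wgraph N w" and f: "sqnorm N w f > 0" and zero_energy: "dual_energy N w f = 0"
  shows "\<exists>A B. A \<subseteq> {u\<in>{..<N}. f u \<noteq> 0} \<and> B \<subseteq> {u\<in>{..<N}. f u \<noteq> 0} \<and> A \<inter> B = {} \<and> A \<union> B \<noteq> {} \<and>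
    1 - phibar N w A B \<le> 0"
proof -
  have f_nz: "\<exists>u<N. f u \<noteq> 0" using f by (rule sqnorm_pos_imp_nonzero)
  have w: "w u v \<ge> 0" if "u < N" "v < N" for u v using G that by (auto simp: wgraph_def)
  have zero: "w u v * \<bar>f u + f v\<bar> = 0" if "u < N" "v < N" for u v
  proof -
    have "w u v * (f u + f v)\<^sup>2 = 0"
    proof (rule ccontr)
      assume "w u v * (f u + f v)\<^sup>2 \<noteq> 0"
      then have "0 < w u v * (f u + f v)\<^sup>2" using w[OF that] by (simp add: less_le)
      also have "\<dots> \<le> (\<Sum>v<N. w u v * (f u + f v)\<^sup>2)" using that w by (intro member_le_sum) auto
      also have "\<dots> \<le> dual_energy N w f" unfolding dual_energy_def
        using that w by (intro member_le_sum[where f = "\<lambda>u. \<Sum>v<N. w u v * (f u + f v)\<^sup>2"] sum_nonneg) auto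
      finally show False using zero_energy by simp
    qed
    then show ?thesis by auto
  qed
  obtain A B where AB: "A \<subseteq> {u\<in>{..<N}. f u > 0}" "B \<subseteq> {u\<in>{..<N}. f u < 0}" "A \<union> B \<noteq> {}"
    "2 * (1 - phibar N w A B) * (\<Sum>u<N. deg N w u * \<bar>f u\<bar>) \<le> (\<Sum>u<N. \<Sum>v<N. w u v * \<bar>f u + f v\<bar>)"
    using signed_sweep[OF G f_nz] by blast
  have X: "0 < (\<Sum>u<N. deg N w u * \<bar>f u\<bar>)"
  proof -
    obtain u where u: "u < N" "f u \<noteq> 0" using f_nz by blast
    then have "0 < deg N w u * \<bar>f u\<bar>" using deg_pos[OF G] by simp
    also have "\<dots> \<le> (\<Sum>u<N. deg N w u * \<bar>f u\<bar>)" using u deg_pos[OF G]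
      by (intro member_le_sum) (auto simp: less_imp_le)
    finally show ?thesis .
  qed
  have "(\<Sum>u<N. \<Sum>v<N. w u v * \<bar>f u + f v\<bar>) = 0" using zero by (intro sum.neutral ballI) auto
  then have "1 - phibar N w A B \<le> 0" using AB(4) X by (simp add: mult_le_0_iff)
  moreover have "{u\<in>{..<N}. f u > 0} \<subseteq> {u\<in>{..<N}. f u \<noteq> 0}" "{u\<in>{..<N}. f u < 0} \<subseteq> {u\<in>{..<N}. f u \<noteq> 0}"
    "{u\<in>{..<N}. f u > 0} \<inter> {u\<in>{..<N}. f u < 0} = {}" by auto
  then have "A \<subseteq> {u\<in>{..<N}. f u \<noteq> 0}" "B \<subseteq> {u\<in>{..<N}. f u \<noteq> 0}" "A \<inter> B = {}"
    using AB(1,2) by blast+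
  ultimately show ?thesis using AB(3) by blast
qed

text \<open>Of the constant 16, the factor \<open>8 * l\<close> comes from Cauchy-Schwarz over
  \<open>2 * l\<close> intervals, 4 from the bound on the swept edge sum, and \<open>1 / 2\<close>
  from the normalization of the sweep.\<close>

lemma improved_dual_cheeger:
  assumes G: "wgraph N w" and l: "1 \<le> l" "l \<le> N" and gap: "dual_gap N w l > 0" and f: "sqnorm N w f > 0"
  shows "\<exists>A B. A \<subseteq> {u\<in>{..<N}. f u \<noteq> 0} \<and> B \<subseteq> {u\<in>{..<N}. f u \<noteq> 0} \<and> A \<inter> B = {} \<and> A \<union> B \<noteq> {} \<and>
    1 - phibar N w A B \<le> 16 * real l * dual_energy N w f / sqnorm N w f / sqrt (dual_gap N w l)"
proof -
  define E where "E = dual_energy N w f"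
  define g where "g = dual_gap N w l"
  have g: "0 < g" "g \<le> 2" using gap dual_gap_bounds(2)[OF G l] by (auto simp: g_def)
  have "E \<ge> 0" unfolding E_def by (rule dual_energy_nonneg[OF G])
  have w: "w u v \<ge> 0" if "u < N" "v < N" for u v using G that by (auto simp: wgraph_def)
  have f_nz: "\<exists>u<N. f u \<noteq> 0" using f by (rule sqnorm_pos_imp_nonzero)
  define M where "M = Max ((\<lambda>u. \<bar>f u\<bar>) ` {..<N})"
  \<comment> \<open>Chosen so that the average energy \<open>E / l\<close> granted to a good
    truncation equals \<open>g / 2\<close> times its norm \<open>C\<close>, which is half of what
    the min-max principle permits.\<close>
  define C where "C = 2 * E / (real l * g)"
  have fM: "\<bar>f u\<bar> \<le> M" if "u < N" for u unfolding M_def using that by (intro Max_ge) auto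
  have "0 \<le> M" using f_nz fM by (metis abs_ge_zero order_trans)
  moreover have "0 \<le> C" unfolding C_def using g \<open>E \<ge> 0\<close> by simp
  ultimately obtain t where t0: "t 0 = 0" and
    t_step: "\<forall>i. t i \<le> t (Suc i) \<and> t (Suc i) \<le> M \<and>
      (\<Sum>u<N. deg N w u * (tent (t i) (t (Suc i)) \<bar>f u\<bar>)\<^sup>2) \<le> C \<and>
      (t (Suc i) < M \<longrightarrow> (\<Sum>u<N. deg N w u * (tent (t i) (t (Suc i)) \<bar>f u\<bar>)\<^sup>2) = C)"
    using equidistributed_thresholds[of M C "deg N w" f N] by blast
  define \<Phi> where "\<Phi> i = (\<Sum>u<N. deg N w u * (tent (t i) (t (Suc i)) \<bar>f u\<bar>)\<^sup>2)" for i
  have t: "t 0 = 0" "\<And>i. t i \<le> t (Suc i)" "\<And>i. t (Suc i) \<le> M" "\<And>i. \<Phi> i \<le> C"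
    "\<And>i. t (Suc i) < M \<Longrightarrow> \<Phi> i = C"
    using t0 t_step unfolding \<Phi>_def by blast+
  show ?thesis
  proof (cases "E = 0")
    case True
    then show ?thesis using zero_dual_energy_pair[OF G f] unfolding E_def by simp
  next
    case False
    then have "E > 0" using \<open>E \<ge> 0\<close> by simp
    then have "C > 0" unfolding C_def using g l by simp
    have "t (2 * l) = M"
    proof (rule ccontr)
      assume "t (2 * l) \<noteq> M"
      obtain l' where l': "2 * l = Suc l'" using l by (cases "2 * l") auto
      then have "t (2 * l) < M" using \<open>t (2 * l) \<noteq> M\<close> t(3)[of l'] by simp
      then have \<Phi>C: "\<Phi> i = C" if "i < 2 * l" for i
        using lift_Suc_mono_le[of t "Suc i" "2 * l"] t(2) that by (intro t(5)) auto
      define h where "h i u = sgn (f u) * tent (t i) (t (Suc i)) \<bar>f u\<bar>" for i u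
      have nonneg: "t i \<ge> 0" for i using lift_Suc_mono_le[of t 0 i] t by auto
      have tent0: "tent (t i) (t (Suc i)) 0 = 0" for i using nonneg[of i] by (simp add: tent_def)
      have h_norm: "sqnorm N w (h i) = \<Phi> i" for i
        unfolding sqnorm_def \<Phi>_def h_def
        by (intro sum.cong refl) (auto simp: sgn_real_def tent0)
      have "(\<Sum>i<2 * l. dual_energy N w (h i)) = (\<Sum>u<N. \<Sum>v<N. w u v * (\<Sum>i<2 * l. (h i u + h i v)\<^sup>2))"
      proof -
        have "(\<Sum>i<2 * l. dual_energy N w (h i)) = (\<Sum>u<N. \<Sum>i<2 * l. \<Sum>v<N. w u v * (h i u + h i v)\<^sup>2)"
          unfolding dual_energy_def by (rule sum.swap)
        also have "\<dots> = (\<Sum>u<N. \<Sum>v<N. \<Sum>i<2 * l. w u v * (h i u + h i v)\<^sup>2)"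
          by (intro sum.cong[OF refl] sum.swap)
        finally show ?thesis by (simp add: sum_distrib_left)
      qed
      also have "\<dots> \<le> E" unfolding E_def dual_energy_def
      proof (intro sum_mono mult_left_mono)
        fix u v assume "u \<in> {..<N}" "v \<in> {..<N}"
        then show "0 \<le> w u v" using w by auto
        have "(\<Sum>i<2 * l. (h i u + h i v)\<^sup>2) \<le> (\<Sum>i<2 * l. \<bar>h i u + h i v\<bar>)\<^sup>2"
          by (rule sum_squares_le_square_sum_abs)
        also have "\<dots> \<le> \<bar>f u + f v\<bar>\<^sup>2" unfolding h_def
          by (intro power_mono sum_signed_tent_diff_le[OF t(2,1)] sum_nonneg) auto
        finally show "(\<Sum>i<2 * l. (h i u + h i v)\<^sup>2) \<le> (f u + f v)\<^sup>2" by simp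
      qed
      finally obtain \<sigma> where \<sigma>: "inj_on \<sigma> {..<l}"
        "\<forall>i<l. \<sigma> i < 2 * l \<and> dual_energy N w (h (\<sigma> i)) \<le> E / real l"
        using many_small_summands[of l E "\<lambda>i. dual_energy N w (h i)"] \<open>E > 0\<close> l dual_energy_nonneg[OF G] by auto
      \<comment> \<open>The \<open>2 * l\<close> truncations all have norm \<open>C\<close> and
        total energy at most \<open>E\<close>; the \<open>l\<close> cheapest of them contradict the
        min-max principle.\<close>
      have "g \<le> g / 2" unfolding g_def
      proof (rule dual_gap_le_disjoint_supports[OF G l, where g = "\<lambda>i. h (\<sigma> i)"])
        fix i j u assume ij: "i < l" "j < l" "i \<noteq> j"
        then have "\<sigma> i \<noteq> \<sigma> j" using \<sigma>(1) by (auto simp: inj_on_def)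
        then show "h (\<sigma> i) u = 0 \<or> h (\<sigma> j) u = 0"
          unfolding h_def using tent_disjoint[of t "\<sigma> i" "\<sigma> j" "\<bar>f u\<bar>", OF t(2)] by auto
      next
        fix i assume "i < l"
        then have i: "\<sigma> i < 2 * l" "dual_energy N w (h (\<sigma> i)) \<le> E / real l" using \<sigma>(2) by auto
        show "0 < sqnorm N w (h (\<sigma> i))" using \<Phi>C[OF i(1)] \<open>C > 0\<close> by (simp add: h_norm)
        have "E / real l = g / 2 * C" unfolding C_def using g l by simp
        then show "dual_energy N w (h (\<sigma> i)) \<le> dual_gap N w l / 2 * sqnorm N w (h (\<sigma> i))"
          using i(2) unfolding h_norm \<Phi>C[OF i(1)] g_def[symmetric] by linarith
      qed
      then show False using g by simp
    qed
    define \<mu> where "\<mu> x = (\<Sum>i<2 * l. tent (t i) (t (Suc i)) x)" for x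
    define H where "H x = (\<Sum>i<2 * l. tent_int (t i) (t (Suc i)) x)" for x
    note H = threshold_primitive[where m = "2 * l", OF t(2,1), folded \<mu>_def H_def]
    define h where "h u = sgn (f u) * H \<bar>f u\<bar>" for u
    have h_ge: "(f u)\<^sup>2 \<le> 8 * real l * \<bar>h u\<bar>" if "u < N" for u
    proof (cases "f u = 0")
      case False
      have "(f u)\<^sup>2 \<le> 4 * real (2 * l) * H \<bar>f u\<bar>"
        using H(1)[of "\<bar>f u\<bar>"] fM[OF that] \<open>t (2 * l) = M\<close> by simp
      also have "\<dots> \<le> 8 * real l * \<bar>h u\<bar>" using False
        by (auto simp: h_def abs_mult abs_sgn_eq intro!: mult_left_mono)
      finally show ?thesis .
    qed (simp add: h_def)
    have "\<exists>u<N. h u \<noteq> 0"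
    proof -
      obtain u where u: "u < N" "f u \<noteq> 0" using f_nz by blast
      then have "h u \<noteq> 0" using h_ge[of u] by auto
      then show ?thesis using u by blast
    qed
    from signed_sweep[OF G this] obtain A B where AB:
      "A \<subseteq> {u\<in>{..<N}. h u > 0}" "B \<subseteq> {u\<in>{..<N}. h u < 0}" "A \<union> B \<noteq> {}"
      "2 * (1 - phibar N w A B) * (\<Sum>u<N. deg N w u * \<bar>h u\<bar>) \<le> (\<Sum>u<N. \<Sum>v<N. w u v * \<bar>h u + h v\<bar>)"
      by blast
    have X: "sqnorm N w f \<le> 8 * real l * (\<Sum>u<N. deg N w u * \<bar>h u\<bar>)"
      unfolding sqnorm_def sum_distrib_left
    proof (intro sum_mono)
      fix u assume "u \<in> {..<N}"
      then have "deg N w u * (f u)\<^sup>2 \<le> deg N w u * (8 * real l * \<bar>h u\<bar>)"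
        using deg_pos[OF G, of u] h_ge[of u] by (intro mult_left_mono) auto
      then show "deg N w u * (f u)\<^sup>2 \<le> 8 * real l * (deg N w u * \<bar>h u\<bar>)" by (simp add: mult_ac)
    qed
    \<comment> \<open>Supports of distinct tents are disjoint, so the squares add, and each of the
      \<open>2 * l\<close> intervals contributes at most \<open>C\<close>.\<close>
    have norm_\<mu>: "(\<Sum>u<N. deg N w u * (\<mu> \<bar>f u\<bar>)\<^sup>2) \<le> 4 * E / g"
    proof -
      have "(\<Sum>u<N. deg N w u * (\<mu> \<bar>f u\<bar>)\<^sup>2) = (\<Sum>u<N. \<Sum>i<2 * l. deg N w u * (tent (t i) (t (Suc i)) \<bar>f u\<bar>)\<^sup>2)"
        unfolding \<mu>_def sum_distrib_left[symmetric] using tent_disjoint[of t, OF t(2)]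
        by (intro sum.cong refl) (subst square_sum_one_active, auto)
      also have "\<dots> = (\<Sum>i<2 * l. \<Phi> i)" unfolding \<Phi>_def by (rule sum.swap)
      also have "\<dots> \<le> real (card {..<2 * l}) * C" using t(4) by (intro sum_bounded_above) auto
      also have "\<dots> = 4 * E / g" unfolding C_def using l by simp
      finally show ?thesis .
    qed
    \<comment> \<open>The value at which \<open>s / 2 * E\<close> and
      \<open>1 / (2 * s) * (4 * E / g)\<close> coincide.\<close>
    define s where "s = 2 / sqrt g"
    have sg: "0 < sqrt g" "sqrt g * sqrt g = g" using g by auto
    have s: "0 < s" using sg unfolding s_def by simp
    have Y: "(\<Sum>u<N. \<Sum>v<N. w u v * \<bar>h u + h v\<bar>) \<le> 4 * E / sqrt g"
    proof -
      have "(\<Sum>u<N. \<Sum>v<N. w u v * \<bar>h u + h v\<bar>)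
        \<le> (\<Sum>u<N. \<Sum>v<N. (1 + s / 2) * (w u v * (f u + f v)\<^sup>2) + 1 / (2 * s) * (w u v * (\<mu> \<bar>f u\<bar>)\<^sup>2))"
      proof (intro sum_mono)
        fix u v assume "u \<in> {..<N}" "v \<in> {..<N}"
        define x where "x = \<bar>f u + f v\<bar>"
        define y where "y = \<mu> \<bar>f u\<bar>"
        \<comment> \<open>AM-GM with a weight that balances the two resulting sums\<close>
        have "x * y \<le> s / 2 * x\<^sup>2 + 1 / (2 * s) * y\<^sup>2"
        proof -
          have "0 \<le> (s * x - y)\<^sup>2 / (2 * s)" using s by simp
          also have "\<dots> = s / 2 * x\<^sup>2 + 1 / (2 * s) * y\<^sup>2 - x * y"
            using s by (simp add: field_simps power2_eq_square)
          finally show ?thesis by simp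
        qed
        moreover have "\<bar>h u + h v\<bar> \<le> x * (y + x)" unfolding h_def x_def y_def by (rule H(2))
        ultimately have "\<bar>h u + h v\<bar> \<le> (1 + s / 2) * x\<^sup>2 + 1 / (2 * s) * y\<^sup>2"
          by (simp add: algebra_simps power2_eq_square)
        then have "w u v * \<bar>h u + h v\<bar> \<le> w u v * ((1 + s / 2) * x\<^sup>2 + 1 / (2 * s) * y\<^sup>2)"
          using w \<open>u \<in> _\<close> \<open>v \<in> _\<close> by (intro mult_left_mono) auto
        also have "\<dots> = (1 + s / 2) * (w u v * (f u + f v)\<^sup>2) + 1 / (2 * s) * (w u v * (\<mu> \<bar>f u\<bar>)\<^sup>2)"
          unfolding x_def y_def power2_abs by (simp only: distrib_left mult.left_commute)
        finally show "w u v * \<bar>h u + h v\<bar>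
          \<le> (1 + s / 2) * (w u v * (f u + f v)\<^sup>2) + 1 / (2 * s) * (w u v * (\<mu> \<bar>f u\<bar>)\<^sup>2)" .
      qed
      also have "\<dots> = (1 + s / 2) * E + 1 / (2 * s) * (\<Sum>u<N. deg N w u * (\<mu> \<bar>f u\<bar>)\<^sup>2)"
        unfolding sum.distrib sum_distrib_left[symmetric] sum_weights_fst E_def dual_energy_def ..
      also have "\<dots> \<le> (1 + s / 2) * E + 1 / (2 * s) * (4 * E / g)"
        using s norm_\<mu> by (intro add_left_mono mult_left_mono) auto
      also have "\<dots> = E + E / sqrt g + E / sqrt g"
      proof -
        have "1 / (2 * (2 / r)) * (4 * E / (r * r)) = E / r" if "r > 0" for r :: real
          using that by (simp add: field_simps)
        from this[OF sg(1)] have "1 / (2 * s) * (4 * E / g) = E / sqrt g" unfolding sg(2) s_def .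
        then show ?thesis by (simp add: s_def distrib_right)
      qed
      \<comment> \<open>The bound \<open>g \<le> 2\<close> lets the term \<open>E\<close>, which
        carries no factor \<open>1 / sqrt g\<close>, be absorbed.\<close>
      also have "\<dots> \<le> 4 * E / sqrt g"
      proof -
        have "sqrt g \<le> sqrt 4" using g by (intro real_sqrt_le_mono) simp
        then have "E * sqrt g \<le> E * 2" using \<open>E > 0\<close> by simp
        then have "E \<le> 2 * (E / sqrt g)" using sg by (simp add: field_simps)
        moreover have "4 * E / sqrt g = 4 * (E / sqrt g)" by simp
        ultimately show ?thesis by linarith
      qed
      finally show ?thesis .
    qed
    have "1 - phibar N w A B \<le> 8 * real l * (4 * E / sqrt g) / (2 * sqnorm N w f)"
      using AB(4) Y X f l \<open>E > 0\<close> sg by (intro phibar_le_of_sweep[where X = "\<Sum>u<N. deg N w u * \<bar>h u\<bar>"]) auto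
    also have "\<dots> = 16 * real l * E / sqnorm N w f / sqrt g" by (simp add: mult_ac)
    finally have "1 - phibar N w A B \<le> 16 * real l * E / sqnorm N w f / sqrt g" .
    moreover have supp: "f u \<noteq> 0" if "h u > 0 \<or> h u < 0" for u using that by (auto simp: h_def)
    have "{u\<in>{..<N}. h u > 0} \<subseteq> {u\<in>{..<N}. f u \<noteq> 0}" "{u\<in>{..<N}. h u < 0} \<subseteq> {u\<in>{..<N}. f u \<noteq> 0}"
      "{u\<in>{..<N}. h u > 0} \<inter> {u\<in>{..<N}. h u < 0} = {}" using supp by auto
    then have "A \<subseteq> {u\<in>{..<N}. f u \<noteq> 0}" "B \<subseteq> {u\<in>{..<N}. f u \<noteq> 0}" "A \<inter> B = {}"
      using AB(1,2) by blast+
    ultimately show ?thesis unfolding E_def g_def using AB(3) by blast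
  qed
qed

section \<open>Ball carving in projective space\<close>

text \<open>A group of least cardinality with mass at least \<open>1 / 2\<close> has mass at most
  \<open>b\<close>: it is a singleton, or it splits into two parts that are both below
  \<open>1 / 2\<close>, and \<open>1 \<le> b\<close>. Removing it leaves enough for the remaining
  groups.\<close>

lemma greedy_grouping:
  fixes m :: "'a \<Rightarrow> real"
  assumes "finite S" and m: "\<And>s. s \<in> S \<Longrightarrow> 0 \<le> m s \<and> m s \<le> b" and "1 \<le> b"
    and total: "(real k - 1) * b + 1 / 2 \<le> (\<Sum>s\<in>S. m s)"
  shows "\<exists>G. (\<forall>i<k. G i \<subseteq> S \<and> 1 / 2 \<le> (\<Sum>s\<in>G i. m s)) \<and> (\<forall>i<k. \<forall>j<k. i \<noteq> j \<longrightarrow> G i \<inter> G j = {})"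
  using assms
proof (induction k arbitrary: S)
  case 0
  then show ?case by simp
next
  case (Suc k)
  define P where "P T \<longleftrightarrow> T \<subseteq> S \<and> 1 / 2 \<le> (\<Sum>s\<in>T. m s)" for T
  have "0 \<le> real k * b" using Suc.prems by simp
  then have "P S" using Suc.prems(4) unfolding P_def by simp
  then obtain T where T: "P T" and min: "\<And>T'. P T' \<Longrightarrow> card T \<le> card T'"
    using ex_has_least_nat[of P S card] by blast
  have "finite T" using T Suc.prems(1) unfolding P_def by (auto intro: finite_subset)
  have small: "(\<Sum>s\<in>T'. m s) < 1 / 2" if "T' \<subset> T" for T'
  proof (rule ccontr)
    assume "\<not> ?thesis"
    then have "P T'" using T that unfolding P_def by auto
    then have "card T \<le> card T'" by (rule min)
    then show False using psubset_card_mono[OF \<open>finite T\<close> that] by simp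
  qed
  have T_le: "(\<Sum>s\<in>T. m s) \<le> b"
  proof -
    have "T \<noteq> {}" using T unfolding P_def by auto
    then obtain s where s: "s \<in> T" by blast
    show ?thesis
    proof (cases "T = {s}")
      case True
      then show ?thesis using Suc.prems(2)[of s] T unfolding P_def by auto
    next
      case False
      have "(\<Sum>s\<in>T. m s) = m s + (\<Sum>s\<in>T - {s}. m s)" using \<open>finite T\<close> s by (rule sum.remove)
      moreover have "m s < 1 / 2" using small[of "{s}"] s False by auto
      moreover have "(\<Sum>s\<in>T - {s}. m s) < 1 / 2" using small[of "T - {s}"] s by auto
      ultimately show ?thesis using Suc.prems(3) by linarith
    qed
  qed
  have "(\<Sum>s\<in>S. m s) = (\<Sum>s\<in>S - T. m s) + (\<Sum>s\<in>T. m s)"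
    using T Suc.prems(1) unfolding P_def by (intro sum.subset_diff) auto
  then have rest: "(real k - 1) * b + 1 / 2 \<le> (\<Sum>s\<in>S - T. m s)"
    using Suc.prems(4) T_le by (simp add: left_diff_distrib)
  obtain G where G: "\<forall>i<k. G i \<subseteq> S - T \<and> 1 / 2 \<le> (\<Sum>s\<in>G i. m s)"
    "\<forall>i<k. \<forall>j<k. i \<noteq> j \<longrightarrow> G i \<inter> G j = {}"
    using Suc.IH[OF _ _ Suc.prems(3) rest] Suc.prems(1,2) by auto
  define G' where "G' i = (if i = k then T else G i)" for i
  have "\<forall>i<Suc k. G' i \<subseteq> S \<and> 1 / 2 \<le> (\<Sum>s\<in>G' i. m s)"
    using G(1) T unfolding G'_def P_def by (auto simp: less_Suc_eq)
  moreover have "\<forall>i<Suc k. \<forall>j<Suc k. i \<noteq> j \<longrightarrow> G' i \<inter> G' j = {}"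
    using G unfolding G'_def by (auto simp: less_Suc_eq)
  ultimately show ?case by blast
qed

lemma slow_growth_step:
  fixes a :: "nat \<Rightarrow> real"
  assumes "0 < J" "0 \<le> \<epsilon>" "0 \<le> a 0" "a J \<le> (1 + \<epsilon>) ^ J * a 0"
  shows "\<exists>j<J. a (Suc j) \<le> (1 + \<epsilon>) * a j"
proof (rule ccontr)
  assume "\<not> ?thesis"
  then have grow: "a (Suc j) > (1 + \<epsilon>) * a j" if "j < J" for j using that by (auto simp: not_le)
  have "a (Suc j) > (1 + \<epsilon>) ^ (Suc j) * a 0" if "Suc j \<le> J" for j
    using that
  proof (induction j)
    case 0
    then show ?case using grow[of 0] by simp
  next
    case (Suc j)
    have "(1 + \<epsilon>) * ((1 + \<epsilon>) ^ (Suc j) * a 0) \<le> (1 + \<epsilon>) * a (Suc j)"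
      using Suc assms(2) by (intro mult_left_mono) auto
    also have "\<dots> < a (Suc (Suc j))" using grow[of "Suc j"] Suc.prems by simp
    finally show ?case by (simp add: mult_ac)
  qed
  from this[of "J - 1"] show False using assms by simp
qed

text \<open>Region growing: each ball is enlarged until its outer layer carries only a small fraction
  of its mass; a ball of maximal mass among those of half radius makes this happen after
  logarithmically many steps in the doubling constant \<open>K\<close>.\<close>
lemma ball_carving:
  fixes m :: "'a \<Rightarrow> real" and \<rho> :: "'a \<Rightarrow> 'a \<Rightarrow> real"
  assumes m: "\<And>u. 0 \<le> m u"
    and refl: "\<And>u. u \<in> V \<Longrightarrow> \<rho> u u = 0"
    and tri: "\<And>c u v. c \<in> V \<Longrightarrow> u \<in> V \<Longrightarrow> v \<in> V \<Longrightarrow> \<rho> c v \<le> \<rho> c u + \<rho> u v"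
    and pos: "0 < \<Delta>" "0 < J" "0 \<le> \<epsilon>"
    and doubling: "\<And>R c m0. R \<subseteq> V \<Longrightarrow> c \<in> R \<Longrightarrow>
      (\<And>p. p \<in> R \<Longrightarrow> (\<Sum>u\<in>{u\<in>R. \<rho> p u \<le> \<Delta> / 2}. m u) \<le> m0) \<Longrightarrow> 0 \<le> m0 \<Longrightarrow>
      (\<Sum>u\<in>{u\<in>R. \<rho> c u \<le> \<Delta>}. m u) \<le> (1 + \<epsilon>) ^ J * m0"
    and "finite V"
  shows "R \<subseteq> V \<Longrightarrow> \<exists>\<S>. finite \<S> \<and> (\<forall>S\<in>\<S>. S \<subseteq> R \<and> (\<exists>c\<in>R. \<forall>u\<in>S. \<rho> c u \<le> \<Delta>)) \<and>
     (\<forall>S\<in>\<S>. \<forall>T\<in>\<S>. S \<noteq> T \<longrightarrow> (\<forall>u\<in>S. \<forall>v\<in>T. \<Delta> / (2 * real J) < \<rho> u v \<or> \<Delta> / (2 * real J) < \<rho> v u)) \<and>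
     (\<Sum>u\<in>R. m u) \<le> (1 + \<epsilon>) * (\<Sum>S\<in>\<S>. \<Sum>u\<in>S. m u)"
proof (induction "card R" arbitrary: R rule: less_induct)
  case less
  have fin: "finite R" using less.prems \<open>finite V\<close> by (rule finite_subset)
  show ?case
  proof (cases "R = {}")
    case True
    then show ?thesis by (intro exI[of _ "{}"]) auto
  next
    case False
    \<comment> \<open>The radii run from \<open>\<Delta> / 2\<close> to \<open>\<Delta>\<close> in
      \<open>J\<close> layers of this width.\<close>
    define \<delta> where "\<delta> = \<Delta> / (2 * real J)"
    have \<delta>: "\<delta> > 0" using pos unfolding \<delta>_def by simp
    define h where "h p = (\<Sum>u\<in>{u\<in>R. \<rho> p u \<le> \<Delta> / 2}. m u)" for p
    obtain c where c: "c \<in> R" "\<And>p. p \<in> R \<Longrightarrow> h p \<le> h c"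
    proof -
      have "Max (h ` R) \<in> h ` R" using fin False by (intro Max_in) auto
      then obtain c where "c \<in> R" "h c = Max (h ` R)" by auto
      moreover have "h p \<le> Max (h ` R)" if "p \<in> R" for p using that fin by (intro Max_ge) auto
      ultimately show ?thesis using that by metis
    qed
    define ball where "ball j = {u\<in>R. \<rho> c u \<le> \<Delta> / 2 + real j * \<delta>}" for j
    have "(\<Sum>u\<in>ball J. m u) \<le> (1 + \<epsilon>) ^ J * h c"
    proof -
      have "\<Delta> / 2 + real J * \<delta> = \<Delta>" unfolding \<delta>_def using pos by (simp add: field_simps)
      then show ?thesis unfolding ball_def
        using doubling[OF less.prems c(1), of "h c"] c m unfolding h_def by (simp add: sum_nonneg)
    qed
    moreover have "h c = (\<Sum>u\<in>ball 0. m u)" unfolding h_def ball_def by simp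
    ultimately obtain j where j: "j < J" "(\<Sum>u\<in>ball (Suc j). m u) \<le> (1 + \<epsilon>) * (\<Sum>u\<in>ball j. m u)"
      using slow_growth_step[of J \<epsilon> "\<lambda>j. \<Sum>u\<in>ball j. m u"] pos m by (auto simp: sum_nonneg)
    \<comment> \<open>Only \<open>ball j\<close> becomes a cluster, but the whole next ball is
      removed: the layer between them is the discarded mass, and it separates the cluster from
      everything chosen later.\<close>
    define R' where "R' = R - ball (Suc j)"
    have c_ball: "c \<in> ball i" for i unfolding ball_def using c refl[of c] less.prems \<delta> pos by auto
    have "R' \<subset> R" unfolding R'_def using c_ball[of "Suc j"] c by auto
    then have "card R' < card R" using fin by (intro psubset_card_mono)
    moreover have "R' \<subseteq> V" using \<open>R' \<subset> R\<close> less.prems by auto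
    ultimately have "\<exists>\<S>. finite \<S> \<and> (\<forall>S\<in>\<S>. S \<subseteq> R' \<and> (\<exists>c\<in>R'. \<forall>u\<in>S. \<rho> c u \<le> \<Delta>)) \<and>
      (\<forall>S\<in>\<S>. \<forall>T\<in>\<S>. S \<noteq> T \<longrightarrow> (\<forall>u\<in>S. \<forall>v\<in>T. \<delta> < \<rho> u v \<or> \<delta> < \<rho> v u)) \<and>
      (\<Sum>u\<in>R'. m u) \<le> (1 + \<epsilon>) * (\<Sum>S\<in>\<S>. \<Sum>u\<in>S. m u)"
      unfolding \<delta>_def by (rule less.hyps)
    then obtain \<S> where \<S>: "finite \<S>" "\<forall>S\<in>\<S>. S \<subseteq> R' \<and> (\<exists>c\<in>R'. \<forall>u\<in>S. \<rho> c u \<le> \<Delta>)"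
      "\<forall>S\<in>\<S>. \<forall>T\<in>\<S>. S \<noteq> T \<longrightarrow> (\<forall>u\<in>S. \<forall>v\<in>T. \<delta> < \<rho> u v \<or> \<delta> < \<rho> v u)"
      "(\<Sum>u\<in>R'. m u) \<le> (1 + \<epsilon>) * (\<Sum>S\<in>\<S>. \<Sum>u\<in>S. m u)"
      by (elim exE conjE)
    have far: "\<delta> < \<rho> u v" if "u \<in> ball j" "v \<in> R'" for u v
    proof -
      have "\<rho> c u \<le> \<Delta> / 2 + real j * \<delta>" "\<Delta> / 2 + real (Suc j) * \<delta> < \<rho> c v" "u \<in> R" "v \<in> R"
        using that unfolding ball_def R'_def by auto
      moreover have "\<rho> c v \<le> \<rho> c u + \<rho> u v"
        using tri c \<open>u \<in> R\<close> \<open>v \<in> R\<close> less.prems by blast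
      moreover have "real (Suc j) * \<delta> = real j * \<delta> + \<delta>" by (simp add: algebra_simps)
      ultimately show ?thesis by linarith
    qed
    \<comment> \<open>Without this, inserting the new cluster might add no summand. The centre
      \<open>c\<close> lies in \<open>ball j\<close> but not in \<open>R'\<close>.\<close>
    have notin: "ball j \<notin> \<S>"
    proof
      assume "ball j \<in> \<S>"
      then have "c \<in> R'" using \<S>(2) c_ball[of j] by blast
      then show False using c_ball[of "Suc j"] unfolding R'_def by simp
    qed
    have "real j * \<delta> \<le> real J * \<delta>" using j \<delta> by (intro mult_right_mono) auto
    also have "real J * \<delta> = \<Delta> / 2" unfolding \<delta>_def using pos by simp
    finally have "ball j \<subseteq> R \<and> (\<exists>c\<in>R. \<forall>u\<in>ball j. \<rho> c u \<le> \<Delta>)"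
      using c(1) unfolding ball_def by force
    moreover have "\<forall>S\<in>\<S>. S \<subseteq> R \<and> (\<exists>c\<in>R. \<forall>u\<in>S. \<rho> c u \<le> \<Delta>)"
    proof
      fix S assume "S \<in> \<S>"
      then have "S \<subseteq> R'" "\<exists>c\<in>R'. \<forall>u\<in>S. \<rho> c u \<le> \<Delta>" using \<S>(2) by auto
      then show "S \<subseteq> R \<and> (\<exists>c\<in>R. \<forall>u\<in>S. \<rho> c u \<le> \<Delta>)" using \<open>R' \<subset> R\<close> by auto
    qed
    ultimately have "\<forall>S\<in>insert (ball j) \<S>. S \<subseteq> R \<and> (\<exists>c\<in>R. \<forall>u\<in>S. \<rho> c u \<le> \<Delta>)" by simp
    moreover have "\<forall>S\<in>insert (ball j) \<S>. \<forall>T\<in>insert (ball j) \<S>. S \<noteq> T \<longrightarrow>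
        (\<forall>u\<in>S. \<forall>v\<in>T. \<delta> < \<rho> u v \<or> \<delta> < \<rho> v u)"
    proof (intro ballI impI)
      fix S T u v assume ST: "S \<in> insert (ball j) \<S>" "T \<in> insert (ball j) \<S>" "S \<noteq> T" and uv: "u \<in> S" "v \<in> T"
      consider "S = ball j" "T \<in> \<S>" | "S \<in> \<S>" "T = ball j" | "S \<in> \<S>" "T \<in> \<S>" using ST by auto
      then show "\<delta> < \<rho> u v \<or> \<delta> < \<rho> v u"
      proof cases
        case 1
        then have "v \<in> R'" using \<S>(2) uv by auto
        then show ?thesis using far 1 uv by auto
      next
        case 2
        then have "u \<in> R'" using \<S>(2) uv by auto
        then show ?thesis using far 2 uv by auto
      next
        case 3
        then show ?thesis using \<S>(3) ST(3) uv by auto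
      qed
    qed
    moreover have "(\<Sum>u\<in>R. m u) \<le> (1 + \<epsilon>) * (\<Sum>S\<in>insert (ball j) \<S>. \<Sum>u\<in>S. m u)"
    proof -
      have "(\<Sum>u\<in>R. m u) = (\<Sum>u\<in>R'. m u) + (\<Sum>u\<in>ball (Suc j). m u)"
        unfolding R'_def using fin by (intro sum.subset_diff) (auto simp: ball_def)
      then show ?thesis using j(2) \<S>(1,4) notin by (simp add: distrib_left)
    qed
    ultimately show ?thesis
      using \<S>(1) unfolding \<delta>_def by (intro exI[of _ "insert (ball j) \<S>"] conjI) (simp_all only: finite_insert)
  qed
qed

section \<open>Lattice point count and doubling of the projective distance\<close>

lemma sum_half_powers_int: "(\<Sum>z\<in>{- int n..int n}. (1 / 2 :: real) ^ nat \<bar>z\<bar>) = 3 - 2 * (1 / 2) ^ n"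
proof (induction n)
  case (Suc n)
  have "{- int (Suc n)..int (Suc n)} = insert (int (Suc n)) (insert (- int (Suc n)) {- int n..int n})" by auto
  then have "(\<Sum>z\<in>{- int (Suc n)..int (Suc n)}. (1 / 2 :: real) ^ nat \<bar>z\<bar>)
     = (1 / 2) ^ Suc n + ((1 / 2) ^ Suc n + (\<Sum>z\<in>{- int n..int n}. (1 / 2) ^ nat \<bar>z\<bar>))"
    by (simp add: nat_add_distrib)
  then show ?case using Suc by simp
qed simp

text \<open>A generating-function bound: on \<open>Z\<close> the weight \<open>2 ^ (3 * k)\<close>
  times the product of the \<open>(1 / 2) ^ \<bar>z i\<bar>\<close> is at least 1, and summed over a
  box it factors into \<open>8 ^ k\<close> times \<open>k\<close> geometric sums, each at most
  4.\<close>

lemma card_lattice_points_le: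
  fixes k :: nat
  defines "Z \<equiv> {z \<in> {..<k} \<rightarrow>\<^sub>E (UNIV :: int set). (\<Sum>i<k. \<bar>z i\<bar>) \<le> 3 * int k}"
  shows "finite Z" "real (card Z) \<le> 32 ^ k"
proof -
  let ?P = "{..<k} \<rightarrow>\<^sub>E {- int (3 * k)..int (3 * k)}"
  have sub: "Z \<subseteq> ?P"
  proof
    fix z assume z: "z \<in> Z"
    have "\<bar>z i\<bar> \<le> int (3 * k)" if "i < k" for i
    proof -
      have "\<bar>z i\<bar> \<le> (\<Sum>i<k. \<bar>z i\<bar>)" using that by (intro member_le_sum) auto
      then show ?thesis using z unfolding Z_def by simp
    qed
    then show "z \<in> ?P" using z unfolding Z_def by (fastforce simp: PiE_iff)
  qed
  have finP: "finite ?P" by (intro finite_PiE) auto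
  show "finite Z" using sub finP by (rule finite_subset)
  have "real (card Z) = (\<Sum>z\<in>Z. 1)" by simp
  also have "\<dots> \<le> (\<Sum>z\<in>Z. 2 ^ (3 * k) * (\<Prod>i<k. (1 / 2 :: real) ^ nat \<bar>z i\<bar>))"
  proof (intro sum_mono)
    fix z assume "z \<in> Z"
    then have "int (\<Sum>i<k. nat \<bar>z i\<bar>) \<le> int (3 * k)" unfolding Z_def by simp
    then have "(\<Sum>i<k. nat \<bar>z i\<bar>) \<le> 3 * k" by linarith
    then have "(1 / 2 :: real) ^ (3 * k) \<le> (1 / 2) ^ (\<Sum>i<k. nat \<bar>z i\<bar>)" by (intro power_decreasing) auto
    then have "(2 :: real) ^ (3 * k) * (1 / 2) ^ (3 * k) \<le> 2 ^ (3 * k) * (\<Prod>i<k. (1 / 2) ^ nat \<bar>z i\<bar>)"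
      unfolding power_sum by (intro mult_left_mono) auto
    then show "1 \<le> 2 ^ (3 * k) * (\<Prod>i<k. (1 / 2 :: real) ^ nat \<bar>z i\<bar>)"
      by (simp add: power_mult_distrib[symmetric])
  qed
  also have "\<dots> \<le> (\<Sum>z\<in>?P. 2 ^ (3 * k) * (\<Prod>i<k. (1 / 2 :: real) ^ nat \<bar>z i\<bar>))"
    using sub finP by (intro sum_mono2) (auto intro!: mult_nonneg_nonneg prod_nonneg)
  also have "\<dots> = 2 ^ (3 * k) * (\<Prod>i<k. \<Sum>z\<in>{- int (3 * k)..int (3 * k)}. (1 / 2 :: real) ^ nat \<bar>z\<bar>)"
    unfolding sum_distrib_left[symmetric] by (subst prod_sum_PiE) auto
  also have "\<dots> \<le> 2 ^ (3 * k) * (\<Prod>i<k. 4)"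
    unfolding sum_half_powers_int
  proof (intro mult_left_mono prod_mono conjI)
    have "(1 / 2 :: real) ^ (3 * k) \<le> 1" "(0 :: real) \<le> (1 / 2) ^ (3 * k)" by (auto intro: power_le_one)
    then show "0 \<le> 3 - 2 * (1 / 2 :: real) ^ (3 * k)" "3 - 2 * (1 / 2 :: real) ^ (3 * k) \<le> 4" for i :: nat by linarith+
  qed auto
  also have "\<dots> = 32 ^ k" by (simp add: power_mult power_mult_distrib[symmetric])
  finally show "real (card Z) \<le> 32 ^ k" .
qed


text \<open>The distance of the lines spanned by \<open>x\<close> and \<open>y\<close> when these are unit vectors of \<open>\<real>\<^sup>k\<close>.\<close>
definition proj_dist :: "nat \<Rightarrow> (nat \<Rightarrow> real) \<Rightarrow> (nat \<Rightarrow> real) \<Rightarrow> real" where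
  "proj_dist k x y = min (L2_set (\<lambda>i. x i - y i) {..<k}) (L2_set (\<lambda>i. x i + y i) {..<k})"

lemma L2_set_uminus: "L2_set (\<lambda>i. - x i) A = L2_set x A"
  by (simp add: L2_set_def)

lemma L2_set_scale: "L2_set (\<lambda>i. c * x i) A = \<bar>c\<bar> * L2_set x A"
  by (simp add: L2_set_def power_mult_distrib sum_distrib_left[symmetric] real_sqrt_mult)

lemma L2_set_minus_commute: "L2_set (\<lambda>i. x i - y i) A = L2_set (\<lambda>i. y i - x i) A"
  using L2_set_uminus[of "\<lambda>i. x i - y i" A] by simp

lemma proj_dist_nonneg: "0 \<le> proj_dist k x y" by (simp add: proj_dist_def)

lemma proj_dist_refl: "proj_dist k x x = 0" by (simp add: proj_dist_def L2_set_0' min_def)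

lemma proj_dist_commute: "proj_dist k x y = proj_dist k y x"
  unfolding proj_dist_def L2_set_minus_commute[of x y] by (simp add: add.commute)

lemma proj_dist_attained:
  "\<exists>s\<in>{1, -1::real}. proj_dist k x y = L2_set (\<lambda>i. s * y i - x i) {..<k}"
proof (cases "L2_set (\<lambda>i. x i - y i) {..<k} \<le> L2_set (\<lambda>i. x i + y i) {..<k}")
  case True
  then show ?thesis using L2_set_minus_commute[of x y "{..<k}"] by (intro bexI[of _ 1]) (auto simp: proj_dist_def)
next
  case False
  moreover have "L2_set (\<lambda>i. - 1 * y i - x i) {..<k} = L2_set (\<lambda>i. x i + y i) {..<k}"
    unfolding L2_set_def by (simp add: power2_eq_square algebra_simps)
  ultimately show ?thesis by (intro bexI[of _ "-1"]) (auto simp: proj_dist_def)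
qed

lemma proj_dist_le_signed:
  assumes "s \<in> {1, -1::real}" "t \<in> {1, -1::real}"
  shows "proj_dist k x y \<le> L2_set (\<lambda>i. s * x i - t * y i) {..<k}"
proof -
  have neg: "L2_set (\<lambda>i. - x i - y i) {..<k} = L2_set (\<lambda>i. x i + y i) {..<k}"
    using L2_set_uminus[of "\<lambda>i. x i + y i" "{..<k}"] by simp
  have "L2_set (\<lambda>i. - x i + y i) {..<k} = L2_set (\<lambda>i. x i - y i) {..<k}"
    using L2_set_uminus[of "\<lambda>i. x i - y i" "{..<k}"] by (simp add: algebra_simps)
  then show ?thesis using assms neg unfolding proj_dist_def by auto
qed

lemma proj_dist_triangle: "proj_dist k x z \<le> proj_dist k x y + proj_dist k y z"
proof -
  obtain s where s: "s \<in> {1, -1}" "proj_dist k y x = L2_set (\<lambda>i. s * x i - y i) {..<k}"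
    using proj_dist_attained by blast
  obtain t where t: "t \<in> {1, -1}" "proj_dist k y z = L2_set (\<lambda>i. t * z i - y i) {..<k}"
    using proj_dist_attained by blast
  have "proj_dist k x z \<le> L2_set (\<lambda>i. s * x i - t * z i) {..<k}" using s t by (intro proj_dist_le_signed)
  also have "\<dots> = L2_set (\<lambda>i. (s * x i - y i) + (y i - t * z i)) {..<k}" by simp
  also have "\<dots> \<le> L2_set (\<lambda>i. s * x i - y i) {..<k} + L2_set (\<lambda>i. y i - t * z i) {..<k}"
    by (rule L2_set_triangle_ineq)
  finally show ?thesis using s(2) t(2) L2_set_minus_commute[of y "\<lambda>i. t * z i"] proj_dist_commute[of k x y] by simp
qed

lemma sum_abs_le_L2_set: "(\<Sum>i<k. \<bar>x i\<bar>) \<le> sqrt (real k) * L2_set x {..<k}"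
  using L2_set_mult_ineq[of "\<lambda>_. 1" x "{..<k}"] by (simp add: L2_set_constant)

text \<open>Two points of a ball of radius \<open>\<Delta>\<close> that round to the same lattice point are at distance at
  most \<open>\<Delta> / 2\<close>, and rounding hits at most \<open>32 ^ k\<close> lattice points.\<close>
lemma proj_dist_doubling:
  fixes e :: "'a \<Rightarrow> nat \<Rightarrow> real" and m :: "'a \<Rightarrow> real"
  assumes "finite R" and m: "\<And>u. 0 \<le> m u" and k: "1 \<le> k" and \<Delta>: "0 < \<Delta>"
    and half: "\<And>p. p \<in> R \<Longrightarrow> (\<Sum>u\<in>{u\<in>R. proj_dist k (e p) (e u) \<le> \<Delta> / 2}. m u) \<le> m0" and m0: "0 \<le> m0"
  shows "(\<Sum>u\<in>{u\<in>R. proj_dist k (e c) (e u) \<le> \<Delta>}. m u) \<le> 32 ^ k * m0"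
proof -
  define B where "B = {u\<in>R. proj_dist k (e c) (e u) \<le> \<Delta>}"
  have finB: "finite B" using assms(1) unfolding B_def by simp
  \<comment> \<open>At this scale a unit cube, of diameter \<open>sqrt k\<close>, corresponds to
    distance \<open>\<Delta> / 2\<close>, and a point of the ball has l1-norm at most
    \<open>2 * k\<close>; rounding adds at most \<open>k\<close>, hence the bound
    \<open>3 * k\<close>.\<close>
  define r where "r = 2 * sqrt (real k) / \<Delta>"
  have r: "r > 0" using k \<Delta> unfolding r_def by simp
  have "\<forall>u. \<exists>s\<in>{1, -1::real}. proj_dist k (e c) (e u) = L2_set (\<lambda>i. s * e u i - e c i) {..<k}"
    using proj_dist_attained by blast
  \<comment> \<open>The sign picks the representative of the line nearest to \<open>e c\<close>, so
    that Euclidean rounding applies.\<close>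
  then obtain s where s: "\<And>u. s u \<in> {1, -1::real}"
    "\<And>u. proj_dist k (e c) (e u) = L2_set (\<lambda>i. s u * e u i - e c i) {..<k}" by metis
  define y where "y u i = r * (s u * e u i - e c i)" for u i
  define cell where "cell u = restrict (\<lambda>i. \<lfloor>y u i\<rfloor>) {..<k}" for u
  define Z where "Z = {z \<in> {..<k} \<rightarrow>\<^sub>E (UNIV :: int set). (\<Sum>i<k. \<bar>z i\<bar>) \<le> 3 * int k}"
  have Z: "finite Z" "real (card Z) \<le> 32 ^ k" unfolding Z_def by (rule card_lattice_points_le)+
  have cellZ: "cell u \<in> Z" if "u \<in> B" for u
  proof -
    have "real_of_int (\<Sum>i<k. \<bar>cell u i\<bar>) = (\<Sum>i<k. \<bar>real_of_int \<lfloor>y u i\<rfloor>\<bar>)" by (simp add: cell_def)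
    also have "\<dots> \<le> (\<Sum>i<k. \<bar>y u i\<bar> + 1)" by (intro sum_mono) linarith
    also have "\<dots> = (\<Sum>i<k. \<bar>y u i\<bar>) + real k" by (simp add: sum.distrib)
    also have "(\<Sum>i<k. \<bar>y u i\<bar>) \<le> sqrt (real k) * L2_set (y u) {..<k}" by (rule sum_abs_le_L2_set)
    also have "L2_set (y u) {..<k} = r * proj_dist k (e c) (e u)"
      unfolding y_def s(2) L2_set_scale using r by simp
    also have "sqrt (real k) * (r * proj_dist k (e c) (e u)) \<le> sqrt (real k) * (r * \<Delta>)"
      using that r unfolding B_def by (intro mult_left_mono) auto
    also have "\<dots> = 2 * real k" unfolding r_def using \<Delta> by simp
    finally have "real_of_int (\<Sum>i<k. \<bar>cell u i\<bar>) \<le> real_of_int (3 * int k)" by simp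
    then have "(\<Sum>i<k. \<bar>cell u i\<bar>) \<le> 3 * int k" by (simp only: of_int_le_iff)
    then show ?thesis unfolding Z_def cell_def by auto
  qed
  have close: "proj_dist k (e p) (e u) \<le> \<Delta> / 2" if "cell p = cell u" for p u
  proof -
    have "\<bar>y p i - y u i\<bar> \<le> 1" if "i < k" for i
    proof -
      have "\<lfloor>y p i\<rfloor> = \<lfloor>y u i\<rfloor>" using fun_cong[OF \<open>cell p = cell u\<close>, of i] that by (simp add: cell_def)
      then show ?thesis by linarith
    qed
    then have "L2_set (\<lambda>i. \<bar>y p i - y u i\<bar>) {..<k} \<le> L2_set (\<lambda>i. 1) {..<k}" by (intro L2_set_mono) auto
    then have "L2_set (\<lambda>i. y p i - y u i) {..<k} \<le> sqrt (real k)" by (simp add: L2_set_constant L2_set_def)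
    moreover have "(\<lambda>i. y p i - y u i) = (\<lambda>i. r * (s p * e p i - s u * e u i))"
      unfolding y_def by (auto simp: algebra_simps)
    ultimately have "r * L2_set (\<lambda>i. s p * e p i - s u * e u i) {..<k} \<le> sqrt (real k)"
      using r by (simp add: L2_set_scale)
    also have "sqrt (real k) = r * (\<Delta> / 2)" unfolding r_def using \<Delta> by simp
    finally have "L2_set (\<lambda>i. s p * e p i - s u * e u i) {..<k} \<le> \<Delta> / 2" using r by simp
    then show ?thesis using proj_dist_le_signed[OF s(1) s(1)] order_trans by blast
  qed
  have "(\<Sum>u\<in>B. m u) = (\<Sum>z\<in>cell ` B. \<Sum>u\<in>{u\<in>B. cell u = z}. m u)"
    using finB by (rule sum.image_gen)
  also have "\<dots> \<le> (\<Sum>z\<in>cell ` B. m0)"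
  proof (intro sum_mono)
    fix z assume "z \<in> cell ` B"
    then obtain p where p: "p \<in> B" "z = cell p" by blast
    have "(\<Sum>u\<in>{u\<in>B. cell u = z}. m u) \<le> (\<Sum>u\<in>{u\<in>R. proj_dist k (e p) (e u) \<le> \<Delta> / 2}. m u)"
      using assms(1) m p close unfolding B_def by (intro sum_mono2) auto
    also have "\<dots> \<le> m0" using p unfolding B_def by (intro half) auto
    finally show "(\<Sum>u\<in>{u\<in>B. cell u = z}. m u) \<le> m0" .
  qed
  also have "\<dots> = real (card (cell ` B)) * m0" by simp
  also have "\<dots> \<le> 32 ^ k * m0"
  proof (intro mult_right_mono m0)
    have "card (cell ` B) \<le> card Z" using Z(1) cellZ by (intro card_mono) auto
    then show "real (card (cell ` B)) \<le> 32 ^ k" using Z(2) by linarith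
  qed
  finally show ?thesis unfolding B_def .
qed

text \<open>By Bernoulli, \<open>8 * k\<close> steps at rate \<open>1 / (8 * k)\<close> at least
  double; \<open>5 * k\<close> doublings make \<open>32 ^ k\<close>.\<close>

lemma growth_rate:
  assumes "1 \<le> k"
  shows "(32::real) ^ k \<le> (1 + 1 / (8 * real k)) ^ (40 * k\<^sup>2)"
proof -
  have "(2::real) \<le> 1 + real (8 * k) * (1 / (8 * real k))" using assms by simp
  also have "\<dots> \<le> (1 + 1 / (8 * real k)) ^ (8 * k)" by (rule Bernoulli_inequality) (simp add: order_trans[of _ 0])
  finally have "(2::real) ^ (5 * k) \<le> ((1 + 1 / (8 * real k)) ^ (8 * k)) ^ (5 * k)" by (intro power_mono) auto
  moreover have "(2::real) ^ (5 * k) = 32 ^ k" by (simp add: power_mult)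
  moreover have "8 * k * (5 * k) = 40 * k\<^sup>2" by (simp add: power2_eq_square)
  ultimately show ?thesis by (simp only: power_mult[symmetric])
qed

section \<open>Localization of the eigenfunctions\<close>

lemma L2_set_power2: "(L2_set x {..<k})\<^sup>2 = (\<Sum>i<k. (x i)\<^sup>2)"
  unfolding L2_set_def by (simp add: sum_nonneg)

text \<open>Links the projective distance to the edge terms of the dual energy. Normalizing distorts
  \<open>x + y\<close> only by the difference of the two lengths, which is itself at most the length
  of \<open>x + y\<close>; hence the factor 2.\<close>

lemma proj_dist_normalized_le:
  fixes x y :: "nat \<Rightarrow> real" and k :: nat
  defines "nx \<equiv> L2_set x {..<k}" and "ny \<equiv> L2_set y {..<k}"
  assumes "nx \<noteq> 0" "ny \<noteq> 0"
  shows "proj_dist k (\<lambda>i. x i / nx) (\<lambda>i. y i / ny) * ny \<le> 2 * L2_set (\<lambda>i. x i + y i) {..<k}"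
proof -
  let ?s = "L2_set (\<lambda>i. x i + y i) {..<k}"
  have pos: "nx > 0" "ny > 0" using assms unfolding nx_def ny_def by (simp_all add: less_le)
  have "proj_dist k (\<lambda>i. x i / nx) (\<lambda>i. y i / ny) * ny \<le> L2_set (\<lambda>i. x i / nx + y i / ny) {..<k} * ny"
    using pos unfolding proj_dist_def by (intro mult_right_mono) auto
  also have "\<dots> = L2_set (\<lambda>i. ny * (x i / nx + y i / ny)) {..<k}"
    unfolding L2_set_scale using pos by simp
  also have "(\<lambda>i. ny * (x i / nx + y i / ny)) = (\<lambda>i. (x i + y i) + (ny - nx) / nx * x i)"
    using pos by (auto simp: field_simps)
  also have "L2_set \<dots> {..<k} \<le> ?s + L2_set (\<lambda>i. (ny - nx) / nx * x i) {..<k}"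
    by (rule L2_set_triangle_ineq)
  also have "L2_set (\<lambda>i. (ny - nx) / nx * x i) {..<k} = \<bar>ny - nx\<bar>"
    unfolding L2_set_scale nx_def[symmetric] using pos by simp
  also have "\<bar>ny - nx\<bar> \<le> ?s"
  proof -
    have "ny \<le> ?s + nx" using L2_set_triangle_ineq[of "\<lambda>i. x i + y i" "\<lambda>i. - x i" "{..<k}"]
      unfolding L2_set_uminus nx_def ny_def by simp
    moreover have "nx \<le> ?s + ny" using L2_set_triangle_ineq[of "\<lambda>i. x i + y i" "\<lambda>i. - y i" "{..<k}"]
      unfolding L2_set_uminus nx_def ny_def by simp
    ultimately show ?thesis by linarith
  qed
  finally show ?thesis by simp
qed

text \<open>If the inequality failed wherever \<open>b j\<close> is positive, summation would
  contradict the totals. Strict positivity of \<open>b j\<close> is part of the claim because a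
  Rayleigh quotient of the zero function would be useless.\<close>

lemma exists_good_coordinate:
  fixes a b :: "nat \<Rightarrow> real"
  assumes "\<And>j. j < k \<Longrightarrow> 0 \<le> a j" "\<And>j. j < k \<Longrightarrow> 0 \<le> b j" "(\<Sum>j<k. a j) \<le> c * (\<Sum>j<k. b j)" "0 < (\<Sum>j<k. b j)"
  shows "\<exists>j<k. 0 < b j \<and> a j \<le> c * b j"
proof (rule ccontr)
  assume no: "\<not> ?thesis"
  have le: "c * b j \<le> a j" if "j < k" for j
    using no assms(1,2)[OF that] that by (cases "b j = 0") (auto simp: less_le)
  have "\<exists>j\<in>{..<k}. 0 < b j"
  proof (rule ccontr)
    assume "\<not> ?thesis"
    then have "(\<Sum>j<k. b j) \<le> 0" by (intro sum_nonpos) (auto simp: not_less)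
    then show False using assms(4) by simp
  qed
  then obtain j where j: "j < k" "0 < b j" by auto
  then have "c * b j < a j" using no by auto
  then have "(\<Sum>j<k. c * b j) < (\<Sum>j<k. a j)" using j le by (intro sum_strict_mono_ex1) auto
  then show False using assms(3) by (simp add: sum_distrib_left)
qed

locale spectral_embedding =
  fixes N :: nat and w :: "nat \<Rightarrow> nat \<Rightarrow> real" and k :: nat and f :: "nat \<Rightarrow> nat \<Rightarrow> real"
  assumes G: "wgraph N w" and k: "1 \<le> k"
    and orthonormal: "\<And>i j. i < k \<Longrightarrow> j < k \<Longrightarrow> (\<Sum>u<N. deg N w u * f i u * f j u) = (if i = j then 1 else 0)"
begin

definition len :: "nat \<Rightarrow> real" where "len u = L2_set (\<lambda>i. f i u) {..<k}"
text \<open>Where the embedding vanishes, division by zero makes this \<open>0\<close>, which is not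
  a unit vector; clusters are therefore taken inside \<open>supp\<close>.\<close>

definition dir :: "nat \<Rightarrow> nat \<Rightarrow> real" where "dir u i = f i u / len u"
text \<open>Set to \<open>0\<close> off the vertex set, where \<open>deg\<close> may be negative:
  region growing asks for a mass that is nonnegative everywhere.\<close>

definition mass :: "nat \<Rightarrow> real" where "mass u = (if u < N then deg N w u * (len u)\<^sup>2 else 0)"
definition supp :: "nat set" where "supp = {u\<in>{..<N}. len u \<noteq> 0}"
definition line_dist :: "nat \<Rightarrow> nat \<Rightarrow> real" where "line_dist u v = proj_dist k (dir u) (dir v)"

lemma mass_nonneg: "0 \<le> mass u"
  using deg_pos[OF G, of u] by (auto simp: mass_def zero_le_mult_iff less_imp_le)

lemma total_mass: "(\<Sum>u\<in>supp. mass u) = real k"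
proof -
  have "(\<Sum>u\<in>supp. mass u) = (\<Sum>u<N. deg N w u * (\<Sum>i<k. (f i u)\<^sup>2))"
    unfolding supp_def by (intro sum.mono_neutral_cong_left) (auto simp: mass_def len_def L2_set_power2[symmetric])
  also have "\<dots> = (\<Sum>u<N. \<Sum>i<k. deg N w u * f i u * f i u)"
    by (simp add: sum_distrib_left power2_eq_square mult.assoc)
  also have "\<dots> = (\<Sum>i<k. \<Sum>u<N. deg N w u * f i u * f i u)" by (rule sum.swap)
  also have "\<dots> = (\<Sum>i<k. 1)" using orthonormal by (intro sum.cong) auto
  finally show ?thesis by simp
qed

text \<open>Orthonormality of the coordinates says that the second-moment matrix of the embedding is
  the identity.\<close>

lemma isotropic: "(\<Sum>u<N. deg N w u * (\<Sum>i<k. x i * f i u)\<^sup>2) = (\<Sum>i<k. (x i)\<^sup>2)"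
proof -
  have "(\<Sum>u<N. deg N w u * (\<Sum>i<k. x i * f i u)\<^sup>2)
      = (\<Sum>u<N. \<Sum>i<k. \<Sum>j<k. x i * x j * (deg N w u * f i u * f j u))"
    by (intro sum.cong refl) (simp add: power2_eq_square sum_product sum_distrib_left mult_ac)
  also have "\<dots> = (\<Sum>i<k. \<Sum>u<N. \<Sum>j<k. x i * x j * (deg N w u * f i u * f j u))" by (rule sum.swap)
  also have "\<dots> = (\<Sum>i<k. \<Sum>j<k. \<Sum>u<N. x i * x j * (deg N w u * f i u * f j u))"
    by (intro sum.cong[OF refl] sum.swap)
  also have "\<dots> = (\<Sum>i<k. \<Sum>j<k. if j = i then (x i)\<^sup>2 else 0)"
    unfolding sum_distrib_left[symmetric]
    by (intro sum.cong refl) (auto simp: orthonormal power2_eq_square)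
  finally show ?thesis by simp
qed

lemma dir_unit: "u \<in> supp \<Longrightarrow> (\<Sum>i<k. (dir u i)\<^sup>2) = 1"
  unfolding dir_def power_divide sum_divide_distrib[symmetric] supp_def
  by (simp add: L2_set_power2[symmetric] len_def)

text \<open>Spreading: isotropy in the direction of the centre leaves little room for mass near it.\<close>
lemma cluster_mass_le:
  assumes "S \<subseteq> supp" "c \<in> supp" "\<And>u. u \<in> S \<Longrightarrow> line_dist c u \<le> \<Delta>" "0 \<le> \<Delta>" "\<Delta> \<le> 1"
  shows "(1 - \<Delta>\<^sup>2) * (\<Sum>u\<in>S. mass u) \<le> 1"
proof -
  have "(1 - \<Delta>\<^sup>2) * mass u \<le> deg N w u * (\<Sum>i<k. dir c i * f i u)\<^sup>2" if u: "u \<in> S" for u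
  proof -
    have uV: "u \<in> supp" "u < N" using u assms(1) unfolding supp_def by auto
    define p where "p = (\<Sum>i<k. dir c i * dir u i)"
    obtain s where s: "s \<in> {1, -1}" "line_dist c u = L2_set (\<lambda>i. s * dir u i - dir c i) {..<k}"
      unfolding line_dist_def using proj_dist_attained by blast
    have "(line_dist c u)\<^sup>2 = (\<Sum>i<k. s\<^sup>2 * (dir u i)\<^sup>2 + (dir c i)\<^sup>2 - 2 * s * (dir c i * dir u i))"
      unfolding s(2) L2_set_power2 by (intro sum.cong refl) (simp add: power2_eq_square algebra_simps)
    also have "\<dots> = s\<^sup>2 + 1 - 2 * s * p"
      unfolding p_def sum_subtractf sum.distrib sum_distrib_left[symmetric] dir_unit[OF uV(1)] dir_unit[OF assms(2)] by simp
    also have "\<dots> = 2 - 2 * (s * p)" using s(1) by auto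
    finally have d2: "(line_dist c u)\<^sup>2 = 2 - 2 * (s * p)" .
    have "(line_dist c u)\<^sup>2 \<le> \<Delta>\<^sup>2" using assms(3)[OF u] proj_dist_nonneg unfolding line_dist_def by (intro power_mono)
    \<comment> \<open>The signed cosine between the two lines is at least
      \<open>1 - \<Delta>\<^sup>2 / 2\<close>; its square is then at least
      \<open>1 - \<Delta>\<^sup>2\<close>.\<close>
    then have sp: "1 - \<Delta>\<^sup>2 / 2 \<le> s * p" using d2 by simp
    have "\<Delta>\<^sup>2 \<le> 1" using assms(4,5) by (simp add: power_le_one)
    then have "(1 - \<Delta>\<^sup>2 / 2)\<^sup>2 \<le> (s * p)\<^sup>2" using sp by (intro power_mono) auto
    also have "(s * p)\<^sup>2 = p\<^sup>2" using s(1) by auto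
    finally have "(1 - \<Delta>\<^sup>2 / 2)\<^sup>2 \<le> p\<^sup>2" .
    moreover have "(1 - \<Delta>\<^sup>2 / 2)\<^sup>2 = 1 - \<Delta>\<^sup>2 + (\<Delta>\<^sup>2 / 2)\<^sup>2" by (simp add: power2_diff)
    ultimately have "1 - \<Delta>\<^sup>2 \<le> p\<^sup>2" using zero_le_power2[of "\<Delta>\<^sup>2 / 2"] by linarith
    then have "(1 - \<Delta>\<^sup>2) * mass u \<le> p\<^sup>2 * mass u" by (intro mult_right_mono mass_nonneg)
    also have "\<dots> = deg N w u * (p * len u)\<^sup>2" using uV by (simp add: mass_def power_mult_distrib)
    also have "p * len u = (\<Sum>i<k. dir c i * f i u)"
      using uV unfolding p_def sum_distrib_right dir_def[of u] supp_def by (intro sum.cong refl) auto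
    finally show ?thesis .
  qed
  then have "(1 - \<Delta>\<^sup>2) * (\<Sum>u\<in>S. mass u) \<le> (\<Sum>u\<in>S. deg N w u * (\<Sum>i<k. dir c i * f i u)\<^sup>2)"
    unfolding sum_distrib_left by (rule sum_mono)
  also have "\<dots> \<le> (\<Sum>u<N. deg N w u * (\<Sum>i<k. dir c i * f i u)\<^sup>2)"
    using assms(1) deg_pos[OF G] unfolding supp_def by (intro sum_mono2) (auto simp: less_imp_le)
  also have "\<dots> = 1" unfolding isotropic by (rule dir_unit[OF assms(2)])
  finally show ?thesis .
qed

text \<open>This is \<open>\<Delta> / (2 * J)\<close> for the radius
  \<open>\<Delta> = 1 / (4 * sqrt k)\<close> and the number \<open>J = 40 * k\<^sup>2\<close> of
  layers.\<close>

definition sep :: real where "sep = 1 / (320 * (real k)\<^sup>2 * sqrt (real k))"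

lemma sep_pos: "0 < sep" using k unfolding sep_def by simp

text \<open>With \<open>\<Delta>\<^sup>2 = 1 / (16 * k)\<close> spreading limits a cluster to mass
  \<open>1 + \<epsilon>\<close>, where \<open>\<epsilon> = 1 / (8 * k)\<close>. Region growing keeps
  at least \<open>k / (1 + \<epsilon>)\<close> of the mass, which is still above the
  \<open>(k - 1) * (1 + \<epsilon>) + 1 / 2\<close> that greedy grouping demands.\<close>

lemma separated_clusters:
  "\<exists>S. (\<forall>i<k. S i \<subseteq> supp \<and> 1 / 2 \<le> (\<Sum>u\<in>S i. mass u)) \<and>
    (\<forall>i<k. \<forall>j<k. i \<noteq> j \<longrightarrow> (\<forall>u\<in>S i. \<forall>v\<in>S j. sep < line_dist u v))"
proof -
  define \<Delta> where "\<Delta> = 1 / (4 * sqrt (real k))"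
  define \<epsilon> where "\<epsilon> = 1 / (8 * real k)"
  define J where "J = 40 * k\<^sup>2"
  have k': "real k \<ge> 1" using k by simp
  have fin: "finite supp" unfolding supp_def by simp
  have "1 \<le> 4 * sqrt (real k)" using real_sqrt_ge_one[OF k'] by linarith
  moreover have "1 / x \<le> 1" if "1 \<le> x" for x :: real using that by simp
  ultimately have "\<Delta> \<le> 1" unfolding \<Delta>_def by blast
  then have \<Delta>: "0 < \<Delta>" "\<Delta> \<le> 1" "\<Delta>\<^sup>2 = 1 / (16 * real k)"
    using k' unfolding \<Delta>_def by (auto simp: power_divide power_mult_distrib)
  have sep_eq: "\<Delta> / (2 * real J) = sep" unfolding \<Delta>_def J_def sep_def by simp
  have comm: "line_dist u v = line_dist v u" for u v unfolding line_dist_def by (rule proj_dist_commute)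
  have "\<exists>\<S>. finite \<S> \<and> (\<forall>S\<in>\<S>. S \<subseteq> supp \<and> (\<exists>c\<in>supp. \<forall>u\<in>S. line_dist c u \<le> \<Delta>)) \<and>
     (\<forall>S\<in>\<S>. \<forall>T\<in>\<S>. S \<noteq> T \<longrightarrow> (\<forall>u\<in>S. \<forall>v\<in>T. \<Delta> / (2 * real J) < line_dist u v \<or> \<Delta> / (2 * real J) < line_dist v u)) \<and>
     (\<Sum>u\<in>supp. mass u) \<le> (1 + \<epsilon>) * (\<Sum>S\<in>\<S>. \<Sum>u\<in>S. mass u)"
  proof (rule ball_carving[where V = supp])
    show "line_dist u u = 0" for u unfolding line_dist_def by (rule proj_dist_refl)
    show "line_dist c v \<le> line_dist c u + line_dist u v" for c u v unfolding line_dist_def by (rule proj_dist_triangle)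
    show "0 < J" "0 \<le> \<epsilon>" unfolding J_def \<epsilon>_def using k by auto
    fix R c m0 assume R: "R \<subseteq> supp" and half: "\<And>p. p \<in> R \<Longrightarrow> (\<Sum>u\<in>{u\<in>R. line_dist p u \<le> \<Delta> / 2}. mass u) \<le> m0" and m0: "0 \<le> (m0 :: real)"
    have "(\<Sum>u\<in>{u\<in>R. line_dist c u \<le> \<Delta>}. mass u) \<le> 32 ^ k * m0"
      unfolding line_dist_def
      using R fin mass_nonneg k \<Delta>(1) half[unfolded line_dist_def] m0
      by (intro proj_dist_doubling) (auto intro: finite_subset)
    also have "\<dots> \<le> (1 + \<epsilon>) ^ J * m0" unfolding \<epsilon>_def J_def using growth_rate[OF k] m0 by (intro mult_right_mono)
    finally show "(\<Sum>u\<in>{u\<in>R. line_dist c u \<le> \<Delta>}. mass u) \<le> (1 + \<epsilon>) ^ J * m0" .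
  qed (use mass_nonneg \<Delta>(1) fin in auto)
  then obtain \<S> where \<S>: "finite \<S>" "\<forall>S\<in>\<S>. S \<subseteq> supp \<and> (\<exists>c\<in>supp. \<forall>u\<in>S. line_dist c u \<le> \<Delta>)"
    "\<forall>S\<in>\<S>. \<forall>T\<in>\<S>. S \<noteq> T \<longrightarrow> (\<forall>u\<in>S. \<forall>v\<in>T. \<Delta> / (2 * real J) < line_dist u v \<or> \<Delta> / (2 * real J) < line_dist v u)"
    "(\<Sum>u\<in>supp. mass u) \<le> (1 + \<epsilon>) * (\<Sum>S\<in>\<S>. \<Sum>u\<in>S. mass u)"
    by (elim exE conjE)
  have far: "sep < line_dist u v" if "S \<in> \<S>" "T \<in> \<S>" "S \<noteq> T" "u \<in> S" "v \<in> T" for S T u v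
  proof -
    have "sep < line_dist u v \<or> sep < line_dist v u" using \<S>(3)[unfolded sep_eq] that by blast
    then show ?thesis using comm[of u v] by simp
  qed
  have each: "0 \<le> (\<Sum>u\<in>S. mass u) \<and> (\<Sum>u\<in>S. mass u) \<le> 1 + \<epsilon>" if SS: "S \<in> \<S>" for S
  proof
    show "0 \<le> (\<Sum>u\<in>S. mass u)" by (intro sum_nonneg mass_nonneg)
    obtain c where c: "c \<in> supp" "\<forall>u\<in>S. line_dist c u \<le> \<Delta>" "S \<subseteq> supp" using bspec[OF \<S>(2) SS] by auto
    have "(1 - \<Delta>\<^sup>2) * (\<Sum>u\<in>S. mass u) \<le> 1" using c \<Delta>(1,2) by (intro cluster_mass_le[of S c]) auto
    also have "1 \<le> (1 - \<Delta>\<^sup>2) * (1 + \<epsilon>)"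
      unfolding \<Delta>(3) \<epsilon>_def using k' by (simp add: field_simps)
    finally show "(\<Sum>u\<in>S. mass u) \<le> 1 + \<epsilon>" using k' unfolding \<Delta>(3)
      by (subst (asm) mult_le_cancel_left_pos) (auto simp: field_simps)
  qed
  have total: "(real k - 1) * (1 + \<epsilon>) + 1 / 2 \<le> (\<Sum>S\<in>\<S>. \<Sum>u\<in>S. mass u)"
  proof -
    have "(1 + \<epsilon>) * ((real k - 1) * (1 + \<epsilon>) + 1 / 2) \<le> real k"
      unfolding \<epsilon>_def using k' by (simp add: field_simps)
    also have "\<dots> \<le> (1 + \<epsilon>) * (\<Sum>S\<in>\<S>. \<Sum>u\<in>S. mass u)" using \<S>(4) unfolding total_mass .
    finally show ?thesis using k' unfolding \<epsilon>_def by (subst (asm) mult_le_cancel_left_pos) (auto simp: field_simps)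
  qed
  have "1 \<le> 1 + \<epsilon>" unfolding \<epsilon>_def by simp
  from greedy_grouping[OF \<S>(1) each this total] obtain H where
    H: "\<forall>i<k. H i \<subseteq> \<S> \<and> 1 / 2 \<le> (\<Sum>S\<in>H i. \<Sum>u\<in>S. mass u)" "\<forall>i<k. \<forall>j<k. i \<noteq> j \<longrightarrow> H i \<inter> H j = {}"
    by blast
  define S where "S i = \<Union> (H i)" for i
  have "S i \<subseteq> supp \<and> 1 / 2 \<le> (\<Sum>u\<in>S i. mass u)" if "i < k" for i
  proof
    have Hi: "H i \<subseteq> \<S>" "finite (H i)" using H(1) that \<S>(1) by (auto intro: finite_subset)
    show "S i \<subseteq> supp" unfolding S_def using Hi \<S>(2) by blast
    \<comment> \<open>A common point of two clusters would be at distance more than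
      \<open>sep\<close> from itself.\<close>
    have "A \<inter> B = {}" if "A \<in> H i" "B \<in> H i" "A \<noteq> B" for A B
    proof (rule ccontr)
      assume "A \<inter> B \<noteq> {}"
      then obtain u where "u \<in> A" "u \<in> B" by blast
      then have "sep < line_dist u u" using far[of A B u u] that Hi by blast
      then show False using sep_pos by (simp add: line_dist_def proj_dist_refl)
    qed
    moreover have "finite A" if "A \<in> H i" for A
      using bspec[OF \<S>(2), of A] that Hi(1) fin finite_subset[of A supp] by auto
    ultimately have "(\<Sum>u\<in>S i. mass u) = (\<Sum>A\<in>H i. \<Sum>u\<in>A. mass u)"
      unfolding S_def by (subst sum.Union_disjoint) auto
    then show "1 / 2 \<le> (\<Sum>u\<in>S i. mass u)" using H(1) that by simp
  qed
  moreover have "sep < line_dist u v" if ij: "i < k" "j < k" "i \<noteq> j" and uv: "u \<in> S i" "v \<in> S j" for i j u v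
  proof -
    obtain A B where AB: "A \<in> H i" "u \<in> A" "B \<in> H j" "v \<in> B" using uv unfolding S_def by blast
    then have "A \<noteq> B" "A \<in> \<S>" "B \<in> \<S>" using H ij by blast+
    then show ?thesis using far AB by blast
  qed
  ultimately show ?thesis by blast
qed

section \<open>Cutting the embedding off around a cluster\<close>

definition set_dist :: "nat set \<Rightarrow> nat \<Rightarrow> real" where
  "set_dist S u = Min (line_dist u ` S)"

text \<open>The slope \<open>2 / sep\<close> makes it vanish from distance \<open>sep / 2\<close>
  on, so cutoffs around two \<open>sep\<close>-separated clusters have disjoint supports.\<close>

definition cutoff :: "nat set \<Rightarrow> nat \<Rightarrow> real" where
  "cutoff S u = max 0 (1 - 2 / sep * set_dist S u)"

context
  fixes S :: "nat set"
  assumes S: "S \<subseteq> supp" "S \<noteq> {}"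
begin

lemma finite_cluster: "finite S"
  using S(1) by (rule finite_subset) (simp add: supp_def)

lemma set_dist_attained: "\<exists>s\<in>S. set_dist S u = line_dist u s"
proof -
  have "Min (line_dist u ` S) \<in> line_dist u ` S" using finite_cluster S(2) by (intro Min_in) auto
  then show ?thesis unfolding set_dist_def by auto
qed

lemma set_dist_le: "s \<in> S \<Longrightarrow> set_dist S u \<le> line_dist u s"
  unfolding set_dist_def using finite_cluster by (intro Min_le) auto

lemma set_dist_nonneg: "0 \<le> set_dist S u"
  using set_dist_attained[of u] proj_dist_nonneg unfolding line_dist_def by auto

lemma set_dist_triangle: "set_dist S u \<le> line_dist u v + set_dist S v"
proof -
  obtain s where s: "s \<in> S" "set_dist S v = line_dist v s" using set_dist_attained by blast
  have "set_dist S u \<le> line_dist u s" using s by (intro set_dist_le)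
  also have "\<dots> \<le> line_dist u v + line_dist v s" unfolding line_dist_def by (rule proj_dist_triangle)
  finally show ?thesis using s by simp
qed

lemma cutoff_range: "0 \<le> cutoff S u" "cutoff S u \<le> 1"
  using set_dist_nonneg[of u] sep_pos by (auto simp: cutoff_def)

lemma cutoff_on: "u \<in> S \<Longrightarrow> cutoff S u = 1"
proof -
  assume "u \<in> S"
  then have "set_dist S u \<le> 0" using set_dist_le[of u u] by (simp add: line_dist_def proj_dist_refl)
  then show ?thesis using set_dist_nonneg[of u] by (simp add: cutoff_def)
qed

lemma cutoff_lipschitz: "\<bar>cutoff S u - cutoff S v\<bar> \<le> 2 / sep * line_dist u v"
proof -
  have "\<bar>set_dist S u - set_dist S v\<bar> \<le> line_dist u v"
    using set_dist_triangle[of u v] set_dist_triangle[of v u] proj_dist_commute[of k "dir u" "dir v"]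
    unfolding line_dist_def by linarith
  then have "2 / sep * \<bar>set_dist S u - set_dist S v\<bar> \<le> 2 / sep * line_dist u v"
    using sep_pos by (intro mult_left_mono) auto
  moreover have "\<bar>2 / sep * set_dist S u - 2 / sep * set_dist S v\<bar> = 2 / sep * \<bar>set_dist S u - set_dist S v\<bar>"
    unfolding right_diff_distrib[symmetric] abs_mult using sep_pos by simp
  ultimately show ?thesis unfolding cutoff_def by linarith
qed

lemma cutoff_support: "cutoff S u \<noteq> 0 \<Longrightarrow> \<exists>s\<in>S. line_dist u s < sep / 2"
proof -
  assume nz: "cutoff S u \<noteq> 0"
  have "2 / sep * set_dist S u < 1"
  proof (rule ccontr)
    assume "\<not> ?thesis"
    then have "cutoff S u = 0" unfolding cutoff_def by linarith
    then show False using nz by simp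
  qed
  then have "set_dist S u < sep / 2" using sep_pos by (simp add: field_simps)
  then show ?thesis using set_dist_attained[of u] by auto
qed

text \<open>A discrete product rule. The gradient of the cutoff contributes \<open>2 / sep\<close>
  times line distance times length, and \<open>proj_dist_normalized_le\<close> bounds the last two
  by twice the edge term of the embedding.\<close>

lemma cutoff_edge:
  "L2_set (\<lambda>i. cutoff S u * f i u + cutoff S v * f i v) {..<k}
    \<le> (1 + 4 / sep) * L2_set (\<lambda>i. f i u + f i v) {..<k}"
proof -
  let ?s = "L2_set (\<lambda>i. f i u + f i v) {..<k}"
  have s_le: "?s \<le> (1 + 4 / sep) * ?s" using sep_pos by (simp add: algebra_simps)
  have scale: "L2_set (\<lambda>i. cutoff S a * x i) {..<k} \<le> L2_set x {..<k}" for a x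
    unfolding L2_set_scale using cutoff_range[of a] by (simp add: mult_left_le_one_le)
  have zero: "f i a = 0" if "len a = 0" "i < k" for a i
    using that unfolding len_def by (subst (asm) L2_set_eq_0_iff) auto
  show ?thesis
  \<comment> \<open>At an endpoint with zero embedding the line is undefined, but then only one
    summand survives and the cutoff merely shrinks it.\<close>
  proof (cases "len u = 0 \<or> len v = 0")
    case True
    then have "L2_set (\<lambda>i. cutoff S u * f i u + cutoff S v * f i v) {..<k} \<le> ?s"
    proof
      assume "len u = 0"
      then have "L2_set (\<lambda>i. cutoff S u * f i u + cutoff S v * f i v) {..<k} = L2_set (\<lambda>i. cutoff S v * f i v) {..<k}"
        "?s = L2_set (\<lambda>i. f i v) {..<k}"
        using zero by (auto intro!: L2_set_cong)
      then show ?thesis using scale by simp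
    next
      assume "len v = 0"
      then have "L2_set (\<lambda>i. cutoff S u * f i u + cutoff S v * f i v) {..<k} = L2_set (\<lambda>i. cutoff S u * f i u) {..<k}"
        "?s = L2_set (\<lambda>i. f i u) {..<k}"
        using zero by (auto intro!: L2_set_cong)
      then show ?thesis using scale by simp
    qed
    then show ?thesis using s_le by linarith
  next
    case False
    have "(\<lambda>i. cutoff S u * f i u + cutoff S v * f i v)
        = (\<lambda>i. cutoff S u * (f i u + f i v) + (cutoff S v - cutoff S u) * f i v)"
      by (auto simp: algebra_simps)
    then have "L2_set (\<lambda>i. cutoff S u * f i u + cutoff S v * f i v) {..<k}
        \<le> L2_set (\<lambda>i. cutoff S u * (f i u + f i v)) {..<k} + L2_set (\<lambda>i. (cutoff S v - cutoff S u) * f i v) {..<k}"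
      by (simp only: L2_set_triangle_ineq)
    also have "\<dots> \<le> ?s + 2 / sep * (line_dist u v * len v)"
    proof (intro add_mono scale)
      have "\<bar>cutoff S v - cutoff S u\<bar> * len v \<le> 2 / sep * line_dist u v * len v"
        using cutoff_lipschitz[of u v] by (intro mult_right_mono) (auto simp: abs_minus_commute len_def)
      then show "L2_set (\<lambda>i. (cutoff S v - cutoff S u) * f i v) {..<k} \<le> 2 / sep * (line_dist u v * len v)"
        unfolding L2_set_scale len_def[symmetric] by (simp add: mult.assoc)
    qed
    also have "\<dots> \<le> ?s + 2 / sep * (2 * ?s)"
    proof (intro add_left_mono mult_left_mono)
      show "line_dist u v * len v \<le> 2 * ?s" unfolding line_dist_def dir_def len_def
        using False by (intro proj_dist_normalized_le) (auto simp: len_def)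
    qed (use sep_pos in simp)
    finally show ?thesis by (simp add: algebra_simps)
  qed
qed

text \<open>Summed over coordinates, the norm is at least the mass \<open>1 / 2\<close> of the
  cluster, where the cutoff equals 1. The energy is at most
  \<open>25 / sep\<^sup>2 = 2560000 * k ^ 5\<close> times \<open>2 * k * \<mu>\<close>. Relative to
  \<open>1 / 2\<close> this is the stated constant, and some coordinate does no worse than the
  totals.\<close>

lemma cutoff_function:
  assumes mass: "1 / 2 \<le> (\<Sum>u\<in>S. mass u)" and en: "\<And>j. j < k \<Longrightarrow> dual_energy N w (f j) \<le> 2 * \<mu>"
    and \<mu>: "0 \<le> \<mu>"
  shows "\<exists>j<k. 0 < sqnorm N w (\<lambda>u. cutoff S u * f j u) \<and>
    dual_energy N w (\<lambda>u. cutoff S u * f j u) \<le> 10240000 * real k ^ 6 * \<mu> * sqnorm N w (\<lambda>u. cutoff S u * f j u)"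
proof -
  define g where "g j u = cutoff S u * f j u" for j u
  have k': "real k \<ge> 1" using k by simp
  have energy: "(\<Sum>j<k. dual_energy N w (h j)) = (\<Sum>u<N. \<Sum>v<N. w u v * (L2_set (\<lambda>j. h j u + h j v) {..<k})\<^sup>2)" for h
  proof -
    have "(\<Sum>j<k. dual_energy N w (h j)) = (\<Sum>u<N. \<Sum>j<k. \<Sum>v<N. w u v * (h j u + h j v)\<^sup>2)"
      unfolding dual_energy_def by (rule sum.swap)
    also have "\<dots> = (\<Sum>u<N. \<Sum>v<N. \<Sum>j<k. w u v * (h j u + h j v)\<^sup>2)"
      by (intro sum.cong[OF refl] sum.swap)
    finally show ?thesis by (simp add: L2_set_power2 sum_distrib_left)
  qed
  have norm: "1 / 2 \<le> (\<Sum>j<k. sqnorm N w (g j))"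
  proof -
    have "(\<Sum>u\<in>S. mass u) = (\<Sum>u\<in>S. deg N w u * (cutoff S u)\<^sup>2 * (len u)\<^sup>2)"
      using S(1) by (intro sum.cong refl) (auto simp: mass_def cutoff_on supp_def)
    also have "\<dots> \<le> (\<Sum>u<N. deg N w u * (cutoff S u)\<^sup>2 * (len u)\<^sup>2)"
      using S(1) deg_pos[OF G] unfolding supp_def
      by (intro sum_mono2) (auto simp: zero_le_mult_iff less_imp_le)
    also have "\<dots> = (\<Sum>u<N. \<Sum>j<k. deg N w u * (g j u)\<^sup>2)"
      unfolding len_def L2_set_power2 g_def by (simp add: sum_distrib_left power_mult_distrib mult.assoc)
    also have "\<dots> = (\<Sum>j<k. sqnorm N w (g j))" unfolding sqnorm_def by (rule sum.swap)
    finally show ?thesis using mass by simp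
  qed
  have sep1: "1 \<le> 1 / sep"
  proof -
    have "1 \<le> (real k)\<^sup>2 * sqrt (real k)"
      using mult_mono[of 1 "(real k)\<^sup>2" 1 "sqrt (real k)"] k' real_sqrt_ge_one[OF k'] by (simp add: one_le_power)
    then show ?thesis unfolding sep_def by simp
  qed
  have sep2: "(1 / sep)\<^sup>2 = 102400 * real k ^ 5"
  proof -
    have "(1 / sep)\<^sup>2 = 102400 * (((real k)\<^sup>2)\<^sup>2 * real k)"
      unfolding sep_def by (simp add: power_mult_distrib)
    also have "((real k)\<^sup>2)\<^sup>2 * real k = real k ^ 5" by (simp flip: power_mult power_Suc2)
    finally show ?thesis .
  qed
  have "(\<Sum>j<k. dual_energy N w (g j))
      \<le> (\<Sum>u<N. \<Sum>v<N. w u v * ((1 + 4 / sep) * L2_set (\<lambda>j. f j u + f j v) {..<k})\<^sup>2)"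
    unfolding energy g_def using G cutoff_edge
    by (intro sum_mono mult_left_mono power_mono) (auto simp: wgraph_def)
  also have "\<dots> = (1 + 4 / sep)\<^sup>2 * (\<Sum>j<k. dual_energy N w (f j))"
    unfolding energy power_mult_distrib sum_distrib_left by (intro sum.cong refl) (simp only: mult_ac)
  also have "\<dots> \<le> (5 * (1 / sep))\<^sup>2 * (\<Sum>j<k. 2 * \<mu>)"
  proof (intro mult_mono power_mono sum_mono)
    show "1 + 4 / sep \<le> 5 * (1 / sep)" using sep1 by simp
    show "0 \<le> (\<Sum>j<k. dual_energy N w (f j))" by (intro sum_nonneg dual_energy_nonneg[OF G])
  qed (use en sep_pos in auto)
  also have "\<dots> = 10240000 * real k ^ 6 * \<mu> * (1 / 2)"
  proof -
    have "real k ^ 6 = real k ^ 5 * real k" by (simp flip: power_Suc2)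
    then show ?thesis unfolding power_mult_distrib sep2 by simp
  qed
  also have "\<dots> \<le> 10240000 * real k ^ 6 * \<mu> * (\<Sum>j<k. sqnorm N w (g j))"
    using norm \<mu> by (intro mult_left_mono) auto
  finally show ?thesis
    using norm exists_good_coordinate[of k "\<lambda>j. dual_energy N w (g j)" "\<lambda>j. sqnorm N w (g j)" "10240000 * real k ^ 6 * \<mu>"]
      dual_energy_nonneg[OF G] sqnorm_nonneg[OF G] unfolding g_def by auto
qed

end

lemma localized_functions:
  assumes en: "\<And>j. j < k \<Longrightarrow> dual_energy N w (f j) \<le> 2 * \<mu>" and \<mu>: "0 \<le> \<mu>"
  shows "\<exists>g. (\<forall>i<k. 0 < sqnorm N w (g i) \<and> dual_energy N w (g i) \<le> 10240000 * real k ^ 6 * \<mu> * sqnorm N w (g i)) \<and>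
    (\<forall>i<k. \<forall>j<k. i \<noteq> j \<longrightarrow> (\<forall>u. g i u = 0 \<or> g j u = 0))"
proof -
  obtain S where S: "\<forall>i<k. S i \<subseteq> supp \<and> 1 / 2 \<le> (\<Sum>u\<in>S i. mass u)"
    "\<forall>i<k. \<forall>j<k. i \<noteq> j \<longrightarrow> (\<forall>u\<in>S i. \<forall>v\<in>S j. sep < line_dist u v)"
    using separated_clusters by blast
  have sub: "S i \<subseteq> supp" and ne: "S i \<noteq> {}" and ms: "1 / 2 \<le> (\<Sum>u\<in>S i. mass u)" if "i < k" for i
    using S(1) that by auto
  have "\<forall>i\<in>{..<k}. \<exists>j<k. 0 < sqnorm N w (\<lambda>u. cutoff (S i) u * f j u) \<and>
    dual_energy N w (\<lambda>u. cutoff (S i) u * f j u) \<le> 10240000 * real k ^ 6 * \<mu> * sqnorm N w (\<lambda>u. cutoff (S i) u * f j u)"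
    using cutoff_function[OF sub ne ms en \<mu>] by auto
  then obtain J where J: "\<forall>i\<in>{..<k}. J i < k \<and> 0 < sqnorm N w (\<lambda>u. cutoff (S i) u * f (J i) u) \<and>
    dual_energy N w (\<lambda>u. cutoff (S i) u * f (J i) u)
      \<le> 10240000 * real k ^ 6 * \<mu> * sqnorm N w (\<lambda>u. cutoff (S i) u * f (J i) u)"
    by (rule bchoice[THEN exE])
  define g where "g i u = cutoff (S i) u * f (J i) u" for i u
  have "\<forall>i<k. 0 < sqnorm N w (g i) \<and> dual_energy N w (g i) \<le> 10240000 * real k ^ 6 * \<mu> * sqnorm N w (g i)"
    using J unfolding g_def by auto
  moreover have "g i u = 0 \<or> g j u = 0" if ij: "i < k" "j < k" "i \<noteq> j" for i j u
  proof (rule ccontr)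
    assume "\<not> ?thesis"
    then have "cutoff (S i) u \<noteq> 0" "cutoff (S j) u \<noteq> 0" unfolding g_def by auto
    then obtain s t where st: "s \<in> S i" "line_dist u s < sep / 2" "t \<in> S j" "line_dist u t < sep / 2"
      using cutoff_support[OF sub ne] ij by meson
    have "line_dist s t \<le> line_dist s u + line_dist u t" unfolding line_dist_def by (rule proj_dist_triangle)
    also have "line_dist s u = line_dist u s" unfolding line_dist_def by (rule proj_dist_commute)
    finally have "line_dist s t < sep" using st by linarith
    moreover have "sep < line_dist s t" using S(2) ij st(1,3) by blast
    ultimately show False by simp
  qed
  ultimately show ?thesis by blast
qed

end

section \<open>Multi-way dual Cheeger constants\<close>

text \<open>The families range over functions on all naturals, so finiteness of the set under
  \<open>Max\<close> is not immediate; it holds because each minimum is a \<open>phibar\<close>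
  value of a pair of vertex sets.\<close>

lemma hbar_ge:
  assumes "1 \<le> k" and adm: "admissible_pairs N k A B" and x: "\<And>i. i < k \<Longrightarrow> x \<le> phibar N w (A i) (B i)"
  shows "x \<le> hbar N w k"
proof -
  let ?M = "\<lambda>A B. Min {phibar N w (A i) (B i) | i. i < k}"
  let ?X = "{?M A B | A B. admissible_pairs N k A B}"
  have Min_in: "\<exists>i<k. ?M A B = phibar N w (A i) (B i)" for A B
  proof -
    have "?M A B \<in> {phibar N w (A i) (B i) | i. i < k}" using assms(1) by (intro Min_in) (auto intro: exI[of _ 0])
    then show ?thesis by auto
  qed
  have "?X \<subseteq> (\<lambda>(P, Q). phibar N w P Q) ` (Pow {..<N} \<times> Pow {..<N})"
  proof
    fix y assume "y \<in> ?X"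
    then obtain A B where AB: "y = ?M A B" "admissible_pairs N k A B" by blast
    obtain i where "i < k" "y = phibar N w (A i) (B i)" using Min_in AB(1) by metis
    then show "y \<in> (\<lambda>(P, Q). phibar N w P Q) ` (Pow {..<N} \<times> Pow {..<N})"
      using AB(2) unfolding admissible_pairs_def by (intro image_eqI[of _ _ "(A i, B i)"]) auto
  qed
  then have "finite ?X" by (rule finite_subset) simp
  moreover have "?M A B \<in> ?X" using adm by blast
  ultimately have "?M A B \<le> hbar N w k" unfolding hbar_def by (rule Max_ge)
  moreover have "x \<le> ?M A B" using Min_in[of A B] x by auto
  ultimately show ?thesis by linarith
qed

text \<open>If gap \<open>l\<close> vanishes, the right-hand side is \<open>0\<close> by division by
  zero. Monotonicity then makes gap \<open>k\<close> and the energy of \<open>g\<close> vanish too,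
  and the zero-energy pair applies.\<close>

lemma dual_cheeger_pair:
  assumes G: "wgraph N w" and kl: "1 \<le> k" "k \<le> l" "l \<le> N"
    and g: "0 < sqnorm N w g" "dual_energy N w g \<le> c * dual_gap N w k * sqnorm N w g"
  shows "\<exists>A B. A \<subseteq> {u\<in>{..<N}. g u \<noteq> 0} \<and> B \<subseteq> {u\<in>{..<N}. g u \<noteq> 0} \<and> A \<inter> B = {} \<and> A \<union> B \<noteq> {} \<and>
    1 - phibar N w A B \<le> 16 * c * real l * dual_gap N w k / sqrt (dual_gap N w l)"
proof (cases "dual_gap N w l = 0")
  case True
  then have "dual_gap N w k = 0"
    using dual_gap_mono[OF G kl] dual_gap_bounds(1)[OF G, of k] kl by simp
  then have "dual_energy N w g = 0" using g(2) dual_energy_nonneg[OF G, of g] by simp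
  then show ?thesis using zero_dual_energy_pair[OF G g(1)] True by simp
next
  case False
  then have gap: "dual_gap N w l > 0" using dual_gap_bounds(1)[OF G, of l] kl by simp
  have "16 * real l * dual_energy N w g / sqnorm N w g / sqrt (dual_gap N w l)
      = 16 * real l * (dual_energy N w g / sqnorm N w g) / sqrt (dual_gap N w l)" by simp
  also have "\<dots> \<le> 16 * real l * (c * dual_gap N w k) / sqrt (dual_gap N w l)"
    using g gap by (intro divide_right_mono mult_left_mono) (auto simp: divide_le_eq)
  also have "\<dots> = 16 * c * real l * dual_gap N w k / sqrt (dual_gap N w l)" by (simp add: mult_ac)
  finally have le: "16 * real l * dual_energy N w g / sqnorm N w g / sqrt (dual_gap N w l)
      \<le> 16 * c * real l * dual_gap N w k / sqrt (dual_gap N w l)" .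
  obtain A B where AB: "A \<subseteq> {u\<in>{..<N}. g u \<noteq> 0}" "B \<subseteq> {u\<in>{..<N}. g u \<noteq> 0}" "A \<inter> B = {}" "A \<union> B \<noteq> {}"
    "1 - phibar N w A B \<le> 16 * real l * dual_energy N w g / sqnorm N w g / sqrt (dual_gap N w l)"
    using improved_dual_cheeger[OF G _ kl(3) gap g(1)] kl by auto
  have "1 - phibar N w A B \<le> 16 * c * real l * dual_gap N w k / sqrt (dual_gap N w l)"
    using AB(5) le by (rule order_trans)
  then show ?thesis using AB(1-4) by blast
qed

theorem theorem6p4:
  shows "\<exists>C::real. C > 0 \<and>
    (\<forall>N w k l. wgraph N w \<longrightarrow> 1 \<le> k \<longrightarrow> k \<le> l \<longrightarrow> l \<le> N \<longrightarrow>
       1 - hbar N w k \<le> C * real l * real k ^ 6 *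
         (2 - lambda N w (N - k + 1)) / sqrt (2 - lambda N w (N - l + 1)))"
proof (intro exI[of _ 163840000] conjI allI impI)
  fix N w k l assume G: "wgraph N w" and kl: "1 \<le> k" "k \<le> l" "l \<le> N"
  let ?\<mu> = "dual_gap N w k"
  have kN: "k \<le> N" using kl by simp
  obtain f where f: "\<forall>i<k. \<forall>j<k. (\<Sum>u<N. deg N w u * f i u * f j u) = (if i = j then 1 else 0)"
    "\<forall>i<k. dual_energy N w (f i) = 2 * dual_gap N w (k - i)"
    using dual_gap_eigenfunctions[OF G kl(1) kN] by (elim exE conjE)
  interpret spectral_embedding N w k f
    using G kl(1) f(1) by unfold_locales auto
  \<comment> \<open>Coordinate \<open>j\<close> belongs to gap number \<open>k - j\<close>, which is
    at most gap number \<open>k\<close>.\<close>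
  have "dual_energy N w (f j) \<le> 2 * ?\<mu>" if "j < k" for j
    using f(2) that dual_gap_mono[OF G, of "k - j" k] kN by simp
  then have "\<exists>g. (\<forall>i<k. 0 < sqnorm N w (g i) \<and>
        dual_energy N w (g i) \<le> 10240000 * real k ^ 6 * ?\<mu> * sqnorm N w (g i)) \<and>
      (\<forall>i<k. \<forall>j<k. i \<noteq> j \<longrightarrow> (\<forall>u. g i u = 0 \<or> g j u = 0))"
    using dual_gap_bounds(1)[OF G kl(1) kN] by (rule localized_functions)
  then obtain g where
    g: "\<forall>i<k. 0 < sqnorm N w (g i) \<and> dual_energy N w (g i) \<le> 10240000 * real k ^ 6 * ?\<mu> * sqnorm N w (g i)"
      "\<forall>i<k. \<forall>j<k. i \<noteq> j \<longrightarrow> (\<forall>u. g i u = 0 \<or> g j u = 0)" by (elim exE conjE)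
  \<comment> \<open>The final constant 163840000 is the product of the sweep constant 16 and the
    localization constant 10240000.\<close>
  define b where "b = 16 * (10240000 * real k ^ 6) * real l * ?\<mu> / sqrt (dual_gap N w l)"
  have "\<forall>i\<in>{..<k}. \<exists>P. fst P \<subseteq> {u\<in>{..<N}. g i u \<noteq> 0} \<and> snd P \<subseteq> {u\<in>{..<N}. g i u \<noteq> 0} \<and>
      fst P \<inter> snd P = {} \<and> fst P \<union> snd P \<noteq> {} \<and> 1 - phibar N w (fst P) (snd P) \<le> b"
  proof
    fix i assume "i \<in> {..<k}"
    then show "\<exists>P. fst P \<subseteq> {u\<in>{..<N}. g i u \<noteq> 0} \<and> snd P \<subseteq> {u\<in>{..<N}. g i u \<noteq> 0} \<and>
      fst P \<inter> snd P = {} \<and> fst P \<union> snd P \<noteq> {} \<and> 1 - phibar N w (fst P) (snd P) \<le> b"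
      using dual_cheeger_pair[OF G kl, of "g i" "10240000 * real k ^ 6"] g(1) unfolding b_def by simp
  qed
  then obtain P where P': "\<forall>i\<in>{..<k}. fst (P i) \<subseteq> {u\<in>{..<N}. g i u \<noteq> 0} \<and> snd (P i) \<subseteq> {u\<in>{..<N}. g i u \<noteq> 0} \<and>
      fst (P i) \<inter> snd (P i) = {} \<and> fst (P i) \<union> snd (P i) \<noteq> {} \<and> 1 - phibar N w (fst (P i)) (snd (P i)) \<le> b"
    by (rule bchoice[THEN exE])
  note P = bspec[OF P', OF lessThan_iff[THEN iffD2]]
  have sub: "fst (P i) \<union> snd (P i) \<subseteq> {u\<in>{..<N}. g i u \<noteq> 0}" if "i < k" for i
    using P[OF that] by simp
  have disj: "(fst (P i) \<union> snd (P i)) \<inter> (fst (P j) \<union> snd (P j)) = {}" if ij: "i < k" "j < k" "i \<noteq> j" for i j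
  proof -
    have "{u\<in>{..<N}. g i u \<noteq> 0} \<inter> {u\<in>{..<N}. g j u \<noteq> 0} = {}" using g(2) ij by auto
    then show ?thesis using sub[OF ij(1)] sub[OF ij(2)] by blast
  qed
  have "admissible_pairs N k (\<lambda>i. fst (P i)) (\<lambda>i. snd (P i))"
    unfolding admissible_pairs_def
  proof (intro conjI allI impI)
    fix i assume i: "i < k"
    show "fst (P i) \<subseteq> {..<N}" "snd (P i) \<subseteq> {..<N}" using sub[OF i] by auto
    show "fst (P i) \<union> snd (P i) \<noteq> {}" using P[OF i] by simp
    fix j assume j: "j < k"
    show "fst (P i) \<inter> snd (P j) = {}"
    proof (cases "i = j")
      case True
      then show ?thesis using P[OF i] by simp
    next
      case False
      then show ?thesis using disj[OF i j] by auto
    qed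
    assume "i \<noteq> j"
    then show "fst (P i) \<inter> fst (P j) = {}" "snd (P i) \<inter> snd (P j) = {}" using disj[OF i j] by auto
  qed
  moreover have "1 - b \<le> phibar N w (fst (P i)) (snd (P i))" if "i < k" for i using P[OF that] by linarith
  ultimately have "1 - b \<le> hbar N w k" by (intro hbar_ge[OF kl(1)])
  then show "1 - hbar N w k \<le> 163840000 * real l * real k ^ 6 *
      (2 - lambda N w (N - k + 1)) / sqrt (2 - lambda N w (N - l + 1))"
    unfolding b_def dual_gap_def by (simp add: mult_ac)
qed simp

end
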